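(* Let $\kappa:S_{g',b,0}\to S_{g,1,0}$ be a branched regular cover of finite index $m$ with $p$ branching points in the interior of $S_{g,1,0}$ which lift to $q$ points in $S_{g',b,0}$, let $\kappa':S_{g',b,q}\to S_{g,1,p}$ be the corresponding unbranched cover, and regard $\Sigma_{g',b,q}=\pi_1(S_{g',b,q},\hat\ast)$ as a normal subgroup of index $m$ of $\Sigma_{g,1,p}$ via $\kappa'_*$, with the basis $\hat x_{1},\dots,\hat x_{g'},\hat y_1,\dots,\hat y_{g'},\hat z_1,\dots,\hat z_{b-1},\hat t_1,\dots,\hat t_q$ described in the context. Suppose that $\Sigma_{g',b,q}$ is $\mathcal{AM}_{g,1,p}$-invariant. If $p\ge1$ let $d$ be the common order of the elements $t_k\Sigma_{g',b,q}$ $(1\le k\le p)$ of $\Sigma_{g,1,p}/\Sigma_{g',b,q}$. Suppose $(g,p,d)\ne(0,2,2)$. Then the composition $$\mathcal{AM}_{g,1,p}\to\mathcal{AM}_{g',1,(b-1)\perp q}\to\mathcal{AM}_{g',1,(b-1)},$$ where the first homomorphism is given by restriction to $\Sigma_{g',b,q}$ and the second homomorphism is given by eliminating the last $q$ punctures, is injective.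
   Context: Notation. $\mathbb{N}=\{0,1,2,\dots\}$; $\overline a=a^{-1}$; $a^b=\overline b a b$; $[x,y]=\overline x\,\overline y\,x\,y$; for a single group element $a$, $[a]$ is its conjugacy class. Automorphisms act on the right. $S_{g,b,p}$ is an orientable surface of genus $g$ with $b$ boundary components and $p$ punctures ($g,p\in\mathbb N$, $b\ge1$). Fundamental groups. $\Sigma_{g,1,p}$ is the free group on $x_1,\dots,x_g,y_1,\dots,y_g,t_1,\dots,t_p$, identified with $\pi_1(S_{g,1,p},\ast)$, $\ast$ a point of the boundary component, so that $t_k$ represents a loop around the $k$-th puncture and $\left([x_1,y_1]\cdots[x_g,y_g]t_1\cdots t_p\right)^{-1}$ a loop around the boundary. Put $Z=[x_1,y_1]\cdots[x_g,y_g]t_1\cdots t_p$. $\mathcal{AM}_{g,1,p}$ is the group of automorphisms of $\Sigma_{g,1,p}$ that fix $Z$ and permute the set of conjugacy classes $\{[\overline t_1],\dots,[\overline t_p]\}$. A subgroup is $\mathcal{AM}_{g,1,p}$-invariant if every element of $\mathcal{AM}_{g,1,p}$ maps it onto itself. The cover. The punctures of $S_{g,1,p}$ are the branching points of $\kappa$ and the punctures of $S_{g',b,q}$ are their preimages ($q=0$ iff $p=0$). The base point $\hat\ast$ lies in the $b$-th boundary component of $S_{g',b,q}$ and lies above $\ast$. Put $G=\Sigma_{g,1,p}/\Sigma_{g',b,q}$, a group of order $m$. Let $c$ be the order of $Z\Sigma_{g',b,q}$ in $G$; then $b=m/c$. For $1\le k\le p$ let $d_k$ be the order of $t_k\Sigma_{g',b,q}$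 in $G$; since the $k$-th puncture is a branching point, $t_k\notin\Sigma_{g',b,q}$ and $d_k\ge2$. If $\Sigma_{g',b,q}$ is $\mathcal{AM}_{g,1,p}$-invariant, all $d_k$ are equal; their common value is $d$ (if $p=0$ the condition $(g,p,d)\neq(0,2,2)$ holds automatically). The basis. $\Sigma_{g',b,q}$ is free of rank $2g'+b-1+q$ and $\hat x_1,\dots,\hat x_{g'},\hat y_1,\dots,\hat y_{g'},\hat z_1,\dots,\hat z_{b-1},\hat t_1,\dots,\hat t_q$ is a basis such that: (1) $[\hat x_1,\hat y_1]\cdots[\hat x_{g'},\hat y_{g'}]\,\hat z_1\cdots\hat z_{b-1}\,\hat t_1\cdots\hat t_q=Z^{c}$ in $\Sigma_{g,1,p}$; (2) for $1\le l\le b-1$, $\hat z_l=\overline w_l Z^{-c}w_l$ for some $w_l\in\Sigma_{g,1,p}-\Sigma_{g',b,q}$, where, with $\varrho=Z\Sigma_{g',b,q}$ and $\rho_l=w_l\Sigma_{g',b,q}$, $G$ is the disjoint union of $\langle\varrho\rangle\rho_1,\dots,\langle\varrho\rangle\rho_{b-1},\langle\varrho\rangle$; (3) $\{\hat t_1,\dots,\hat t_q\}$ is the disjoint union over $k=1,\dots,p$ of the sets $\{(t_k^{d_k})^{u_{1,k}},\dots,(t_k^{d_k})^{u_{m_k,k}}\}$, where $m_k=m/d_k$, $u_{i,k}\in\Sigma_{g,1,p}$, and $G$ is the disjoint union of the cosets $\langle t_k\Sigma_{g',b,q}\rangle\, u_{i,k}\Sigma_{g',b,q}$, $1\le i\le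 m_k$. The groups in the composition. Regarding the $\hat z_l$ as loops around punctures, $\mathcal{AM}_{g',1,(b-1)\perp q}$ is the group of automorphisms of the free group $\Sigma_{g',b,q}$ that fix $[\hat x_1,\hat y_1]\cdots[\hat x_{g'},\hat y_{g'}]\hat z_1\cdots\hat z_{b-1}\hat t_1\cdots\hat t_q$, permute the set of conjugacy classes (in $\Sigma_{g',b,q}$) of $\hat z_1^{-1},\dots,\hat z_{b-1}^{-1}$, and permute the set of conjugacy classes of $\hat t_1^{-1},\dots,\hat t_q^{-1}$. Restriction of elements of $\mathcal{AM}_{g,1,p}$ to $\Sigma_{g',b,q}$ gives elements of this group. Let $N$ be the normal closure of $\hat t_1,\dots,\hat t_q$ in $\Sigma_{g',b,q}$; the quotient $\Sigma_{g',b,q}/N$ is free on the images of the $\hat x_i,\hat y_i,\hat z_l$ and is identified with $\Sigma_{g',1,(b-1)}$, the image of $\hat z_l$ being the $l$-th puncture generator. Eliminating the last $q$ punctures sends an element of $\mathcal{AM}_{g',1,(b-1)\perp q}$ to the automorphism it induces on $\Sigma_{g',b,q}/N=\Sigma_{g',1,(b-1)}$, which lies in $\mathcal{AM}_{g',1,(b-1)}$. *)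

theory Defs
  imports
    "HOL-Algebra.Bij" "HOL-Algebra.Generated_Groups" "HOL-Algebra.Multiplicative_Group"
    "HOL-Library.Disjoint_Sets"
begin

section \<open>Free groups\<close>

text \<open>A letter \<open>(a, True)\<close> stands for \<open>a\<close>, and \<open>(a, False)\<close> for the inverse of \<open>a\<close>.\<close>

definition word_val :: "('a, 'm) monoid_scheme \<Rightarrow> ('a \<times> bool) list \<Rightarrow> 'a" where
  "word_val G w = foldr (\<lambda>(a, e) r. (if e then a else inv\<^bsub>G\<^esub> a) \<otimes>\<^bsub>G\<^esub> r) w \<one>\<^bsub>G\<^esub>"

definition reduced_word :: "('a \<times> bool) list \<Rightarrow> bool" where
  "reduced_word w \<longleftrightarrow> successively (\<lambda>(a, e) (a', e'). \<not> (a = a' \<and> e \<noteq> e')) w"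

definition free_basis :: "('a, 'm) monoid_scheme \<Rightarrow> 'a set \<Rightarrow> bool" where
  "free_basis G B \<longleftrightarrow>
     B \<subseteq> carrier G \<and> generate G B = carrier G \<and>
     (\<forall>w. w \<noteq> [] \<and> fst ` set w \<subseteq> B \<and> reduced_word w \<longrightarrow> word_val G w \<noteq> \<one>\<^bsub>G\<^esub>)"

section \<open>Conjugation and normal closures\<close>

text \<open>Conjugation acts on the right, and the commutator is the one that fits this convention;
  it differs from the commutator used for \<^const>\<open>derived\<close>.\<close>

definition conj_by :: "('a, 'm) monoid_scheme \<Rightarrow> 'a \<Rightarrow> 'a \<Rightarrow> 'a" where
  "conj_by G a b = inv\<^bsub>G\<^esub> b \<otimes>\<^bsub>G\<^esub> a \<otimes>\<^bsub>G\<^esub> b"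

definition comm :: "('a, 'm) monoid_scheme \<Rightarrow> 'a \<Rightarrow> 'a \<Rightarrow> 'a" where
  "comm G x y = inv\<^bsub>G\<^esub> x \<otimes>\<^bsub>G\<^esub> inv\<^bsub>G\<^esub> y \<otimes>\<^bsub>G\<^esub> x \<otimes>\<^bsub>G\<^esub> y"

definition conj_class :: "('a, 'm) monoid_scheme \<Rightarrow> 'a \<Rightarrow> 'a set" where
  "conj_class G a = conj_by G a ` carrier G"

definition normal_closure :: "('a, 'm) monoid_scheme \<Rightarrow> 'a set \<Rightarrow> 'a set" where
  "normal_closure G A = generate G (\<Union>a\<in>A. conj_class G a)"

section \<open>Algebraic mapping class groups\<close>

text \<open>The product \<open>[x\<^sub>1,y\<^sub>1]\<cdots>[x\<^sub>g,y\<^sub>g] s\<^sub>1\<cdots>s\<^sub>n\<close> for a list \<open>ss = [s\<^sub>1,\<dots>,s\<^sub>n]\<close>.\<close>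

definition surface_word ::
    "('a, 'm) monoid_scheme \<Rightarrow> nat \<Rightarrow> (nat \<Rightarrow> 'a) \<Rightarrow> (nat \<Rightarrow> 'a) \<Rightarrow> 'a list \<Rightarrow> 'a" where
  "surface_word G g x y ss =
     foldr (\<otimes>\<^bsub>G\<^esub>) (map (\<lambda>i. comm G (x i) (y i)) [1..<g+1] @ ss) \<one>\<^bsub>G\<^esub>"

text \<open>For a list \<open>pss\<close> of blocks of puncture generators: the automorphisms that fix the surface word
  and permute, for each block separately, the conjugacy classes of the inverses of its members.
  One block gives \<open>\<A>\<M>\<^bsub>g,1,p\<^esub>\<close>, two blocks give \<open>\<A>\<M>\<^bsub>g,1,p\<bottom>q\<^esub>\<close>.

  Composition in \<^const>\<open>AutoGroup\<close> is that of left actions. For automorphisms acting on the right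
  one has the opposite groups; these have the same carriers, and the same maps between them are
  homomorphisms.\<close>

definition AM ::
    "('a, 'm) monoid_scheme \<Rightarrow> nat \<Rightarrow> (nat \<Rightarrow> 'a) \<Rightarrow> (nat \<Rightarrow> 'a) \<Rightarrow> 'a list list \<Rightarrow> ('a \<Rightarrow> 'a) monoid"
  where
  "AM G g x y pss =
     AutoGroup G \<lparr>carrier :=
       {\<phi> \<in> auto G.
          \<phi> (surface_word G g x y (concat pss)) = surface_word G g x y (concat pss) \<and>
          (\<forall>ps\<in>set pss.
             (\<lambda>C. \<phi> ` C) ` (\<lambda>s. conj_class G (inv\<^bsub>G\<^esub> s)) ` set ps =
               (\<lambda>s. conj_class G (inv\<^bsub>G\<^esub> s)) ` set ps)}\<rparr>"

definition restrict_to :: "'a set \<Rightarrow> ('a \<Rightarrow> 'a) \<Rightarrow> 'a \<Rightarrow> 'a" where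
  "restrict_to H \<phi> = restrict \<phi> H"

text \<open>If \<open>\<phi>\<close> is an automorphism of \<open>G\<close> that maps the normal subgroup \<open>N\<close> onto itself, then
  \<open>\<phi> ` (N #> a) = N #> \<phi> a\<close>.\<close>

definition induced_on_quotient ::
    "('a, 'm) monoid_scheme \<Rightarrow> 'a set \<Rightarrow> ('a \<Rightarrow> 'a) \<Rightarrow> 'a set \<Rightarrow> 'a set" where
  "induced_on_quotient G N \<phi> = restrict (\<lambda>C. \<phi> ` C) (carrier (G Mod N))"

definition disjoint_union :: "'b set \<Rightarrow> 'i set \<Rightarrow> ('i \<Rightarrow> 'b set) \<Rightarrow> bool" where
  "disjoint_union S I A \<longleftrightarrow> disjoint_family_on A I \<and> (\<Union>i\<in>I. A i) = S"

end

(*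
The free group F acts on the planar tree given by a ribbon graph of the surface, and its vertices
inherit a cyclic order from the corners at which the base point sits. An automorphism phi in the
algebraic mapping class group preserves this order: for fixed s and r the difference of
(phi a, phi s, phi r) and (a, s, r) as a function of a changes along finitely many edges only, is
invariant under right multiplication by the boundary word Z and has equal limits along t^n and t^-n;
since the lines spelled by Z and by the t_k pass through all corners of the tree, such a function
is constant. Hence images of basis elements do not cross their translates, so that no square of a
puncture generator occurs in their reduced words.

If phi becomes trivial on H / N, then e^-1 phi(e) centralizes a subgroup of finite index in F / N, the
free product of a free group of rank 2g and p cyclic groups of order d. Such a centralizer is trivial
unless (g, p) = (0, 1) or (g, p, d) = (0, 2, 2). So phi(e) and e agree in F / N, and since the reduced
word of phi(e) is square-free in the puncture generators, it can be read off from the normal form.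
*)

theory Submission
  imports Defs
begin

section \<open>Words\<close>

text \<open>Knowing \<open>\<phi>\<close> modulo \<open>N\<close> says little about
  \<open>\<phi>\<close> itself: there t and t^(d+1) agree, so a congruence of \<phi>(e) and e is far
  from equality. The planar order supplies what is missing. Once squares are excluded, a single
  ambiguity is left, t against t^-1 for d = 2; it is removed by the exponent sum, because
  \<phi>(t_k) is conjugate to some t_j. The centralizing property comes from normality of H: for h
  in H both h and e h e^-1 are fixed modulo N, and comparing the image of e h e^-1 with its factors
  gives that e^-1 \<phi>(e) commutes with h. The exceptions are those where F / N is too small. For
  (0, 2, 2) it is infinite dihedral, with an abelian subgroup of index 2. For (0, 1) it is cyclic,
  but then Z = t_1, which \<open>\<phi>\<close> fixes by definition. The group F / N itself is not
  formed. F acts on the normal forms of the free product, N acts trivially, and all statements about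
  F / N are read off from this action.\<close>

definition flip :: "'a \<times> bool \<Rightarrow> 'a \<times> bool" where
  "flip l = (fst l, \<not> snd l)"

definition winv :: "('a \<times> bool) list \<Rightarrow> ('a \<times> bool) list" where
  "winv w = rev (map flip w)"

text \<open>On reduced words this is left multiplication by the letter \<open>l\<close> in the free
  group.\<close>

definition cons_red :: "'a \<times> bool \<Rightarrow> ('a \<times> bool) list \<Rightarrow> ('a \<times> bool) list" where
  "cons_red l w = (if w \<noteq> [] \<and> hd w = flip l then tl w else l # w)"

lemma flip_flip [simp]: "flip (flip l) = l"
  by (simp add: flip_def)

lemma flip_neq [simp]: "flip l \<noteq> l" "l \<noteq> flip l"
  by (auto simp: flip_def prod_eq_iff)

lemma flip_eq_iff [simp]: "flip l = flip l' \<longleftrightarrow> l = l'"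
  by (metis flip_flip)

lemma fst_flip [simp]: "fst (flip l) = fst l"
  by (simp add: flip_def)

lemma flip_Pair [simp]: "flip (a, e) = (a, \<not> e)"
  by (simp add: flip_def)

lemma winv_simps [simp]: "winv [] = []" "winv (l # w) = winv w @ [flip l]"
  "winv (u @ v) = winv v @ winv u"
  by (auto simp: winv_def)

lemma winv_winv [simp]: "winv (winv w) = w"
  by (induction w) auto

lemma winv_eq_Nil [simp]: "winv w = [] \<longleftrightarrow> w = []"
  by (simp add: winv_def)

lemma set_winv: "set (winv w) = flip ` set w"
  by (simp add: winv_def)

lemma hd_winv: "w \<noteq> [] \<Longrightarrow> hd (winv w) = flip (last w)"
  by (simp add: winv_def hd_rev last_map)

lemma last_winv: "w \<noteq> [] \<Longrightarrow> last (winv w) = flip (hd w)"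
  by (simp add: winv_def last_rev hd_map)

lemma reduced_word_successively: "reduced_word w \<longleftrightarrow> successively (\<lambda>l l'. l' \<noteq> flip l) w"
  unfolding reduced_word_def
  by (rule successively_cong) (auto simp: flip_def prod_eq_iff)

lemma reduced_word_Nil [simp]: "reduced_word []"
  by (simp add: reduced_word_successively)

lemma reduced_word_Cons [simp]:
  "reduced_word (l # w) \<longleftrightarrow> (w = [] \<or> hd w \<noteq> flip l) \<and> reduced_word w"
  by (auto simp: reduced_word_successively successively_Cons)

lemma reduced_word_append:
  "reduced_word (u @ v) \<longleftrightarrow>
     reduced_word u \<and> reduced_word v \<and> (u = [] \<or> v = [] \<or> hd v \<noteq> flip (last u))"
  by (auto simp: reduced_word_successively successively_append_iff)

lemma reduced_word_winv [simp]: "reduced_word (winv w) \<longleftrightarrow> reduced_word w"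
proof (induction w)
  case (Cons l w)
  then show ?case
    by (cases "w = []") (auto simp: reduced_word_append last_winv)
qed simp

lemma reduced_word_cons_red: "reduced_word w \<Longrightarrow> reduced_word (cons_red l w)"
  by (cases w) (auto simp: cons_red_def)

lemma reduced_word_replicate [simp]: "reduced_word (replicate k l)"
proof (induction k)
  case (Suc k)
  then show ?case by (cases k) auto
qed simp

lemma cons_red_flip: "reduced_word w \<Longrightarrow> cons_red (flip l) (cons_red l w) = w"
  by (cases w) (auto simp: cons_red_def)

lemma set_cons_red: "set (cons_red l w) \<subseteq> insert l (set w)"
  by (cases w) (auto simp: cons_red_def)

section \<open>Adjacent entries of a list\<close>

text \<open>Corners of a ribbon graph are consecutive pairs. The splitting form passes easily
  through concatenation; for distinct lists it amounts to succession of positions.\<close>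

definition adj :: "'b list \<Rightarrow> 'b \<Rightarrow> 'b \<Rightarrow> bool" where
  "adj xs a b \<longleftrightarrow> (\<exists>p s. xs = p @ a # b # s)"

lemma adj_Nil [simp]: "\<not> adj [] a b"
  by (simp add: adj_def)

lemma adj_Cons: "adj (x # xs) a b \<longleftrightarrow> adj xs a b \<or> (xs \<noteq> [] \<and> a = x \<and> b = hd xs)"
proof
  assume "adj (x # xs) a b"
  then obtain p s where "x # xs = p @ a # b # s" by (auto simp: adj_def)
  then show "adj xs a b \<or> (xs \<noteq> [] \<and> a = x \<and> b = hd xs)"
    by (cases p) (auto simp: adj_def)
next
  assume "adj xs a b \<or> (xs \<noteq> [] \<and> a = x \<and> b = hd xs)"
  then show "adj (x # xs) a b"
  proof
    assume "adj xs a b"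
    then obtain p s where "xs = p @ a # b # s" by (auto simp: adj_def)
    then have "x # xs = (x # p) @ a # b # s" by simp
    then show ?thesis unfolding adj_def by blast
  next
    assume "xs \<noteq> [] \<and> a = x \<and> b = hd xs"
    then have "x # xs = [] @ a # b # tl xs" by simp
    then show ?thesis unfolding adj_def by blast
  qed
qed

lemma adj_append:
  "adj (xs @ ys) a b \<longleftrightarrow>
     adj xs a b \<or> adj ys a b \<or> (xs \<noteq> [] \<and> ys \<noteq> [] \<and> a = last xs \<and> b = hd ys)"
  by (induction xs) (auto simp: adj_Cons)

lemma adj_in_set: "adj xs a b \<Longrightarrow> a \<in> set xs \<and> b \<in> set xs"
  by (auto simp: adj_def)

lemma reduced_word_adj: "reduced_word w \<longleftrightarrow> (\<forall>l l'. adj w l l' \<longrightarrow> l' \<noteq> flip l)"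
proof (induction w)
  case (Cons x w)
  have "(\<forall>l l'. adj (x # w) l l' \<longrightarrow> l' \<noteq> flip l) \<longleftrightarrow>
      (\<forall>l l'. adj w l l' \<longrightarrow> l' \<noteq> flip l) \<and> (w \<noteq> [] \<longrightarrow> hd w \<noteq> flip x)"
    unfolding adj_Cons by metis
  then show ?case using Cons by auto
qed simp

text \<open>Positions start at 1 because 0 is kept for the base point in the cyclic order at a
  vertex.\<close>

primrec pos :: "'b list \<Rightarrow> 'b \<Rightarrow> nat" where
  "pos [] l = 1"
| "pos (a # as) l = (if l = a then 1 else Suc (pos as l))"

lemma pos_ge_1 [simp]: "Suc 0 \<le> pos xs l"
  by (induction xs) auto

lemma pos_neq_0 [simp]: "pos xs l \<noteq> 0" "0 < pos xs l"
  by (induction xs) auto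

lemma pos_le: "l \<in> set xs \<Longrightarrow> pos xs l \<le> length xs"
  by (induction xs) auto

lemma nth_pos: "l \<in> set xs \<Longrightarrow> xs ! (pos xs l - 1) = l"
proof (induction xs)
  case (Cons a xs)
  then show ?case by (auto simp: nth_Cons split: nat.split)
qed simp

lemma pos_inj: "l \<in> set xs \<Longrightarrow> l' \<in> set xs \<Longrightarrow> pos xs l = pos xs l' \<longleftrightarrow> l = l'"
  by (metis nth_pos)

lemma pos_surj: "distinct xs \<Longrightarrow> 1 \<le> i \<Longrightarrow> i \<le> length xs \<Longrightarrow> \<exists>l\<in>set xs. pos xs l = i"
proof (induction xs arbitrary: i)
  case (Cons a xs)
  show ?case
  proof (cases "i = 1")
    case False
    then obtain l where "l \<in> set xs" "pos xs l = i - 1"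
      using Cons.IH[of "i - 1"] Cons.prems False by fastforce
    moreover from this have "l \<noteq> a" using Cons.prems by auto
    ultimately show ?thesis using False Cons.prems by (intro bexI[of _ l]) auto
  qed simp
qed simp

lemma adj_iff_pos:
  assumes "distinct xs" "a \<in> set xs" "b \<in> set xs"
  shows "adj xs a b \<longleftrightarrow> pos xs b = Suc (pos xs a)"
  using assms
proof (induction xs)
  case (Cons x xs)
  show ?case
  proof (cases "a = x")
    case True
    then have "\<not> adj xs a b" using Cons.prems adj_in_set[of xs a b] by auto
    moreover have "pos xs b = 1 \<longleftrightarrow> xs \<noteq> [] \<and> b = hd xs" if "b \<noteq> x"
      using Cons.prems that by (cases xs) auto
    moreover have "xs \<noteq> [] \<Longrightarrow> hd xs \<noteq> x" using Cons.prems by auto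
    ultimately show ?thesis using True Cons.prems by (auto simp: adj_Cons)
  next
    case False
    then show ?thesis
      using Cons adj_in_set[of xs a b] by (auto simp: adj_Cons)
  qed
qed simp

lemma pos_hd: "xs \<noteq> [] \<Longrightarrow> pos xs (hd xs) = 1"
  by (cases xs) auto

lemma pos_last: "distinct xs \<Longrightarrow> xs \<noteq> [] \<Longrightarrow> pos xs (last xs) = length xs"
  by (induction xs) auto

section \<open>The cyclic order of a ribbon graph\<close>

text \<open>\<open>E\<close> lists the edges leaving a vertex, beginning at the corner of the base
  point, and \<open>Z\<close> is the boundary word. Arriving along \<open>l\<close> and leaving
  along \<open>l'\<close> is a turn through the corner between \<open>flip l\<close> and
  \<open>l'\<close>. So \<open>Z\<close> starts and ends at the base point corner, all its turns are
  corners of \<open>E\<close>, and every corner missed by \<open>Z\<close> lies between the two ends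
  of a puncture loop in \<open>T\<close>.\<close>

definition ribbon_pair ::
    "('a \<times> bool) list \<Rightarrow> ('a \<times> bool) list \<Rightarrow> ('a \<times> bool) set \<Rightarrow> bool" where
  "ribbon_pair E Z T \<longleftrightarrow>
     E \<noteq> [] \<and> Z \<noteq> [] \<and> hd Z = hd E \<and> flip (last Z) = last E \<and>
     (\<forall>l l'. adj Z l l' \<longrightarrow> adj E (flip l) l') \<and>
     (\<forall>e e'. adj E e e' \<longrightarrow> adj Z (flip e) e' \<or> (e \<in> T \<and> e' = flip e)) \<and>
     (\<forall>t\<in>T. adj E t (flip t))"

text \<open>This is boundary connected sum: the one new corner, between \<open>last E\<close> and
  \<open>hd E'\<close>, is the turn at which \<open>Z\<close> passes into \<open>Z'\<close>.\<close>

lemma ribbon_pair_append: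
  "ribbon_pair E Z T \<Longrightarrow> ribbon_pair E' Z' T' \<Longrightarrow> ribbon_pair (E @ E') (Z @ Z') (T \<union> T')"
proof -
  assume 1: "ribbon_pair E Z T" and 2: "ribbon_pair E' Z' T'"
  have ne: "E \<noteq> []" "Z \<noteq> []" "E' \<noteq> []" "Z' \<noteq> []"
    and ends: "hd Z = hd E" "hd Z' = hd E'" "flip (last Z) = last E" "flip (last Z') = last E'"
      "last Z = flip (last E)"
    using 1 2 unfolding ribbon_pair_def by (metis flip_flip)+
  have "adj (E @ E') (flip l) l'" if "adj (Z @ Z') l l'" for l l'
    using that 1 2 ne ends unfolding adj_append ribbon_pair_def by metis
  moreover have "adj (Z @ Z') (flip e) e' \<or> (e \<in> T \<union> T' \<and> e' = flip e)" if "adj (E @ E') e e'" for e e'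
    using that 1 2 ne ends unfolding adj_append ribbon_pair_def by (metis UnCI)
  moreover have "adj (E @ E') t (flip t)" if "t \<in> T \<union> T'" for t
    using that 1 2 unfolding adj_append ribbon_pair_def by blast
  ultimately show ?thesis
    using ne ends unfolding ribbon_pair_def by auto
qed

lemma ribbon_pair_concat:
  assumes "bs \<noteq> []" "\<And>b. b \<in> set bs \<Longrightarrow> ribbon_pair (E b) (Z b) (T b)"
  shows "ribbon_pair (concat (map E bs)) (concat (map Z bs)) (\<Union>b\<in>set bs. T b)"
  using assms
proof (induction bs)
  case (Cons b bs)
  then show ?case by (cases "bs = []") (auto intro: ribbon_pair_append)
qed simp

text \<open>The value 1 means that the first argument comes before the second;
  \<open>ord_words\<close> inherits this sign.\<close>

definition cmp :: "nat \<Rightarrow> nat \<Rightarrow> int" where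
  "cmp i j = (if i < j then 1 else if j < i then -1 else 0)"

locale ribbon =
  fixes E Z :: "('a \<times> bool) list" and T :: "('a \<times> bool) set"
  assumes ribbon: "ribbon_pair E Z T"
    and distinct_E: "distinct E"
    and flip_closed: "\<And>l. l \<in> set E \<Longrightarrow> flip l \<in> set E"
begin

lemma ribbon_ends: "E \<noteq> []" "Z \<noteq> []" "hd Z = hd E" "flip (last Z) = last E"
  and ribbon_adj_Z: "adj Z l l' \<Longrightarrow> adj E (flip l) l'"
  and ribbon_adj_E: "adj E e e' \<Longrightarrow> adj Z (flip e) e' \<or> (e \<in> T \<and> e' = flip e)"
  and ribbon_adj_T: "t \<in> T \<Longrightarrow> adj E t (flip t)"
  using ribbon unfolding ribbon_pair_def by metis+

lemma flip_in_E [simp]: "flip l \<in> set E \<longleftrightarrow> l \<in> set E"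
  using flip_closed flip_flip by metis

lemma set_winv_subset_E [simp]: "set (winv w) \<subseteq> set E \<longleftrightarrow> set w \<subseteq> set E"
  unfolding set_winv image_subset_iff flip_in_E by blast

text \<open>For places up to \<open>length E\<close> this is \<open>k - r\<close> modulo
  \<open>length E + 1\<close>: the base point occupies a place of its own besides the
  letters.\<close>

definition key :: "nat \<Rightarrow> nat \<Rightarrow> nat" where
  "key r k = (if r \<le> k then k - r else k + Suc (length E) - r)"

text \<open>The position of the end of a word is \<open>0\<close>: at every vertex of the Cayley tree the base point
  sits in the corner between the last and the first letter of \<open>E\<close>. The letters that leave a vertex
  are compared in the cyclic order that starts from the edge \<open>r\<close> through which it was reached.\<close>

fun ord_words :: "nat \<Rightarrow> ('a \<times> bool) list \<Rightarrow> ('a \<times> bool) list \<Rightarrow> int" where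
  "ord_words r [] [] = 0"
| "ord_words r [] (b # v) = cmp (key r 0) (key r (pos E b))"
| "ord_words r (a # u) [] = cmp (key r (pos E a)) (key r 0)"
| "ord_words r (a # u) (b # v) =
     (if a = b then ord_words (pos E (flip a)) u v
      else cmp (key r (pos E a)) (key r (pos E b)))"

text \<open>The orientation of a triple. The linear order depends on where the cycle is cut open,
  the cyclic sum does not. As the coboundary of an antisymmetric function it satisfies the cocycle
  identity formally, with no appeal to transitivity.\<close>

definition cyc :: "('a \<times> bool) list \<Rightarrow> ('a \<times> bool) list \<Rightarrow> ('a \<times> bool) list \<Rightarrow> int" where
  "cyc u v w = ord_words 0 u v + ord_words 0 v w + ord_words 0 w u"

lemma key_0 [simp]: "key 0 k = k"
  by (simp add: key_def)

lemma ord_words_antisym: "ord_words r u v = - ord_words r v u"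
  by (induction r u v rule: ord_words.induct) (auto simp: cmp_def)

lemma ord_words_refl [simp]: "ord_words r u u = 0"
  using ord_words_antisym[of r u u] by simp

lemma cyc_degenerate [simp]: "cyc u u w = 0"
  using ord_words_antisym[of 0 u w] by (simp add: cyc_def)

lemma cyc_cocycle: "cyc b c d - cyc a c d = cyc a b c - cyc a b d"
  using ord_words_antisym[of 0 a b] ord_words_antisym[of 0 a c] ord_words_antisym[of 0 a d]
    ord_words_antisym[of 0 b c] ord_words_antisym[of 0 b d] ord_words_antisym[of 0 c d]
  by (simp add: cyc_def)

section \<open>Invariance of the cyclic order under left multiplication\<close>

definition hd_pos :: "('a \<times> bool) list \<Rightarrow> nat" where
  "hd_pos u = (if u = [] then 0 else pos E (hd u))"

lemma hd_pos_simps [simp]: "hd_pos [] = 0" "hd_pos (a # u) = pos E a"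
  by (auto simp: hd_pos_def)

lemma hd_pos_le: "set u \<subseteq> set E \<Longrightarrow> hd_pos u \<le> length E"
  by (cases u) (auto simp: pos_le)

lemma hd_pos_neq_flip:
  "reduced_word (l # u) \<Longrightarrow> set (l # u) \<subseteq> set E \<Longrightarrow> hd_pos u \<noteq> pos E (flip l)"
  by (cases u) (auto simp: pos_inj)

lemma ord_words_hd_neq:
  "hd_pos u \<noteq> hd_pos v \<Longrightarrow> ord_words r u v = cmp (key r (hd_pos u)) (key r (hd_pos v))"
  by (cases u; cases v) auto

lemma ord_words_hd_eq:
  assumes "hd_pos u = hd_pos v" "set u \<subseteq> set E" "set v \<subseteq> set E"
  shows "ord_words r u v = ord_words r' u v"
  using assms by (cases u; cases v) (auto simp: pos_inj)

text \<open>Starting the cycle at \<open>r\<close> puts the places below \<open>r\<close> behind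
  those above it, so only pairs separated by \<open>r\<close> change sign.\<close>

lemma cmp_key_rotate:
  assumes "i \<le> length E" "j \<le> length E" "r \<le> length E" "i \<noteq> r" "j \<noteq> r" "i \<noteq> j"
  shows "cmp (key r i) (key r j) = cmp i j - 2 * (of_bool (i < r) - of_bool (j < r))"
  using assms by (auto simp: cmp_def key_def)

text \<open>The indicator of the initial segment that left multiplication by \<open>e\<close> moves.
  Words through \<open>flip e\<close> are compared from \<open>e\<close> on at the next vertex, so
  there the places above \<open>e\<close> form the initial piece.\<close>

definition rot :: "'a \<times> bool \<Rightarrow> ('a \<times> bool) list \<Rightarrow> int" where
  "rot e u = (if u \<noteq> [] \<and> hd u = flip e then of_bool (pos E e < hd_pos (tl u))
              else of_bool (hd_pos u < pos E (flip e)))"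

text \<open>Left multiplication by a letter moves an initial segment of the linear order to its end.\<close>

lemma ord_words_cons_red:
  assumes e: "e \<in> set E" and u: "reduced_word u" "set u \<subseteq> set E"
    and v: "reduced_word v" "set v \<subseteq> set E"
  shows "ord_words 0 (cons_red e u) (cons_red e v) = ord_words 0 u v - 2 * (rot e u - rot e v)"
proof -
  let ?r = "pos E (flip e)" and ?s = "pos E e"
  have rs: "?r \<le> length E" "?s \<le> length E" "flip e \<in> set E"
    using e by (simp_all add: pos_le)
  \<comment> \<open>If exactly one of the words cancels, the comparison is decided at the root both
    before and after the multiplication. The case \<open>ab\<close> below is the same by
    antisymmetry.\<close>
  have mixed: "ord_words 0 (cons_red e u) (cons_red e v) = ord_words 0 u v - 2 * (rot e u - rot e v)"
    if "u = flip e # u'" "\<not> (v \<noteq> [] \<and> hd v = flip e)"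
      "reduced_word u" "set u \<subseteq> set E" "reduced_word v" "set v \<subseteq> set E" for u v u'
  proof -
    have 1: "hd_pos u' \<noteq> ?s" using that hd_pos_neq_flip[of "flip e" u'] by auto
    have 2: "hd_pos v \<noteq> ?r" using that rs by (cases v) (auto simp: pos_inj)
    have a: "cons_red e u = u'" "cons_red e v = e # v" using that by (auto simp: cons_red_def)
    have "ord_words 0 u' (e # v) = cmp (hd_pos u') ?s"
      using 1 ord_words_hd_neq[of u' "e # v" 0] by simp
    moreover have "ord_words 0 u v = cmp ?r (hd_pos v)"
      using 2 that ord_words_hd_neq[of u v 0] by simp
    ultimately show ?thesis using 1 2 that unfolding a by (auto simp: rot_def cmp_def)
  qed
  consider (aa) "\<not> (u \<noteq> [] \<and> hd u = flip e)" "\<not> (v \<noteq> [] \<and> hd v = flip e)"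
    | (bb) u' v' where "u = flip e # u'" "v = flip e # v'"
    | (ba) u' where "u = flip e # u'" "\<not> (v \<noteq> [] \<and> hd v = flip e)"
    | (ab) v' where "v = flip e # v'" "\<not> (u \<noteq> [] \<and> hd u = flip e)"
    by (metis list.collapse)
  then show ?thesis
  proof cases
    case aa
    have 1: "hd_pos u \<noteq> ?r" using aa u rs by (cases u) (auto simp: pos_inj)
    have 2: "hd_pos v \<noteq> ?r" using aa v rs by (cases v) (auto simp: pos_inj)
    have *: "ord_words 0 (cons_red e u) (cons_red e v) = ord_words ?r u v"
      using aa by (auto simp: cons_red_def)
    show ?thesis
    proof (cases "hd_pos u = hd_pos v")
      case True
      then show ?thesis
        using ord_words_hd_eq[of u v ?r 0] aa u v unfolding * by (auto simp: rot_def)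
    next
      case False
      then show ?thesis
        using ord_words_hd_neq[of u v] cmp_key_rotate[of "hd_pos u" "hd_pos v" ?r]
          1 2 aa hd_pos_le u v rs unfolding * by (auto simp: rot_def)
    qed
  next
    case bb
    have 1: "hd_pos u' \<noteq> ?s" using bb u hd_pos_neq_flip[of "flip e" u'] by auto
    have 2: "hd_pos v' \<noteq> ?s" using bb v hd_pos_neq_flip[of "flip e" v'] by auto
    have *: "cons_red e u = u'" "cons_red e v = v'" using bb by (auto simp: cons_red_def)
    have sub: "set u' \<subseteq> set E" "set v' \<subseteq> set E" using bb u v by auto
    show ?thesis
    proof (cases "hd_pos u' = hd_pos v'")
      case True
      then show ?thesis
        using ord_words_hd_eq[of u' v' ?s 0] bb sub unfolding * by (auto simp: rot_def)
    next
      case False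
      have "cmp (key ?s (hd_pos u')) (key ?s (hd_pos v')) =
          cmp (hd_pos u') (hd_pos v') + 2 * (of_bool (?s < hd_pos u') - of_bool (?s < hd_pos v'))"
        using cmp_key_rotate[of "hd_pos u'" "hd_pos v'" ?s] False 1 2 hd_pos_le[OF sub(1)]
          hd_pos_le[OF sub(2)] rs by auto
      then show ?thesis
        using False ord_words_hd_neq[of u' v'] bb unfolding * by (auto simp: rot_def)
    qed
  next
    case ba
    then show ?thesis using mixed[OF ba u v] by simp
  next
    case ab
    then show ?thesis
      using mixed[OF ab v u] ord_words_antisym[of 0 "cons_red e u" "cons_red e v"]
        ord_words_antisym[of 0 u v] by (simp add: algebra_simps)
  qed
qed

text \<open>The corrections by \<open>rot\<close> are differences, so they cancel in the cyclic
  sum.\<close>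

lemma cyc_cons_red:
  assumes "e \<in> set E" "reduced_word u" "set u \<subseteq> set E" "reduced_word v" "set v \<subseteq> set E"
    "reduced_word w" "set w \<subseteq> set E"
  shows "cyc (cons_red e u) (cons_red e v) (cons_red e w) = cyc u v w"
  using assms by (simp add: cyc_def ord_words_cons_red)

text \<open>Comparison with \<open>s\<close> reads the letters of \<open>s\<close> and then asks
  whether, and with which letter, the other word continues; this accounts for the
  \<open>Suc\<close>. Far out in the tree the comparison with a fixed word is therefore locally
  constant.\<close>

lemma ord_words_take:
  "take (Suc (length s)) u = take (Suc (length s)) v \<Longrightarrow> ord_words r u s = ord_words r v s"
proof (induction s arbitrary: r u v)
  case Nil
  then show ?case by (cases u; cases v) simp_all
next
  case (Cons a s)
  show ?case
  proof (cases u)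
    case Nil
    then show ?thesis using Cons.prems by (cases v) simp_all
  next
    case u: (Cons b u')
    show ?thesis
    proof (cases v)
      case Nil
      then show ?thesis using Cons.prems u by simp
    next
      case v: (Cons b' v')
      have "b = b'" "take (Suc (length s)) u' = take (Suc (length s)) v'"
        using Cons.prems u v by simp_all
      then show ?thesis using Cons.IH[of u' v'] unfolding u v by simp
    qed
  qed
qed

lemma ord_words_append:
  "ord_words r (u @ v) (u @ w) = ord_words (if u = [] then r else pos E (flip (last u))) v w"
  by (induction u arbitrary: r) auto

section \<open>Boundary lines and puncture lines in the order\<close>

lemma T_subset: "t \<in> T \<Longrightarrow> t \<in> set E \<and> flip t \<in> set E"
  using ribbon_adj_T adj_in_set by metis

lemma pos_T: "t \<in> T \<Longrightarrow> pos E (flip t) = Suc (pos E t)"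
  using ribbon_adj_T T_subset adj_iff_pos[OF distinct_E, of t "flip t"] by simp

lemma set_Z: "set Z \<subseteq> set E"
proof
  fix l assume "l \<in> set Z"
  then obtain p s where Z: "Z = p @ l # s" by (meson split_list)
  show "l \<in> set E"
  proof (cases "p = []")
    case True
    then show ?thesis using Z ribbon_ends by auto
  next
    case False
    then have "adj Z (last p) l" using Z unfolding adj_def
      by (metis append.assoc append_Cons append_Nil append_butlast_last_id)
    then show ?thesis using ribbon_adj_Z adj_in_set by metis
  qed
qed

text \<open>A cancelling pair in \<open>Z\<close> would be a corner between an edge and
  itself.\<close>

lemma reduced_Z: "reduced_word Z"
  unfolding reduced_word_adj
proof (intro allI impI notI)
  fix l l' assume "adj Z l l'" "l' = flip l"
  then have "adj E l' l'" using ribbon_adj_Z[of l l'] by simp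
  then show False using distinct_E by (auto simp: adj_def)
qed

text \<open>At each vertex the boundary leaves through the successor of the edge of arrival, whose
  place is \<open>r\<close>, and it stops where this successor is the base point. So a suffix of
  \<open>Z\<close> precedes every other word that continues from its vertex without turning
  back.\<close>

lemma ord_words_Z_suffix:
  assumes "\<And>l l'. adj z l l' \<Longrightarrow> adj E (flip l) l'"
    and "z \<noteq> [] \<Longrightarrow> pos E (hd z) = Suc r" "z \<noteq> [] \<Longrightarrow> flip (last z) = last E"
    and "z = [] \<Longrightarrow> r = length E" "set z \<subseteq> set E" "r \<le> length E"
    and "reduced_word w" "set w \<subseteq> set E" "hd_pos w \<noteq> r" "w \<noteq> z"
  shows "ord_words r z w = 1"
  using assms
proof (induction z arbitrary: r w)
  case Nil
  then obtain b v where w: "w = b # v" by (cases w) simp_all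
  then have "pos E b < length E" using Nil.prems(4,8,9) pos_le[of b E] by force
  then show ?case using Nil.prems(4) w by (simp add: cmp_def key_def)
next
  case (Cons a z)
  note p = Cons.prems
  have a: "pos E a = Suc r" "a \<in> set E" "set z \<subseteq> set E" using p(2,5) by auto
  have r: "r < length E" using a pos_le[of a E] by simp
  show ?case
  proof (cases w)
    case Nil
    then show ?thesis using a(1) r p(9) by (simp add: cmp_def key_def)
  next
    case w: (Cons b v)
    have b: "b \<in> set E" "set v \<subseteq> set E" "pos E b \<noteq> r" "reduced_word v" using p(7,8,9) w by auto
    show ?thesis
    proof (cases "a = b")
      case False
      then have "pos E b \<noteq> pos E a" using a b False pos_inj by metis
      then show ?thesis
        using w a(1) r False b(3) pos_le[OF b(1)] by (auto simp: cmp_def key_def)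
    next
      case True
      have "ord_words (pos E (flip a)) z v = 1"
      proof (rule Cons.IH)
        show "adj E (flip l) l'" if "adj z l l'" for l l'
          using that p(1)[of l l'] unfolding adj_Cons by blast
        show "pos E (hd z) = Suc (pos E (flip a))" if "z \<noteq> []"
        proof -
          have "adj E (flip a) (hd z)" using p(1)[of a "hd z"] that unfolding adj_Cons by blast
          then show ?thesis using adj_iff_pos[OF distinct_E] adj_in_set by metis
        qed
        show "z \<noteq> [] \<Longrightarrow> flip (last z) = last E" using p(3) by simp
        show "pos E (flip a) = length E" if "z = []"
          using p(3) that pos_last[OF distinct_E] ribbon_ends by simp
        show "set z \<subseteq> set E" by fact
        show "pos E (flip a) \<le> length E" using a by (simp add: pos_le)
        show "reduced_word v" "set v \<subseteq> set E" by fact+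
        show "hd_pos v \<noteq> pos E (flip a)"
          using hd_pos_neq_flip[of a v] p(7,8) w True by simp
        show "v \<noteq> z" using p(10) w True by simp
      qed
      then show ?thesis using w True by simp
    qed
  qed
qed

text \<open>The empty word and \<open>Z\<close> are neighbours in the cyclic order. Hence the
  orientation only records whether \<open>w\<close> is one of them, which is a condition free of any
  order.\<close>

lemma cyc_Z:
  assumes "reduced_word w" "set w \<subseteq> set E"
  shows "cyc [] Z w = (if w = [] \<or> w = Z then 0 else 1)"
proof (cases "w = [] \<or> w = Z")
  case True
  then show ?thesis using ord_words_antisym[of 0 Z "[]"] by (auto simp: cyc_def)
next
  case False
  have "ord_words 0 Z w = 1"
  proof (rule ord_words_Z_suffix)
    show "pos E (hd Z) = Suc 0" using ribbon_ends pos_hd[of E] by simp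
    show "hd_pos w \<noteq> 0" using False by (simp add: hd_pos_def)
  qed (use False assms set_Z ribbon_ends ribbon_adj_Z in simp_all)
  moreover have "ord_words 0 [] Z = 1"
    using ribbon_ends(2) by (cases Z) (simp_all add: cmp_def)
  moreover have "ord_words 0 w [] = -1"
    using False by (cases w) (simp_all add: cmp_def)
  ultimately show ?thesis using False by (simp add: cyc_def)
qed

text \<open>At the root \<open>flip t\<close> is the successor of \<open>t\<close>. Among the words
  through \<open>t\<close> the long powers of \<open>t\<close> come last, among those through
  \<open>flip t\<close> the long powers of \<open>flip t\<close> come first, so no shorter word lies
  between the two.\<close>

lemma ord_words_T_powers:
  assumes t: "t \<in> T" and s: "set s \<subseteq> set E" "reduced_word s" and N: "length s < N"
  shows "ord_words 0 (replicate N t) s = ord_words 0 (replicate N (flip t)) s"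
proof -
  have t': "t \<in> set E" "flip t \<in> set E" "pos E (flip t) = Suc (pos E t)" 
    "pos E t \<le> length E" "pos E (flip t) \<le> length E"
    using T_subset[OF t] pos_T[OF t] pos_le[of t E] pos_le[of "flip t" E] by simp_all
  \<comment> \<open>At a vertex reached along \<open>t\<close> the comparison starts from
    \<open>flip t\<close>, so its predecessor \<open>t\<close> is the last letter.\<close>
  have max: "ord_words (pos E (flip t)) (replicate M t) s' = -1"
    if "set s' \<subseteq> set E" "length s' < M" for s' M
    using that
  proof (induction s' arbitrary: M)
    case Nil
    then show ?case using t'(3,5) by (cases M) (simp_all add: cmp_def key_def diff_less ribbon_ends)
  next
    case (Cons b s')
    then obtain M' where M: "M = Suc M'" by (cases M) simp_all
    show ?case
    proof (cases "b = t")
      case True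
      then show ?thesis using Cons M by simp
    next
      case False
      then have "pos E b \<noteq> pos E t" using Cons.prems t' by (simp add: pos_inj)
      then show ?thesis using False t'(3,5) M pos_le[of b E] Cons.prems by (auto simp: cmp_def key_def)
    qed
  qed
  \<comment> \<open>At a vertex reached along \<open>flip t\<close> the comparison starts from
    \<open>t\<close>, so \<open>flip t\<close> is the first letter after it.\<close>
  have min: "ord_words (pos E t) (replicate M (flip t)) s' = 1"
    if "set s' \<subseteq> set E" "reduced_word (flip t # s')" "length s' < M" for s' M
    using that
  proof (induction s' arbitrary: M)
    case Nil
    then show ?case using t'(3,5) by (cases M) (simp_all add: cmp_def key_def diff_less ribbon_ends)
  next
    case (Cons b s')
    then obtain M' where M: "M = Suc M'" by (cases M) simp_all
    show ?case
    proof (cases "b = flip t")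
      case True
      then show ?thesis using Cons M by simp
    next
      case False
      then have "pos E b \<noteq> pos E (flip t)" "pos E b \<noteq> pos E t" "pos E b \<le> length E"
        using Cons.prems t'(1,2) pos_le[of b E] by (simp_all add: pos_inj)
      then show ?thesis using False t'(3,5) M by (auto simp: cmp_def key_def)
    qed
  qed
  obtain M where M: "N = Suc M" "length s \<le> M" using N by (cases N) auto
  show ?thesis
  proof (cases s)
    case Nil
    then show ?thesis using M by (simp add: cmp_def)
  next
    case (Cons b s')
    consider "b = t" | "b = flip t" | "b \<noteq> t" "b \<noteq> flip t" by blast
    then show ?thesis
    proof cases
      case 1
      then show ?thesis using max[of s' M] Cons M t'(3) s flip_neq(2)[of t] by (simp add: cmp_def)
    next
      case 2
      then show ?thesis using min[of s' M] Cons M t'(3) s flip_neq(2)[of t] by (simp add: cmp_def)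
    next
      case 3
      then have "pos E b \<noteq> pos E (flip t)" "pos E b \<noteq> pos E t" using Cons s t'(1,2) by (simp_all add: pos_inj)
      then show ?thesis using Cons M t'(3) 3 by (auto simp: cmp_def)
    qed
  qed
qed

text \<open>The boundary lines of the surface pass through all corners of the Cayley tree. At a deepest
  edge along which \<open>K\<close> changes they force equal values beyond all edges but one.\<close>

lemma constant_if_corners_agree:
  assumes fin: "\<And>w l. reduced_word (w @ [l]) \<Longrightarrow> set (w @ [l]) \<subseteq> set E \<Longrightarrow> M \<le> length w \<Longrightarrow>
      K (w @ [l]) = K w"
    and Z_inv: "\<And>v z1 z2. Z = z1 @ z2 \<Longrightarrow> set v \<subseteq> set E \<Longrightarrow> reduced_word (v @ winv z1) \<Longrightarrow>
      reduced_word (v @ z2) \<Longrightarrow> K (v @ winv z1) = K (v @ z2)"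
    and T_inv: "\<And>v t. t \<in> T \<Longrightarrow> set v \<subseteq> set E \<Longrightarrow> reduced_word (v @ [t]) \<Longrightarrow>
      reduced_word (v @ [flip t]) \<Longrightarrow>
      \<exists>N\<ge>1. K (v @ replicate N t) = K (v @ replicate N (flip t))"
    and w: "reduced_word w" "set w \<subseteq> set E"
  shows "K w = K []"
proof -
  define step where "step w l \<longleftrightarrow> reduced_word (w @ [l]) \<and> set (w @ [l]) \<subseteq> set E" for w l
  have "\<not> (\<exists>w l. step w l \<and> K (w @ [l]) \<noteq> K w)"
  proof
    define P where "P w \<longleftrightarrow> (\<exists>l. step w l \<and> K (w @ [l]) \<noteq> K w)" for w
    assume "\<exists>w l. step w l \<and> K (w @ [l]) \<noteq> K w"
    then obtain w0 where w0: "P w0" unfolding P_def by blast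
    have "\<forall>w. P w \<longrightarrow> length w < Suc M"
    proof (intro allI impI)
      fix w assume "P w"
      then obtain l where "step w l" "K (w @ [l]) \<noteq> K w" unfolding P_def by blast
      then have "\<not> M \<le> length w" using fin[of w l] unfolding step_def by blast
      then show "length w < Suc M" by simp
    qed
    \<comment> \<open>By \<open>fin\<close> changes occur only at bounded depth, so there is a
      deepest vertex \<open>w\<close> with an outgoing edge along which \<open>K\<close>
      changes.\<close>
    from ex_has_greatest_nat[OF w0 this] obtain w where w: "P w" and max: "\<And>w'. P w' \<Longrightarrow> length w' \<le> length w"
      by blast
    have max': "K (w' @ [l]) = K w'" if "step w' l" "length w < length w'" for w' l
    proof (rule ccontr)
      assume "K (w' @ [l]) \<noteq> K w'"
      then have "P w'" using that(1) unfolding P_def by blast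
      then show False using max[of w'] that(2) by simp
    qed
    obtain l where l: "step w l" "K (w @ [l]) \<noteq> K w" using w unfolding P_def by blast
    have wE: "set w \<subseteq> set E" "reduced_word w" using l by (simp_all add: step_def reduced_word_append)
    \<comment> \<open>Nothing changes further out, so beyond \<open>w\<close> the value depends only
      on the edge by which \<open>w\<close> is left. This lets a whole line through \<open>w\<close>
      be replaced by its two edges at \<open>w\<close>.\<close>
    have beyond: "K (w @ e # r) = K (w @ [e])" if "reduced_word (w @ e # r)" "set (e # r) \<subseteq> set E" for e r
      using that
    proof (induction r rule: rev_induct)
      case (snoc a r)
      have "step (w @ e # r) a" using snoc.prems wE by (simp add: step_def)
      then have "K ((w @ e # r) @ [a]) = K (w @ e # r)" using max'[of "w @ e # r" a] by simp
      moreover have "reduced_word (w @ e # r)"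
        using snoc.prems reduced_word_append[of "w @ e # r" "[a]"] by simp
      ultimately show ?case using snoc by simp
    qed simp
    have beyond': "K (w @ r) = K (w @ [hd r])" if "reduced_word (w @ r)" "set r \<subseteq> set E" "r \<noteq> []" for r
      using beyond[of "hd r" "tl r"] that by simp
    \<comment> \<open>The place of the edge that leads back to the root; at the root itself there is
      none and 0 is the place of the base point.\<close>
    define \<rho> where "\<rho> = (if w = [] then 0 else pos E (flip (last w)))"
    have ok: "reduced_word (w @ r)" if "reduced_word r" "r \<noteq> []" "set r \<subseteq> set E" "pos E (hd r) \<noteq> \<rho>" for r
    proof (cases "w = []")
      case False
      then have "hd r \<noteq> flip (last w)" using that(4) by (metis \<rho>_def)
      then show ?thesis using that wE by (simp add: reduced_word_append)
    qed (use that in simp)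
    \<comment> \<open>A corner away from the edge back is crossed either by a line spelled by
      \<open>Z\<close>, which is cut at that corner, or by the line of a puncture loop. Both ends of
      the line lie beyond \<open>w\<close>.\<close>
    have corner: "K (w @ [e]) = K (w @ [e'])"
      if e: "e \<in> set E" "e' \<in> set E" "pos E e' = Suc (pos E e)" "pos E e \<noteq> \<rho>" "pos E e' \<noteq> \<rho>" for e e'
    proof -
      have "adj E e e'" using e adj_iff_pos[OF distinct_E] by blast
      then consider "adj Z (flip e) e'" | "e \<in> T" "e' = flip e"
        using ribbon_adj_E by blast
      then show ?thesis
      proof cases
        case 1
        then obtain p s where Z: "Z = (p @ [flip e]) @ (e' # s)" by (auto simp: adj_def)
        have sub: "set p \<subseteq> set E" "set s \<subseteq> set E" "reduced_word (p @ [flip e])" "reduced_word (e' # s)"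
          using set_Z reduced_Z reduced_word_append[of "p @ [flip e]" "e' # s"] unfolding Z
          by simp_all
        have "reduced_word (e # winv p)"
          using sub(3) reduced_word_winv[of "p @ [flip e]"] by simp
        then have 2: "reduced_word (w @ e # winv p)" "reduced_word (w @ e' # s)"
          using ok[of "e # winv p"] ok[of "e' # s"] sub e by simp_all
        have "K (w @ e # winv p) = K (w @ e' # s)" using Z_inv[OF Z wE(1)] 2 by simp
        then show ?thesis using beyond[OF 2(1)] beyond[OF 2(2)] sub(1,2) e(1,2) by simp
      next
        case 2
        have red: "reduced_word (w @ [e])" "reduced_word (w @ [e'])"
          using ok[of "[e]"] ok[of "[e']"] e by simp_all
        then obtain N where N: "N \<ge> 1" "K (w @ replicate N e) = K (w @ replicate N e')"
          using T_inv[OF 2(1) wE(1)] 2(2) by blast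
        have "K (w @ replicate N a) = K (w @ [a])" if "a \<in> set E" "pos E a \<noteq> \<rho>" for a
        proof -
          have a: "replicate N a \<noteq> []" "hd (replicate N a) = a" using N(1) by (cases N; simp)+
          moreover have "set (replicate N a) \<subseteq> set E" using that by auto
          ultimately show ?thesis
            using beyond'[of "replicate N a"] ok[of "replicate N a"] that by simp
        qed
        then show ?thesis using N(2) e by simp
      qed
    qed
    note Z = ribbon_ends
    \<comment> \<open>At the base point corner the line of \<open>Z\<close> begins at
      \<open>w\<close> itself, which brings the value \<open>K w\<close> into the comparison. Its
      inverse does the same for the last edge.\<close>
    have first: "K (w @ [hd E]) = K w" if "\<rho> \<noteq> 1"
    proof -
      have "reduced_word (w @ Z)"
        using ok[of Z] Z reduced_Z set_Z pos_hd[of E] that by simp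
      then show ?thesis using Z_inv[of "[]" Z w] wE beyond'[of Z] Z set_Z by simp
    qed
    have last: "K (w @ [last E]) = K w" if "\<rho> \<noteq> length E"
    proof -
      have "reduced_word (w @ winv Z)"
        using ok[of "winv Z"] Z reduced_Z set_Z pos_last[OF distinct_E] that by (simp add: hd_winv)
      then show ?thesis
        using Z_inv[of Z "[]" w] wE beyond'[of "winv Z"] Z set_Z by (simp add: hd_winv)
    qed
    \<comment> \<open>Going up from the first edge reaches the places below \<open>\<rho>\<close>,
      going down from the last edge those above it. As \<open>l\<close> does not lead back, one of
      the two walks meets it; at the root either walk does.\<close>
    have up: "\<forall>e\<in>set E. pos E e = Suc i \<longrightarrow> K (w @ [e]) = K w" if "Suc i < \<rho> \<or> \<rho> = 0" for i
      using that
    proof (induction i)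
      case 0
      show ?case
      proof (intro ballI impI)
        fix e assume "e \<in> set E" "pos E e = Suc 0"
        then have "e = hd E" using pos_hd[of E] Z pos_inj[of e E "hd E"] by simp
        moreover have "\<rho> \<noteq> 1" using 0 by linarith
        ultimately show "K (w @ [e]) = K w" using first by simp
      qed
    next
      case (Suc i)
      show ?case
      proof (intro ballI impI)
        fix e assume e: "e \<in> set E" "pos E e = Suc (Suc i)"
        then have "\<exists>e0\<in>set E. pos E e0 = Suc i"
          using pos_surj[OF distinct_E, of "Suc i"] pos_le[of e E] by simp
        then obtain e0 where e0: "e0 \<in> set E" "pos E e0 = Suc i" by blast
        have ne: "Suc i < \<rho> \<or> \<rho> = 0" "Suc i \<noteq> \<rho>" "Suc (Suc i) \<noteq> \<rho>" using Suc.prems by linarith+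
        have "K (w @ [e0]) = K (w @ [e])" using corner[OF e0(1) e(1)] e0(2) e(2) ne by simp
        moreover have "K (w @ [e0]) = K w" using Suc.IH[OF ne(1)] e0 by simp
        ultimately show "K (w @ [e]) = K w" by simp
      qed
    qed
    have down: "\<forall>e\<in>set E. pos E e = length E - i \<longrightarrow> K (w @ [e]) = K w" if "\<rho> < length E - i" for i
      using that
    proof (induction i)
      case 0
      show ?case
      proof (intro ballI impI)
        fix e assume "e \<in> set E" "pos E e = length E - 0"
        then have "e = last E" using pos_last[OF distinct_E] Z pos_inj[of e E "last E"] by simp
        then show "K (w @ [e]) = K w" using last 0 by simp
      qed
    next
      case (Suc i)
      show ?case
      proof (intro ballI impI)
        fix e assume e: "e \<in> set E" "pos E e = length E - Suc i"
        have i: "Suc (length E - Suc i) = length E - i" "1 \<le> length E - i" using Suc.prems by simp_all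
        then have "\<exists>e0\<in>set E. pos E e0 = length E - i"
          using pos_surj[OF distinct_E, of "length E - i"] by simp
        then obtain e0 where e0: "e0 \<in> set E" "pos E e0 = length E - i" by blast
        have "K (w @ [e]) = K (w @ [e0])"
          using corner[OF e(1) e0(1)] e0(2) e(2) i Suc.prems by simp
        moreover have "K (w @ [e0]) = K w" using Suc.IH[OF Suc_lessD] Suc.prems e0 by simp
        ultimately show "K (w @ [e]) = K w" by simp
      qed
    qed
    have lE: "l \<in> set E" using l by (simp add: step_def)
    have "pos E l \<noteq> \<rho>"
    proof (cases "w = []")
      case False
      then have "l \<noteq> flip (last w)" "last w \<in> set E"
        using l(1) wE(1) by (auto simp: step_def reduced_word_append)
      then show ?thesis using False lE by (simp add: \<rho>_def pos_inj)
    qed (simp add: \<rho>_def)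
    then consider "pos E l < \<rho>" | "\<rho> < pos E l" by linarith
    then have "K (w @ [l]) = K w"
    proof cases
      case 1
      then show ?thesis using up[of "pos E l - 1"] lE by simp
    next
      case 2
      then show ?thesis using down[of "length E - pos E l"] lE pos_le[OF lE] by simp
    qed
    then show False using l by simp
  qed
  then have step': "K (w @ [l]) = K w" if "reduced_word (w @ [l])" "set (w @ [l]) \<subseteq> set E" for w l
    using that unfolding step_def by blast
  show ?thesis
    using w
  proof (induction w rule: rev_induct)
    case (snoc a w)
    then show ?case using step'[of w a] reduced_word_append[of w "[a]"] by simp
  qed simp
qed

text \<open>The word \<open>u @ t # t # v\<close> runs around the puncture \<open>t\<close> and thus crosses its translate by
  \<open>u t\<^sup>-\<^sup>1 u\<^sup>-\<^sup>1\<close>.\<close>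

lemma ord_words_square:
  assumes t: "t \<in> T" and red: "reduced_word (u @ t # t # v)" and sub: "set (u @ t # t # v) \<subseteq> set E"
    and u: "u = [] \<or> last u \<noteq> t"
  shows "ord_words 0 (u @ t # t # v) (u @ flip t # winv u) = 1"
    and "ord_words 0 (u @ t # t # v) (u @ t # v) = -1"
proof -
  have t': "t \<in> set E" "flip t \<in> set E" "pos E (flip t) = Suc (pos E t)" 
    "pos E t \<le> length E" "pos E (flip t) \<le> length E"
    using T_subset[OF t] pos_T[OF t] pos_le[of t E] pos_le[of "flip t" E] by simp_all
  define r where "r = (if u = [] then 0 else pos E (flip (last u)))"
  \<comment> \<open>The word \<open>u\<close> ends neither in \<open>flip t\<close>, by reducedness,
    nor in \<open>t\<close>, by assumption. So the cycle is not cut at either end of the loop, and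
    \<open>t\<close> still directly precedes \<open>flip t\<close>.\<close>
  have "r \<noteq> pos E t \<and> r \<noteq> pos E (flip t) \<and> r \<le> length E"
  proof (cases "u = []")
    case False
    then have "last u \<in> set E" using sub by auto
    moreover have "last u \<noteq> flip t" using red False by (auto simp: reduced_word_append)
    moreover have "flip (last u) \<noteq> t" using \<open>last u \<noteq> flip t\<close> by (metis flip_flip)
    ultimately show ?thesis using False u t'(1,2) pos_le[of "flip (last u)" E]
      by (simp add: r_def pos_inj)
  qed (simp add: r_def)
  then show "ord_words 0 (u @ t # t # v) (u @ flip t # winv u) = 1"
    using t' unfolding ord_words_append r_def[symmetric] by (auto simp: cmp_def key_def)
  \<comment> \<open>At a vertex reached along \<open>t\<close> the letter \<open>t\<close> is last,
    so an additional \<open>t\<close> makes a word come later. Common letters \<open>t\<close> are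
    peeled off by induction.\<close>
  have *: "ord_words (pos E (flip t)) (t # v) v = -1" if "set v \<subseteq> set E" for v
    using that
  proof (induction v)
    case Nil
    then show ?case using t' by (simp add: cmp_def key_def diff_less ribbon_ends)
  next
    case (Cons b v)
    show ?case
    proof (cases "b = t")
      case False
      then have "pos E b \<noteq> pos E t" using Cons.prems t' by (auto simp: pos_inj)
      then show ?thesis using False t' pos_le[of b E] Cons.prems by (auto simp: cmp_def key_def)
    qed (use Cons in auto)
  qed
  show "ord_words 0 (u @ t # t # v) (u @ t # v) = -1"
    using *[of v] sub unfolding ord_words_append by auto
qed

end

section \<open>Free groups\<close>

context group
begin

lemma inv_mult_cancel [simp]:
  "a \<in> carrier G \<Longrightarrow> b \<in> carrier G \<Longrightarrow> inv a \<otimes> (a \<otimes> b) = b"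
  "a \<in> carrier G \<Longrightarrow> b \<in> carrier G \<Longrightarrow> a \<otimes> (inv a \<otimes> b) = b"
  by (simp_all flip: m_assoc)

definition lval :: "'a \<times> bool \<Rightarrow> 'a" where
  "lval l = (if snd l then fst l else inv fst l)"

lemma word_val_Nil [simp]: "word_val G [] = \<one>"
  by (simp add: word_val_def)

lemma word_val_Cons [simp]: "word_val G (l # w) = lval l \<otimes> word_val G w"
  by (simp add: word_val_def lval_def case_prod_beta)

lemma lval_closed [simp]: "fst l \<in> carrier G \<Longrightarrow> lval l \<in> carrier G"
  by (simp add: lval_def)

lemma lval_flip: "fst l \<in> carrier G \<Longrightarrow> lval (flip l) = inv (lval l)"
  by (simp add: lval_def flip_def)

lemma word_val_closed [simp]: "set w \<subseteq> carrier G \<times> UNIV \<Longrightarrow> word_val G w \<in> carrier G"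
  by (induction w) (auto simp: mem_Times_iff)

lemma word_val_append:
  "set u \<subseteq> carrier G \<times> UNIV \<Longrightarrow> set v \<subseteq> carrier G \<times> UNIV \<Longrightarrow>
    word_val G (u @ v) = word_val G u \<otimes> word_val G v"
  by (induction u) (auto simp: mem_Times_iff m_assoc)

lemma set_winv_subset [simp]: "set (winv w) \<subseteq> B \<times> UNIV \<longleftrightarrow> set w \<subseteq> B \<times> UNIV"
  by (induction w) (auto simp: mem_Times_iff)

lemma word_val_winv:
  "set w \<subseteq> carrier G \<times> UNIV \<Longrightarrow> word_val G (winv w) = inv (word_val G w)"
  by (induction w) (auto simp: mem_Times_iff word_val_append lval_flip inv_mult_group)

lemma word_val_cons_red:
  assumes "fst l \<in> carrier G" "set w \<subseteq> carrier G \<times> UNIV"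
  shows "word_val G (cons_red l w) = lval l \<otimes> word_val G w"
proof (cases "w \<noteq> [] \<and> hd w = flip l")
  case True
  then obtain v where w: "w = flip l # v" by (cases w) auto
  then have "word_val G v \<in> carrier G" using assms by simp
  then show ?thesis
    using assms w by (simp add: cons_red_def lval_flip flip: m_assoc)
next
  case False
  then show ?thesis by (auto simp: cons_red_def)
qed

end

section \<open>Reduced words over a basis\<close>

locale free_group = group G for G (structure) +
  fixes B :: "'a set"
  assumes free: "free_basis G B"
begin

lemma basis_closed: "B \<subseteq> carrier G"
  using free by (simp add: free_basis_def)

abbreviation words :: "('a \<times> bool) list set" where
  "words \<equiv> {w. reduced_word w \<and> set w \<subseteq> B \<times> UNIV}"

lemma letters_closed: "set w \<subseteq> B \<times> UNIV \<Longrightarrow> set w \<subseteq> carrier G \<times> UNIV"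
  using basis_closed by auto

lemma lval_basis_closed [simp]: "fst l \<in> B \<Longrightarrow> lval l \<in> carrier G"
  using basis_closed by auto

lemma word_val_words_closed [simp]: "set w \<subseteq> B \<times> UNIV \<Longrightarrow> word_val G w \<in> carrier G"
  by (intro word_val_closed letters_closed)

lemma word_val_append_B:
  "set u \<subseteq> B \<times> UNIV \<Longrightarrow> set v \<subseteq> B \<times> UNIV \<Longrightarrow>
    word_val G (u @ v) = word_val G u \<otimes> word_val G v"
  by (simp add: word_val_append letters_closed)

lemma word_val_winv_B: "set w \<subseteq> B \<times> UNIV \<Longrightarrow> word_val G (winv w) = inv (word_val G w)"
  by (simp add: word_val_winv letters_closed)

lemma lval_flip_B: "fst l \<in> B \<Longrightarrow> lval (flip l) = inv (lval l)"
  using basis_closed by (auto intro: lval_flip)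

lemma cons_red_words: "fst l \<in> B \<Longrightarrow> w \<in> words \<Longrightarrow> cons_red l w \<in> words"
  using set_cons_red[of l w] reduced_word_cons_red[of w l] by (auto simp: mem_Times_iff)

lemma ex_word: "f \<in> carrier G \<Longrightarrow> \<exists>w\<in>words. word_val G w = f"
proof -
  have mult: "\<exists>w\<in>words. word_val G w = word_val G u \<otimes> word_val G v" if "u \<in> words" "v \<in> words" for u v
    using that
  proof (induction u)
    case Nil
    then show ?case using word_val_words_closed[of v] by auto
  next
    case (Cons l u)
    then obtain w where w: "w \<in> words" "word_val G w = word_val G u \<otimes> word_val G v" by auto
    have l: "fst l \<in> B" "set u \<subseteq> B \<times> UNIV" "set v \<subseteq> B \<times> UNIV"
      using Cons.prems by (auto simp: mem_Times_iff)
    have "cons_red l w \<in> words" using cons_red_words w l by blast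
    moreover have "word_val G (cons_red l w) = word_val G (l # u) \<otimes> word_val G v"
      using word_val_cons_red[of l w] w l letters_closed[of w] basis_closed
      by (auto simp: m_assoc)
    ultimately show ?case by blast
  qed
  assume "f \<in> carrier G"
  then have "f \<in> generate G B" using free by (simp add: free_basis_def)
  then show ?thesis
  proof induction
    case one
    show ?case by (intro bexI[of _ "[]"]) auto
  next
    case (incl h)
    then show ?case using basis_closed by (intro bexI[of _ "[(h, True)]"]) (auto simp: lval_def)
  next
    case (inv h)
    then show ?case using basis_closed by (intro bexI[of _ "[(h, False)]"]) (auto simp: lval_def)
  next
    case (eng h1 h2)
    then show ?case using mult by blast
  qed
qed

lemma word_val_neq_one: "w \<in> words \<Longrightarrow> w \<noteq> [] \<Longrightarrow> word_val G w \<noteq> \<one>"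
proof -
  assume w: "w \<in> words" "w \<noteq> []"
  then have "fst ` set w \<subseteq> B" by auto
  then show ?thesis using free w unfolding free_basis_def by blast
qed

lemma word_unique:
  assumes "u \<in> words" "v \<in> words" "word_val G u = word_val G v"
  shows "u = v"
  using assms
proof (induction u arbitrary: v)
  case Nil
  then show ?case using word_val_neq_one[of v] by (metis word_val_Nil)
next
  case (Cons a u)
  have lu: "fst a \<in> B" "set u \<subseteq> B \<times> UNIV" using Cons.prems by (auto simp: mem_Times_iff)
  have v: "v \<noteq> []"
    using word_val_neq_one[OF Cons.prems(1)] Cons.prems(3) by auto
  then obtain b v' where v': "v = b # v'" by (cases v) auto
  have lv: "fst b \<in> B" "set v' \<subseteq> B \<times> UNIV" using Cons.prems v' by (auto simp: mem_Times_iff)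
  show ?case
  proof (cases "a = b")
    case True
    then have "word_val G u = word_val G v'" using Cons.prems(3) v' lu lv by simp
    then show ?thesis using Cons.IH[of v'] Cons.prems(1,2) v' lu lv True by simp
  next
    case False
    \<comment> \<open>If the first letters differ, this concatenation is reduced, so it would be a
      nontrivial relation.\<close>
    define w where "w = winv (a # u) @ v"
    have "reduced_word w"
      using Cons.prems(1,2) v False reduced_word_winv[of "a # u"] last_winv[of "a # u"]
      unfolding w_def v' by (simp add: reduced_word_append del: reduced_word_winv)
    moreover have "w \<noteq> []" "set w \<subseteq> B \<times> UNIV"
      using Cons.prems(1,2) v by (auto simp: w_def simp del: winv_simps)
    moreover have "word_val G w = \<one>"
    proof -
      have "set (a # u) \<subseteq> B \<times> UNIV" "set v \<subseteq> B \<times> UNIV" using Cons.prems(1,2) by auto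
      then have "word_val G w = inv (word_val G (a # u)) \<otimes> word_val G v"
        unfolding w_def by (subst word_val_append_B) (simp_all only: word_val_winv_B set_winv_subset)
      then show ?thesis using Cons.prems(3) \<open>set v \<subseteq> B \<times> UNIV\<close> by simp
    qed
    ultimately show ?thesis using word_val_neq_one[of w] by simp
  qed
qed

definition word_of :: "'a \<Rightarrow> ('a \<times> bool) list" where
  "word_of f = (THE w. w \<in> words \<and> word_val G w = f)"

lemma word_of_word_val: "w \<in> words \<Longrightarrow> word_of (word_val G w) = w"
  unfolding word_of_def by (rule the_equality) (auto intro: word_unique)

lemma word_of:
  assumes "f \<in> carrier G"
  shows "word_of f \<in> words" "word_val G (word_of f) = f"
proof -
  obtain w where "w \<in> words" "word_val G w = f" using ex_word[OF assms] by blast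
  then show "word_of f \<in> words" "word_val G (word_of f) = f" using word_of_word_val[of w] by simp_all
qed

lemma word_of_sub: "f \<in> carrier G \<Longrightarrow> set (word_of f) \<subseteq> B \<times> UNIV"
  and word_of_red: "f \<in> carrier G \<Longrightarrow> reduced_word (word_of f)"
  using word_of(1) by auto

lemma word_of_one [simp]: "word_of \<one> = []"
  using word_of_word_val[of "[]"] by simp

lemma word_of_inj: "f \<in> carrier G \<Longrightarrow> g \<in> carrier G \<Longrightarrow> word_of f = word_of g \<longleftrightarrow> f = g"
  using word_of(2) by metis

lemma word_of_lval_mult:
  assumes "fst l \<in> B" "f \<in> carrier G"
  shows "word_of (lval l \<otimes> f) = cons_red l (word_of f)"
proof -
  have "word_val G (cons_red l (word_of f)) = lval l \<otimes> f"
    using word_val_cons_red[of l "word_of f"] assms word_of[of f] basis_closed letters_closed by auto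
  then show ?thesis using word_of_word_val cons_red_words[OF assms(1) word_of(1)[OF assms(2)]] by metis
qed

lemma word_of_lval: "fst l \<in> B \<Longrightarrow> word_of (lval l) = [l]"
  using word_of_word_val[of "[l]"] by (auto simp: mem_Times_iff)

lemma word_of_inv: "f \<in> carrier G \<Longrightarrow> word_of (inv f) = winv (word_of f)"
  using word_of_word_val[of "winv (word_of f)"] word_of[of f] word_val_winv_B[of "word_of f"]
  by simp

lemma word_of_mult_lval:
  assumes l: "fst l \<in> B" and a: "a \<in> carrier G"
  shows "word_of (a \<otimes> lval l) =
    (if word_of a \<noteq> [] \<and> last (word_of a) = flip l then butlast (word_of a) else word_of a @ [l])"
proof (cases "word_of a \<noteq> [] \<and> last (word_of a) = flip l")
  case True
  define w where "w = butlast (word_of a)"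
  have wa: "word_of a = w @ [flip l]" using True unfolding w_def by (metis append_butlast_last_id)
  have w: "w \<in> words" using word_of(1)[OF a] unfolding wa by (simp add: reduced_word_append)
  have "a = word_val G w \<otimes> inv (lval l)"
    using word_of(2)[OF a] w l unfolding wa
    by (simp add: word_val_append_B lval_flip_B mem_Times_iff)
  then have "a \<otimes> lval l = word_val G w" using w l by (simp add: m_assoc)
  then show ?thesis using True word_of_word_val[OF w] w_def by simp
next
  case False
  have "word_of a @ [l] \<in> words"
    using False word_of(1)[OF a] l
    by (auto simp: reduced_word_append mem_Times_iff)
  moreover have "word_val G (word_of a @ [l]) = a \<otimes> lval l"
    using word_of[OF a] l by (simp add: word_val_append_B mem_Times_iff)
  ultimately show ?thesis using word_of_word_val[of "word_of a @ [l]"] False by auto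
qed

text \<open>Each letter multiplied from the right adds or removes one final letter, so
  \<open>length g\<close> letters cannot disturb the first \<open>k\<close>.\<close>

lemma take_word_of_mult:
  assumes "a \<in> carrier G" "set g \<subseteq> B \<times> UNIV" "k + length g \<le> length (word_of a)"
  shows "take k (word_of (a \<otimes> word_val G g)) = take k (word_of a)"
  using assms
proof (induction g arbitrary: a)
  case (Cons l g)
  have l: "fst l \<in> B" "set g \<subseteq> B \<times> UNIV" using Cons.prems by (auto simp: mem_Times_iff)
  let ?w = "word_of (a \<otimes> lval l)"
  have w: "length (word_of a) \<le> Suc (length ?w)" "take k ?w = take k (word_of a)"
    using Cons.prems(3) unfolding word_of_mult_lval[OF l(1) Cons.prems(1)]
    by (auto simp: take_butlast)
  have "take k (word_of ((a \<otimes> lval l) \<otimes> word_val G g)) = take k ?w"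
    using Cons.IH[of "a \<otimes> lval l"] Cons.prems l w by simp
  then show ?case using w l Cons.prems by (simp add: m_assoc)
qed simp

lemma word_of_replicate: "fst l \<in> B \<Longrightarrow> word_of (word_val G (replicate N l)) = replicate N l"
  by (rule word_of_word_val) (auto simp: mem_Times_iff)

lemma finite_word_length_le: "finite B \<Longrightarrow> finite {f \<in> carrier G. length (word_of f) \<le> C}"
proof -
  assume "finite B"
  then have "finite {w. set w \<subseteq> B \<times> (UNIV :: bool set) \<and> length w \<le> C}"
    by (intro finite_lists_length_le) auto
  moreover have "word_of ` {f \<in> carrier G. length (word_of f) \<le> C} \<subseteq>
      {w. set w \<subseteq> B \<times> (UNIV :: bool set) \<and> length w \<le> C}"
    using word_of_sub by blast
  moreover have "inj_on word_of {f \<in> carrier G. length (word_of f) \<le> C}"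
    by (auto simp: inj_on_def word_of_inj)
  ultimately show ?thesis using finite_imageD finite_subset by blast
qed

end

section \<open>Automorphisms preserve the cyclic order\<close>

locale ribbon_group = free_group G B + ribbon E Z T
  for G :: "('a, 'm) monoid_scheme" (structure) and B and E Z :: "('a \<times> bool) list" and T +
  assumes E_letters: "set E = B \<times> UNIV"
begin

lemma in_E: "l \<in> set E \<longleftrightarrow> fst l \<in> B"
  by (simp add: E_letters mem_Times_iff)

lemma finite_B: "finite B"
proof -
  have "B = fst ` set E" by (auto simp: E_letters)
  then show ?thesis by simp
qed

lemma word_of_E: "f \<in> carrier G \<Longrightarrow> set (word_of f) \<subseteq> set E"
  using word_of_sub E_letters by simp

definition gcyc :: "'a \<Rightarrow> 'a \<Rightarrow> 'a \<Rightarrow> int" where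
  "gcyc a b c = cyc (word_of a) (word_of b) (word_of c)"

lemma gcyc_mult_left:
  assumes "f \<in> carrier G" "a \<in> carrier G" "b \<in> carrier G" "c \<in> carrier G"
  shows "gcyc (f \<otimes> a) (f \<otimes> b) (f \<otimes> c) = gcyc a b c"
proof -
  have "gcyc (word_val G w \<otimes> a) (word_val G w \<otimes> b) (word_val G w \<otimes> c) = gcyc a b c"
    if "set w \<subseteq> B \<times> UNIV" for w
    using that
  proof (induction w)
    case (Cons l w)
    have l: "fst l \<in> B" "set w \<subseteq> B \<times> UNIV" using Cons.prems by (auto simp: mem_Times_iff)
    have *: "word_of (word_val G (l # w) \<otimes> d) = cons_red l (word_of (word_val G w \<otimes> d))"
      if "d \<in> carrier G" for d
      using that l word_of_lval_mult[of l "word_val G w \<otimes> d"] by (simp add: m_assoc)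
    show ?case
      using Cons.IH[OF l(2)] assms l
      by (simp add: gcyc_def * cyc_cons_red in_E word_of_red word_of_E del: word_val_Cons)
  qed (use assms in simp)
  from this[of "word_of f"] show ?thesis using assms word_of[of f] by simp
qed

lemma gcyc_translate:
  assumes "a \<in> carrier G" "b \<in> carrier G" "c \<in> carrier G" "d \<in> carrier G"
  shows "gcyc (a \<otimes> b) c d = gcyc b (inv a \<otimes> c) (inv a \<otimes> d)"
  using gcyc_mult_left[of a b "inv a \<otimes> c" "inv a \<otimes> d"] assms by (simp flip: m_assoc)

lemma gcyc_eq_ord_words:
  "gcyc a s r = ord_words 0 (word_of a) (word_of s) - ord_words 0 (word_of a) (word_of r) +
     ord_words 0 (word_of s) (word_of r)"
  using ord_words_antisym[of 0 "word_of r" "word_of a"] by (simp add: gcyc_def cyc_def)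

text \<open>The letters of \<open>a\<close> that the comparison reads are out of reach of the short
  right factor \<open>h\<close>.\<close>

lemma gcyc_far:
  assumes "a \<in> carrier G" "h \<in> carrier G"
    and "length (word_of s) + length (word_of h) < length (word_of a)"
    and "length (word_of r) + length (word_of h) < length (word_of a)"
  shows "gcyc (a \<otimes> h) s r = gcyc a s r"
proof -
  have "ord_words 0 (word_of (a \<otimes> h)) (word_of x) = ord_words 0 (word_of a) (word_of x)"
    if "length (word_of x) + length (word_of h) < length (word_of a)" for x
    using take_word_of_mult[of a "word_of h" "Suc (length (word_of x))"] word_of[of h] assms that
    by (intro ord_words_take) simp
  then show ?thesis using assms by (simp add: gcyc_eq_ord_words)
qed

definition gZ :: 'a where
  "gZ = word_val G Z"

lemma Z_words: "Z \<in> words"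
  using reduced_Z set_Z E_letters by simp

lemma gZ_closed [simp]: "gZ \<in> carrier G"
  unfolding gZ_def using Z_words by simp

lemma word_of_gZ: "word_of gZ = Z"
  unfolding gZ_def by (rule word_of_word_val[OF Z_words])

lemma gcyc_gZ:
  assumes "f \<in> carrier G"
  shows "gcyc \<one> gZ f = (if f = \<one> \<or> f = gZ then 0 else 1)"
  using cyc_Z[of "word_of f"] assms word_of_inj[of f \<one>] word_of_inj[of f gZ]
  by (simp add: gcyc_def word_of_gZ word_of_red word_of_E)

text \<open>The cocycle identity expresses the change from \<open>a\<close> to
  \<open>a \<otimes> gZ\<close> by triples containing both. These elements are neighbours, so the
  right-hand side asks only whether certain elements equal \<open>\<one>\<close> or
  \<open>gZ\<close>.\<close>

lemma gcyc_mult_gZ: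
  assumes "a \<in> carrier G" "s \<in> carrier G" "r \<in> carrier G"
  shows "gcyc (a \<otimes> gZ) s r - gcyc a s r = gcyc \<one> gZ (inv a \<otimes> s) - gcyc \<one> gZ (inv a \<otimes> r)"
proof -
  have *: "gcyc a (a \<otimes> gZ) x = gcyc \<one> gZ (inv a \<otimes> x)" if "x \<in> carrier G" for x
    using gcyc_mult_left[of a \<one> gZ "inv a \<otimes> x"] assms that by (simp flip: m_assoc)
  have "gcyc (a \<otimes> gZ) s r - gcyc a s r = gcyc a (a \<otimes> gZ) s - gcyc a (a \<otimes> gZ) r"
    unfolding gcyc_def by (rule cyc_cocycle)
  then show ?thesis using * assms by simp
qed

lemma T_in_B: "t \<in> T \<Longrightarrow> fst t \<in> B"
  using T_subset in_E by blast

text \<open>The factor \<open>h\<close> allows for the image of a puncture line: the image of a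
  power of \<open>t\<close> is a conjugate of a power, and the conjugating element remains as a tail
  of fixed length.\<close>

lemma gcyc_T_powers:
  assumes t: "t \<in> T" and cl: "b \<in> carrier G" "h \<in> carrier G" "s \<in> carrier G" "r \<in> carrier G"
  shows "\<exists>M. \<forall>N\<ge>M. gcyc (b \<otimes> word_val G (replicate N t) \<otimes> h) s r =
    gcyc (b \<otimes> word_val G (replicate N (flip t)) \<otimes> h) s r"
proof (intro exI allI impI)
  let ?s = "inv b \<otimes> s" and ?r = "inv b \<otimes> r"
  fix N assume N: "Suc (length (word_of ?s) + length (word_of ?r) + length (word_of h)) \<le> N"
  have *: "gcyc (b \<otimes> word_val G (replicate N l) \<otimes> h) s r = gcyc (word_val G (replicate N l)) ?s ?r"
    if "fst l \<in> B" for l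
  proof -
    have "set (replicate N l) \<subseteq> B \<times> UNIV" using that by (auto simp: mem_Times_iff)
    then have "word_val G (replicate N l) \<in> carrier G" by simp
    then show ?thesis
      using gcyc_translate[of b "word_val G (replicate N l) \<otimes> h" s r]
        gcyc_far[of "word_val G (replicate N l)" h ?s ?r] cl N word_of_replicate[OF that]
      by (simp add: m_assoc)
  qed
  have "ord_words 0 (replicate N t) (word_of x) = ord_words 0 (replicate N (flip t)) (word_of x)"
    if "x = ?s \<or> x = ?r" for x
    using that N cl by (intro ord_words_T_powers t word_of_E word_of_red) auto
  then have "gcyc (word_val G (replicate N t)) ?s ?r = gcyc (word_val G (replicate N (flip t))) ?s ?r"
    using T_in_B[OF t] word_of_replicate[of t N] word_of_replicate[of "flip t" N]
    by (simp add: gcyc_eq_ord_words)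
  then show "gcyc (b \<otimes> word_val G (replicate N t) \<otimes> h) s r =
      gcyc (b \<otimes> word_val G (replicate N (flip t)) \<otimes> h) s r"
    using * T_in_B[OF t] by simp
qed

end

section \<open>Automorphisms that fix the boundary word and permute the puncture loops\<close>

locale ribbon_aut = ribbon_group G B E Z T + group_hom G G \<phi>
  for G :: "('a, 'm) monoid_scheme" (structure) and B and E Z :: "('a \<times> bool) list" and T and \<phi> :: "'a \<Rightarrow> 'a" +
  assumes bij: "bij_betw \<phi> (carrier G) (carrier G)"
    and fix_Z: "\<phi> gZ = gZ"
    and conj_T: "\<And>t. t \<in> T \<Longrightarrow> \<exists>t'\<in>T. \<exists>h\<in>carrier G. \<phi> (lval t) = h \<otimes> lval t' \<otimes> inv h"
begin

lemma \<phi>_inj: "a \<in> carrier G \<Longrightarrow> b \<in> carrier G \<Longrightarrow> \<phi> a = \<phi> b \<longleftrightarrow> a = b"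
  using bij by (auto simp: bij_betw_def inj_on_def)

lemma \<phi>_T_power:
  assumes "t \<in> T"
  obtains t' h where "t' \<in> T" "h \<in> carrier G"
    "\<And>N. \<phi> (word_val G (replicate N t)) = h \<otimes> word_val G (replicate N t') \<otimes> inv h"
    "\<And>N. \<phi> (word_val G (replicate N (flip t))) = h \<otimes> word_val G (replicate N (flip t')) \<otimes> inv h"
proof -
  obtain t' h where h: "t' \<in> T" "h \<in> carrier G" "\<phi> (lval t) = h \<otimes> lval t' \<otimes> inv h"
    using conj_T[OF assms] by blast
  have cl: "lval t \<in> carrier G" "lval t' \<in> carrier G" "fst t \<in> carrier G" "fst t' \<in> carrier G"
    using T_in_B[OF assms] T_in_B[OF h(1)] basis_closed by auto
  have rep: "word_val G (replicate N l) \<in> carrier G" if "fst l \<in> carrier G" for N l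
    using that by (intro word_val_closed) (auto simp: mem_Times_iff)
  have pow: "\<phi> (word_val G (replicate N l)) = h \<otimes> word_val G (replicate N l') \<otimes> inv h"
    if "fst l \<in> carrier G" "fst l' \<in> carrier G" "\<phi> (lval l) = h \<otimes> lval l' \<otimes> inv h" for N l l'
  proof (induction N)
    case (Suc N)
    have "\<phi> (word_val G (replicate (Suc N) l)) =
        h \<otimes> lval l' \<otimes> inv h \<otimes> (h \<otimes> word_val G (replicate N l') \<otimes> inv h)"
      using Suc that rep by simp
    then show ?case using that rep h by (simp add: m_assoc)
  qed (use h in simp)
  have "\<phi> (lval (flip t)) = h \<otimes> lval (flip t') \<otimes> inv h"
    using h cl by (simp add: lval_flip inv_mult_group m_assoc)
  then show ?thesis using that[OF h(1,2)] pow h cl by simp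
qed

theorem gcyc_invariant:
  assumes cl: "a \<in> carrier G" "s \<in> carrier G" "r \<in> carrier G"
  shows "gcyc (\<phi> a) (\<phi> s) (\<phi> r) = gcyc a s r"
proof -
  define K where "K w = gcyc (\<phi> (word_val G w)) (\<phi> s) (\<phi> r) - gcyc (word_val G w) s r" for w
  \<comment> \<open>Large enough for the two fixed images together with the image of any single
    letter.\<close>
  define C where "C = length (word_of (\<phi> s)) + length (word_of (\<phi> r)) +
    (\<Sum>l\<in>set E. length (word_of (\<phi> (lval l))))"
  \<comment> \<open>An automorphism is proper: only finitely many elements have images of length at
    most \<open>C\<close>, so all sufficiently long words have longer images.\<close>
  have "finite (\<phi> -` {f \<in> carrier G. length (word_of f) \<le> C} \<inter> carrier G)"
    using finite_vimage_IntI[OF finite_word_length_le[OF finite_B]] bij by (auto simp: bij_betw_def)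
  then have "finite ((\<lambda>f. length (word_of f)) ` (\<phi> -` {f \<in> carrier G. length (word_of f) \<le> C} \<inter> carrier G))"
    by (rule finite_imageI)
  then obtain M where
    "\<forall>n\<in>(\<lambda>f. length (word_of f)) ` (\<phi> -` {f \<in> carrier G. length (word_of f) \<le> C} \<inter> carrier G). n < M"
    using finite_nat_set_iff_bounded by blast
  then have M: "length (word_of f) < M" if "f \<in> carrier G" "length (word_of (\<phi> f)) \<le> C" for f
    using that hom_closed by simp
  \<comment> \<open>The summand 1 is the length of the letter that is appended.\<close>
  define M' where "M' = Suc (M + length (word_of s) + length (word_of r) + 1)"
  have const: "K w = K []" if "reduced_word w" "set w \<subseteq> set E" for w
  proof (rule constant_if_corners_agree[OF _ _ _ that, of M'])
    fix w l assume w: "reduced_word (w @ [l])" "set (w @ [l]) \<subseteq> set E" "M' \<le> length w"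
    let ?f = "word_val G w"
    have wl: "w \<in> words" "fst l \<in> B" using w by (auto simp: reduced_word_append E_letters in_E)
    have f: "?f \<in> carrier G" "word_of ?f = w" "length (word_of ?f) = length w"
      using wl by (simp_all add: word_of_word_val)
    have val: "word_val G (w @ [l]) = ?f \<otimes> lval l"
      using wl by (simp add: word_val_append_B mem_Times_iff)
    have "length (word_of (\<phi> (lval l))) \<le> (\<Sum>l\<in>set E. length (word_of (\<phi> (lval l))))"
      using wl by (intro member_le_sum) (auto simp: in_E)
    moreover have "\<not> length (word_of (\<phi> ?f)) \<le> C" using M[OF f(1)] f(3) w(3) by (auto simp: M'_def)
    ultimately have "gcyc (\<phi> ?f \<otimes> \<phi> (lval l)) (\<phi> s) (\<phi> r) = gcyc (\<phi> ?f) (\<phi> s) (\<phi> r)"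
      using f wl by (intro gcyc_far) (auto simp: C_def)
    moreover have "gcyc (?f \<otimes> lval l) s r = gcyc ?f s r"
      using f wl w(3) by (intro gcyc_far) (auto simp: M'_def word_of_lval)
    ultimately show "K (w @ [l]) = K w" using f wl by (simp add: K_def val)
  next
    fix v z1 z2 assume Z: "Z = z1 @ z2" and v: "set v \<subseteq> set E"
    let ?a = "word_val G v \<otimes> inv (word_val G z1)"
    have z: "set z1 \<subseteq> carrier G \<times> UNIV" "set z2 \<subseteq> carrier G \<times> UNIV" "set v \<subseteq> carrier G \<times> UNIV"
      using set_Z v E_letters letters_closed unfolding Z by auto
    have "gZ = word_val G (z1 @ z2)" unfolding gZ_def by (simp only: Z)
    then have gZ: "gZ = word_val G z1 \<otimes> word_val G z2" using z by (simp add: word_val_append)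
    have val: "word_val G (v @ winv z1) = ?a" "word_val G (v @ z2) = ?a \<otimes> gZ" "?a \<in> carrier G"
      using z unfolding gZ by (simp_all add: word_val_append word_val_winv m_assoc)
    \<comment> \<open>By \<open>gcyc_gZ\<close> only equality with \<open>\<one>\<close> or
      \<open>gZ\<close> matters, and \<open>\<phi>\<close> is injective and fixes both.\<close>
    have \<delta>: "gcyc \<one> gZ (inv (\<phi> ?a) \<otimes> \<phi> x) = gcyc \<one> gZ (inv ?a \<otimes> x)" if "x \<in> carrier G" for x
    proof -
      have "inv (\<phi> ?a) \<otimes> \<phi> x = \<phi> (inv ?a \<otimes> x)" using val(3) that by simp
      moreover have "\<phi> (inv ?a \<otimes> x) = \<one> \<longleftrightarrow> inv ?a \<otimes> x = \<one>"
        using \<phi>_inj[of "inv ?a \<otimes> x" \<one>] val(3) that by simp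
      moreover have "\<phi> (inv ?a \<otimes> x) = gZ \<longleftrightarrow> inv ?a \<otimes> x = gZ"
        using \<phi>_inj[of "inv ?a \<otimes> x" gZ] val(3) that by (simp add: fix_Z)
      moreover have "inv ?a \<otimes> x \<in> carrier G" using val(3) that by blast
      ultimately show ?thesis using gcyc_gZ hom_closed by metis
    qed
    have "gcyc (\<phi> ?a \<otimes> gZ) (\<phi> s) (\<phi> r) - gcyc (\<phi> ?a) (\<phi> s) (\<phi> r) = gcyc (?a \<otimes> gZ) s r - gcyc ?a s r"
      using gcyc_mult_gZ[of "\<phi> ?a" "\<phi> s" "\<phi> r"] gcyc_mult_gZ[of ?a s r] \<delta> val(3) cl by simp
    moreover have "\<phi> (?a \<otimes> gZ) = \<phi> ?a \<otimes> gZ" using val(3) fix_Z hom_mult gZ_closed by metis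
    ultimately show "K (v @ winv z1) = K (v @ z2)" unfolding K_def val by simp
  next
    fix v t assume t: "t \<in> T" and v: "set v \<subseteq> set E"
    obtain t' h where h: "t' \<in> T" "h \<in> carrier G"
      "\<And>N. \<phi> (word_val G (replicate N t)) = h \<otimes> word_val G (replicate N t') \<otimes> inv h"
      "\<And>N. \<phi> (word_val G (replicate N (flip t))) = h \<otimes> word_val G (replicate N (flip t')) \<otimes> inv h"
      by (rule \<phi>_T_power[OF t]) (rule that)
    let ?v = "word_val G v"
    have vc: "?v \<in> carrier G" "set v \<subseteq> carrier G \<times> UNIV" using v E_letters letters_closed by auto
    have rep: "set (replicate N l) \<subseteq> carrier G \<times> UNIV" if "fst l \<in> B" for N l
      by (rule letters_closed) (use that in \<open>auto simp: mem_Times_iff\<close>)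
    have tB: "fst t \<in> B" "fst (flip t) \<in> B" "fst t' \<in> B" "fst (flip t') \<in> B" using T_in_B t h by auto
    have one: "\<one> \<in> carrier G" by simp
    obtain M1 where M1: "\<forall>N\<ge>M1. gcyc (?v \<otimes> word_val G (replicate N t) \<otimes> \<one>) s r =
        gcyc (?v \<otimes> word_val G (replicate N (flip t)) \<otimes> \<one>) s r"
      using gcyc_T_powers[OF t vc(1) one cl(2,3)] ..
    have ph: "\<phi> ?v \<otimes> h \<in> carrier G" "inv h \<in> carrier G" "\<phi> s \<in> carrier G" "\<phi> r \<in> carrier G"
      using vc h cl by auto
    obtain M2 where M2: "\<forall>N\<ge>M2. gcyc (\<phi> ?v \<otimes> h \<otimes> word_val G (replicate N t') \<otimes> inv h) (\<phi> s) (\<phi> r) =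
        gcyc (\<phi> ?v \<otimes> h \<otimes> word_val G (replicate N (flip t')) \<otimes> inv h) (\<phi> s) (\<phi> r)"
      using gcyc_T_powers[OF h(1) ph] ..
    have val: "word_val G (v @ replicate N l) = ?v \<otimes> word_val G (replicate N l) \<otimes> \<one>" if "fst l \<in> B" for N l
      using vc rep[OF that] by (simp add: word_val_append)
    have \<phi>val: "\<phi> (word_val G (v @ replicate N l)) = \<phi> ?v \<otimes> h \<otimes> word_val G (replicate N l') \<otimes> inv h"
      if "fst l \<in> B" "fst l' \<in> B" 
        "\<phi> (word_val G (replicate N l)) = h \<otimes> word_val G (replicate N l') \<otimes> inv h" for N l l'
      using vc rep[of l N] rep[of l' N] that h(2) by (simp add: val m_assoc)
    \<comment> \<open>An exponent beyond both bounds serves the line and its image at once; the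
      \<open>Suc\<close> makes it positive.\<close>
    let ?N = "Suc (M1 + M2)"
    have "K (v @ replicate ?N t) = K (v @ replicate ?N (flip t))"
      unfolding K_def \<phi>val[OF tB(1,3) h(3)] \<phi>val[OF tB(2,4) h(4)]
      unfolding val[OF tB(1)] val[OF tB(2)]
      using M1[rule_format, of ?N] M2[rule_format, of ?N] by simp
    then show "\<exists>N\<ge>1. K (v @ replicate N t) = K (v @ replicate N (flip t))"
      by (intro exI[of _ ?N]) simp
  qed
  have "K (word_of f) = gcyc (\<phi> f) (\<phi> s) (\<phi> r) - gcyc f s r" if "f \<in> carrier G" for f
    using word_of(2)[OF that] by (simp add: K_def)
  \<comment> \<open>At \<open>a = s\<close> both triples are degenerate, so the constant is
    0.\<close>
  moreover have "K (word_of a) = K (word_of s)"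
    using const[of "word_of a"] const[of "word_of s"] cl by (simp add: word_of_E word_of_red)
  ultimately show ?thesis using cl by (simp add: gcyc_def)
qed

text \<open>The loop of a letter does not cross its translates.\<close>

lemma gcyc_letter:
  assumes e: "fst e \<in> B" and f: "f \<in> carrier G" "f \<noteq> \<one>" "f \<noteq> lval e"
    and fe: "f \<otimes> lval e \<noteq> \<one>" "f \<otimes> lval e \<noteq> lval e"
  shows "gcyc \<one> (lval e) f = gcyc \<one> (lval e) (f \<otimes> lval e)"
proof -
  let ?w = "word_of f" and ?w' = "word_of (f \<otimes> lval e)"
  have ecl: "lval e \<in> carrier G" using e by simp
  have w: "?w \<noteq> []" "?w \<noteq> [e]" "?w' \<noteq> []" "?w' \<noteq> [e]"
    using word_of_inj[of f \<one>] word_of_inj[of f "lval e"] word_of_inj[of "f \<otimes> lval e" \<one>]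
      word_of_inj[of "f \<otimes> lval e" "lval e"] f fe ecl word_of_lval[OF e] by auto
  have w': "?w' = (if last ?w = flip e then butlast ?w else ?w @ [e])"
    using word_of_mult_lval[OF e f(1)] w(1) by simp
  \<comment> \<open>Comparison with a one-letter word reads at most two letters. Multiplication by
    \<open>e\<close> acts at the other end of the word and could alter the result only in the
    excluded cases.\<close>
  have "ord_words 0 [e] ?w = ord_words 0 [e] ?w'"
  proof (cases "hd ?w = e")
    case True
    then obtain l v where v: "?w = e # l # v" using w by (cases ?w; cases "tl ?w") auto
    moreover have "v \<noteq> []" if "last ?w = flip e" using w(4) that v unfolding w' by auto
    ultimately have "\<exists>v'. ?w' = e # l # v'" unfolding w' by auto
    then show ?thesis using v by auto
  next
    case False
    then obtain l v where v: "?w = l # v" "l \<noteq> e" using w by (cases ?w) auto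
    moreover have "v \<noteq> []" if "last ?w = flip e" using w(3) that v unfolding w' by auto
    ultimately have "\<exists>v'. ?w' = l # v'" unfolding w' by auto
    then show ?thesis using v by auto
  qed
  moreover have "ord_words 0 u [] = -1" if "u \<noteq> []" for u using that by (cases u) (auto simp: cmp_def)
  moreover have "ord_words 0 [] u = 1" if "u \<noteq> []" for u using that by (cases u) (auto simp: cmp_def)
  ultimately show ?thesis
    using w by (simp add: gcyc_def cyc_def word_of_lval[OF e])
qed

text \<open>With \<open>?a\<close> the image of \<open>e\<close> and \<open>f\<close> the value of
  \<open>u @ flip t # winv u\<close>, the product \<open>f \<otimes> ?a\<close> has the word
  \<open>u @ t # v\<close>. By \<open>ord_words_square\<close> the pair \<open>f\<close>,
  \<open>f \<otimes> ?a\<close> is separated by \<open>\<one>\<close> and \<open>?a\<close>.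
  Invariance pulls this crossing back to the loop of the letter \<open>e\<close> and one of its
  translates, contrary to \<open>gcyc_letter\<close>.\<close>

lemma image_no_first_T_square:
  assumes e: "fst e \<in> B" and t: "t \<in> T" and u: "u = [] \<or> last u \<noteq> t"
  shows "word_of (\<phi> (lval e)) \<noteq> u @ t # t # v"
proof
  assume w: "word_of (\<phi> (lval e)) = u @ t # t # v"
  have ecl: "lval e \<in> carrier G" using e by simp
  let ?a = "\<phi> (lval e)"
  have a: "?a \<in> carrier G" using ecl by simp
  have red: "reduced_word (u @ t # t # v)" and sub: "set (u @ t # t # v) \<subseteq> B \<times> UNIV"
    using word_of(1)[OF a] unfolding w by auto
  have f: "u @ flip t # winv u \<in> words"
  proof -
    have "u = [] \<or> last u \<noteq> flip t" using red by (simp add: reduced_word_append) (metis flip_flip)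
    then have "u = [] \<or> hd (winv u) \<noteq> t" by (metis hd_winv flip_flip)
    moreover have "u = [] \<or> flip t \<noteq> flip (last u)" using u by simp metis
    ultimately show ?thesis
      using red sub by (simp add: reduced_word_append mem_Times_iff)
  qed
  have fa: "u @ t # v \<in> words" using red sub by (simp add: reduced_word_append)
  define f where "f = word_val G (u @ flip t # winv u)"
  have fcl: "f \<in> carrier G" "word_of f = u @ flip t # winv u"
    unfolding f_def using f word_of_word_val[OF f] by auto
  have "f \<otimes> ?a = word_val G (u @ t # v)"
  proof -
    have cl: "word_val G u \<in> carrier G" "word_val G v \<in> carrier G" "lval t \<in> carrier G"
      "set u \<subseteq> carrier G \<times> UNIV" "set v \<subseteq> carrier G \<times> UNIV" "fst t \<in> carrier G"
      using sub letters_closed[of u] letters_closed[of v] T_in_B[OF t] basis_closed by auto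
    have "?a = word_val G u \<otimes> (lval t \<otimes> (lval t \<otimes> word_val G v))"
      using word_of(2)[OF a] cl unfolding w by (simp add: word_val_append mem_Times_iff)
    moreover have "f = word_val G u \<otimes> (inv (lval t) \<otimes> inv (word_val G u))"
      using cl unfolding f_def by (simp add: word_val_append word_val_winv lval_flip mem_Times_iff)
    ultimately have "f \<otimes> ?a = word_val G u \<otimes> (lval t \<otimes> word_val G v)"
      using cl by (simp add: m_assoc)
    then show ?thesis using cl by (simp add: word_val_append mem_Times_iff)
  qed
  then have fa': "word_of (f \<otimes> ?a) = u @ t # v" using word_of_word_val[OF fa] by simp
  obtain k where k: "k \<in> carrier G" "\<phi> k = f"
    using bij fcl(1) by (metis bij_betw_def imageE)
  have ka: "\<phi> (k \<otimes> lval e) = f \<otimes> ?a" using k ecl by simp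
  \<comment> \<open>The degenerate positions for \<open>gcyc_letter\<close> are ruled out by
    comparing the explicit reduced words after applying \<open>\<phi>\<close>.\<close>
  have ne: "k \<noteq> \<one>" "k \<noteq> lval e" "k \<otimes> lval e \<noteq> \<one>" "k \<otimes> lval e \<noteq> lval e"
  proof -
    have "word_of (\<phi> k) \<noteq> word_of \<one>" "word_of (\<phi> k) \<noteq> word_of ?a" using fcl k w by auto
    moreover have "word_of (\<phi> (k \<otimes> lval e)) \<noteq> word_of \<one>" "word_of (\<phi> (k \<otimes> lval e)) \<noteq> word_of ?a"
      using fa' ka w by auto
    ultimately show "k \<noteq> \<one>" "k \<noteq> lval e" "k \<otimes> lval e \<noteq> \<one>" "k \<otimes> lval e \<noteq> lval e"
      using hom_one by metis+
  qed
  have "gcyc \<one> (lval e) k = gcyc \<one> (lval e) (k \<otimes> lval e)"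
    using gcyc_letter[OF e k(1)] ne by blast
  then have "gcyc \<one> ?a f = gcyc \<one> ?a (f \<otimes> ?a)"
    using gcyc_invariant[of \<one> "lval e" k] gcyc_invariant[of \<one> "lval e" "k \<otimes> lval e"] k ka ecl by simp
  moreover have "ord_words 0 u' [] = -1" if "u' \<noteq> []" for u' using that by (cases u') (auto simp: cmp_def)
  ultimately have "ord_words 0 (u @ t # t # v) (u @ flip t # winv u) = ord_words 0 (u @ t # t # v) (u @ t # v)"
    using fcl fa' w by (simp add: gcyc_def cyc_def)
  then show False using ord_words_square[OF t red _ u] sub by (simp add: E_letters)
qed

text \<open>A square inside a run of \<open>t\<close> can be moved to the beginning of the run, by
  shifting letters \<open>t\<close> from the end of \<open>u\<close> into \<open>v\<close>.\<close>

lemma image_no_T_square: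
  assumes "fst e \<in> B" "t \<in> T"
  shows "word_of (\<phi> (lval e)) \<noteq> u @ t # t # v"
proof (induction u arbitrary: v rule: rev_induct)
  case Nil
  show ?case using image_no_first_T_square[of e t "[]" v] assms by simp
next
  case (snoc a u)
  show ?case
  proof (cases "a = t")
    case True
    then show ?thesis using snoc[of "t # v"] by simp
  next
    case False
    then show ?thesis using image_no_first_T_square[of e t "u @ [a]" v] assms by simp
  qed
qed

text \<open>The inverse letter has the inverse image, in which this square becomes a square of
  \<open>t\<close>.\<close>

lemma image_no_flip_T_square:
  assumes e: "fst e \<in> B" and t: "t \<in> T"
  shows "word_of (\<phi> (lval e)) \<noteq> u @ flip t # flip t # v"
proof
  assume w: "word_of (\<phi> (lval e)) = u @ flip t # flip t # v"
  have "\<phi> (lval (flip e)) = inv (\<phi> (lval e))" using e basis_closed by (auto simp: lval_flip)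
  then have "word_of (\<phi> (lval (flip e))) = winv (u @ flip t # flip t # v)"
    using word_of_inv[of "\<phi> (lval e)"] e w by simp
  then show False using image_no_T_square[of "flip e" t "winv v" "winv u"] e t by simp
qed

end

section \<open>The action on normal forms of a free product of cyclic groups\<close>

lemma take_replicate_append_neq:
  assumes "k < n" "w = [] \<or> hd w \<noteq> a"
  shows "take n (replicate k a @ w) \<noteq> replicate n a"
proof
  assume "take n (replicate k a @ w) = replicate n a"
  then have "drop k (take n (replicate k a @ w)) = replicate (n - k) a" by simp
  then have "take (n - k) w = replicate (n - k) a" using assms(1) by (simp add: drop_take)
  moreover obtain j where "n - k = Suc j" using assms(1) by (metis Suc_diff_Suc)
  ultimately show False using assms(2) by (cases w) auto
qed

lemma split_replicate: "\<exists>i w'. w = replicate i a @ w' \<and> (w' = [] \<or> hd w' \<noteq> a)"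
proof (induction w)
  case (Cons b w)
  then obtain i w' where w: "w = replicate i a @ w'" "w' = [] \<or> hd w' \<noteq> a" by blast
  show ?case
  proof (cases "b = a")
    case True
    then show ?thesis using w by (intro exI[of _ "Suc i"] exI[of _ w']) simp
  next
    case False
    then show ?thesis by (intro exI[of _ 0] exI[of _ "b # w"]) simp
  qed
qed simp

lemma foldr_replicate: "foldr f (replicate k l) w = (f l ^^ k) w"
  by (induction k) auto

locale cyclic_quotient = free_group G B for G (structure) and B +
  fixes C :: "'a set" and d :: nat
  assumes C_sub: "C \<subseteq> B" and d_ge: "C \<noteq> {} \<Longrightarrow> 2 \<le> d"
begin

text \<open>Normal forms of the free product of cyclic groups of order \<open>d\<close> generated by
  \<open>C\<close> and infinite cyclic ones generated by \<open>B - C\<close>. Letters from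
  \<open>C\<close> occur with positive sign only, in runs of length at most \<open>d - 1\<close>;
  the condition on \<open>take\<close> bounds the run that starts at \<open>l\<close>.\<close>

fun nf :: "('a \<times> bool) list \<Rightarrow> bool" where
  "nf [] = True"
| "nf (l # w) =
     (fst l \<in> B \<and> (fst l \<in> C \<longrightarrow> snd l \<and> take (d - 1) w \<noteq> replicate (d - 1) l) \<and>
      (w = [] \<or> hd w \<noteq> flip l) \<and> nf w)"

text \<open>Left multiplication on normal forms, as in van der Waerden's proof of the normal form
  theorem. A full run of \<open>d\<close> letters vanishes, and an inverse that meets nothing to
  cancel is written as the power \<open>d - 1\<close>.\<close>

definition act :: "'a \<times> bool \<Rightarrow> ('a \<times> bool) list \<Rightarrow> ('a \<times> bool) list" where
  "act l w =
    (if fst l \<notin> C then cons_red l w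
     else if snd l then (if take (d - 1) w = replicate (d - 1) l then drop (d - 1) w else l # w)
     else (if w \<noteq> [] \<and> hd w = flip l then tl w else replicate (d - 1) (flip l) @ w))"

lemma d_pos: "a \<in> C \<Longrightarrow> 1 \<le> d - 1"
  using d_ge by fastforce

lemma nf_append: "nf (u @ v) \<Longrightarrow> nf v"
  by (induction u) auto

lemma nf_drop: "nf w \<Longrightarrow> nf (drop k w)"
  using nf_append[of "take k w" "drop k w"] by simp

lemma nf_positive: "nf w \<Longrightarrow> l \<in> set w \<Longrightarrow> fst l \<in> B \<and> (fst l \<in> C \<longrightarrow> snd l)"
  by (induction w) auto

lemma nf_set: "nf w \<Longrightarrow> set w \<subseteq> B \<times> UNIV"
  using nf_positive by (auto simp: mem_Times_iff)

lemma nf_replicate: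
  assumes "a \<in> C" "nf w" "w = [] \<or> hd w \<noteq> (a, True)" "k \<le> d - 1"
  shows "nf (replicate k (a, True) @ w)"
  using assms(4)
proof (induction k)
  case (Suc k)
  let ?v = "replicate k (a, True) @ w"
  have v: "nf ?v" using Suc by simp
  have "take (d - 1) ?v \<noteq> replicate (d - 1) (a, True)"
    using take_replicate_append_neq[of k "d - 1" w "(a, True)"] Suc.prems assms(3) by simp
  moreover have "?v = [] \<or> hd ?v \<noteq> (a, False)"
    using nf_positive[OF v, of "hd ?v"] assms(1) by (metis hd_in_set fst_conv snd_conv)
  ultimately show ?case using v assms(1) C_sub by auto
qed (use assms in simp)

lemma nf_run:
  assumes "a \<in> C" "nf (replicate i (a, True) @ w)"
  shows "i \<le> d - 1"
proof (rule ccontr)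
  assume "\<not> i \<le> d - 1"
  then have i: "d \<le> i" by simp
  then have "drop (i - d) (replicate i (a, True) @ w) = replicate d (a, True) @ w" by simp
  then have "nf (replicate d (a, True) @ w)" using nf_drop[OF assms(2), of "i - d"] by simp
  moreover have "replicate d (a, True) = (a, True) # replicate (d - 1) (a, True)"
    using d_pos[OF assms(1)] by (cases d) simp_all
  ultimately show False using assms(1) by simp
qed

lemma nf_act: 
  assumes "nf w" "fst l \<in> B"
  shows "nf (act l w)"
proof (cases "fst l \<in> C")
  case False
  then show ?thesis using assms nf_append[of "[hd w]" "tl w"]
    by (cases w) (auto simp: act_def cons_red_def)
next
  case True
  obtain a s where l: "l = (a, s)" by (cases l)
  show ?thesis
  proof (cases s)
    case True
    have "w = [] \<or> hd w \<noteq> (a, False)"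
      using nf_positive[OF assms(1), of "hd w"] \<open>fst l \<in> C\<close> l by (metis hd_in_set fst_conv snd_conv)
    then show ?thesis using True \<open>fst l \<in> C\<close> assms l nf_drop by (auto simp: act_def)
  next
    case False
    then show ?thesis
      using \<open>fst l \<in> C\<close> assms l nf_replicate[of a w "d - 1"] nf_drop[of w 1]
      by (auto simp: act_def drop_Suc)
  qed
qed

lemma act_Cons: "nf (l # w) \<Longrightarrow> act l w = l # w"
  by (auto simp: act_def cons_red_def)

lemma act_flip:
  assumes "nf w" "fst l \<in> B"
  shows "act (flip l) (act l w) = w"
proof (cases "fst l \<in> C")
  case False
  have "reduced_word w" using assms(1) by (induction w) auto
  then show ?thesis using False by (simp add: act_def cons_red_flip)
next
  case True
  obtain a s where l: "l = (a, s)" by (cases l)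
  have a: "a \<in> C" using True l by simp
  \<comment> \<open>Only the initial run of \<open>a\<close> matters. It disappears when
    \<open>a\<close> meets a run of length \<open>d - 1\<close>, and it arises when the inverse of
    \<open>a\<close> meets no \<open>a\<close>.\<close>
  obtain i w' where w: "w = replicate i (a, True) @ w'" "w' = [] \<or> hd w' \<noteq> (a, True)"
    using split_replicate[of w "(a, True)"] by blast
  have i: "i \<le> d - 1" using nf_run a assms(1) unfolding w(1) by blast
  show ?thesis
  proof (cases s)
    case True
    show ?thesis
    proof (cases "i = d - 1")
      case True
      then have "act (a, True) w = w'" using a w by (simp add: act_def)
      moreover have "act (a, False) w' = w" using a w True by (auto simp: act_def)
      ultimately show ?thesis using l \<open>s\<close> by simp
    next
      case False
      then have "take (d - 1) w \<noteq> replicate (d - 1) (a, True)"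
        using take_replicate_append_neq[of i "d - 1" w' "(a, True)"] i w by simp
      then show ?thesis using a l \<open>s\<close> by (simp add: act_def)
    qed
  next
    case False
    show ?thesis
    proof (cases i)
      case 0
      then have "act (a, False) w = replicate (d - 1) (a, True) @ w" using a w by (auto simp: act_def)
      moreover have "act (a, True) (replicate (d - 1) (a, True) @ w) = w" using a by (simp add: act_def)
      ultimately show ?thesis using l False by simp
    next
      case (Suc j)
      then have *: "act (a, False) w = replicate j (a, True) @ w'" using a w by (simp add: act_def)
      have "take (d - 1) (replicate j (a, True) @ w') \<noteq> replicate (d - 1) (a, True)"
        using take_replicate_append_neq[of j "d - 1" w' "(a, True)"] i w Suc by simp
      then have "act (a, True) (replicate j (a, True) @ w') = w" using a w Suc by (simp add: act_def)
      then show ?thesis using * l False by simp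
    qed
  qed
qed

lemma act_power_replicate:
  assumes "a \<in> C" "w = [] \<or> hd w \<noteq> (a, True)" "k \<le> d - 1"
  shows "(act (a, True) ^^ k) w = replicate k (a, True) @ w"
  using assms(3)
proof (induction k)
  case (Suc k)
  then show ?case
    using take_replicate_append_neq[of k "d - 1" w "(a, True)"] assms by (simp add: act_def)
qed simp

text \<open>Stripping the initial run leaves \<open>w'\<close>, on which \<open>d\<close>
  applications build a run of \<open>d - 1\<close> letters and then remove it. As \<open>w\<close>
  lies in the same orbit, it is fixed too.\<close>

lemma act_power_d:
  assumes "a \<in> C" "nf w"
  shows "(act (a, True) ^^ d) w = w"
proof -
  let ?A = "act (a, True)"
  obtain i w' where w: "w = replicate i (a, True) @ w'" "w' = [] \<or> hd w' \<noteq> (a, True)"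
    using split_replicate[of w "(a, True)"] by blast
  have i: "i \<le> d - 1" using nf_run assms unfolding w(1) by blast
  have d: "d = Suc (d - 1)" using d_pos[OF assms(1)] by simp
  have "(?A ^^ d) w' = ?A ((?A ^^ (d - 1)) w')" by (subst d) simp
  also have "\<dots> = ?A (replicate (d - 1) (a, True) @ w')"
    using act_power_replicate[OF assms(1) w(2)] by simp
  also have "\<dots> = w'" using assms(1) by (simp add: act_def)
  finally have *: "(?A ^^ d) w' = w'" .
  have "w = (?A ^^ i) w'" using act_power_replicate[OF assms(1) w(2) i] w(1) by simp
  then have "(?A ^^ d) w = (?A ^^ (d + i)) w'" by (simp add: funpow_add)
  also have "\<dots> = (?A ^^ i) ((?A ^^ d) w')" by (simp add: funpow_add add.commute[of d])
  finally show ?thesis using * \<open>w = (?A ^^ i) w'\<close> by simp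
qed

lemma nf_foldr_act: "set u \<subseteq> B \<times> UNIV \<Longrightarrow> nf w \<Longrightarrow> nf (foldr act u w)"
  by (induction u) (auto simp: nf_act mem_Times_iff)

section \<open>The free group acting on normal forms\<close>

definition gact :: "'a \<Rightarrow> ('a \<times> bool) list \<Rightarrow> ('a \<times> bool) list" where
  "gact f = foldr act (word_of f)"

lemma nf_gact: "f \<in> carrier G \<Longrightarrow> nf w \<Longrightarrow> nf (gact f w)"
  unfolding gact_def by (rule nf_foldr_act[OF word_of_sub])

lemma gact_one [simp]: "gact \<one> w = w"
  by (simp add: gact_def)

lemma gact_lval_mult:
  assumes "fst l \<in> B" "f \<in> carrier G" "nf w"
  shows "gact (lval l \<otimes> f) w = act l (gact f w)"
proof (cases "word_of f \<noteq> [] \<and> hd (word_of f) = flip l")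
  case True
  then obtain v where v: "word_of f = flip l # v" by (cases "word_of f") auto
  have "nf (foldr act v w)" using word_of_sub[OF assms(2)] v assms(3) by (intro nf_foldr_act) auto
  then have "act l (act (flip l) (foldr act v w)) = foldr act v w"
    using act_flip[of "foldr act v w" "flip l"] assms(1) by simp
  then show ?thesis using v assms by (simp add: gact_def word_of_lval_mult cons_red_def)
next
  case False
  then show ?thesis using assms by (auto simp: gact_def word_of_lval_mult cons_red_def)
qed

lemma gact_word_val_mult:
  "set u \<subseteq> B \<times> UNIV \<Longrightarrow> f \<in> carrier G \<Longrightarrow> nf w \<Longrightarrow> gact (word_val G u \<otimes> f) w = foldr act u (gact f w)"
proof (induction u)
  case (Cons l u)
  then show ?case using gact_lval_mult[of l "word_val G u \<otimes> f" w] by (auto simp: mem_Times_iff m_assoc)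
qed simp

lemma gact_word_val: "set u \<subseteq> B \<times> UNIV \<Longrightarrow> nf w \<Longrightarrow> gact (word_val G u) w = foldr act u w"
  using gact_word_val_mult[of u \<one> w] by simp

lemma gact_mult:
  "f \<in> carrier G \<Longrightarrow> h \<in> carrier G \<Longrightarrow> nf w \<Longrightarrow> gact (f \<otimes> h) w = gact f (gact h w)"
  using gact_word_val_mult[of "word_of f" h w] word_of[of f] by (simp add: gact_def)

lemma gact_inv:
  "f \<in> carrier G \<Longrightarrow> nf w \<Longrightarrow> gact (inv f) (gact f w) = w"
  "f \<in> carrier G \<Longrightarrow> nf w \<Longrightarrow> gact f (gact (inv f) w) = w"
  using gact_mult[of "inv f" f w] gact_mult[of f "inv f" w] by simp_all

text \<open>This takes the place of the kernel of the projection from F to F / N: it is closed under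
  conjugation in the whole group and contains the \<open>d\<close>-th powers of the elements of
  \<open>C\<close>.\<close>

definition act_kernel :: "'a set" where
  "act_kernel = {f \<in> carrier G. \<forall>w. nf w \<longrightarrow> gact f w = w}"

lemma act_kernel_closed:
  shows "\<one> \<in> act_kernel"
    and "f \<in> act_kernel \<Longrightarrow> h \<in> act_kernel \<Longrightarrow> f \<otimes> h \<in> act_kernel"
    and "f \<in> act_kernel \<Longrightarrow> inv f \<in> act_kernel"
    and "f \<in> act_kernel \<Longrightarrow> h \<in> carrier G \<Longrightarrow> inv h \<otimes> f \<otimes> h \<in> act_kernel"
proof -
  show "\<one> \<in> act_kernel" by (simp add: act_kernel_def)
  show "f \<in> act_kernel \<Longrightarrow> h \<in> act_kernel \<Longrightarrow> f \<otimes> h \<in> act_kernel"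
    by (simp add: act_kernel_def gact_mult)
  show "f \<in> act_kernel \<Longrightarrow> inv f \<in> act_kernel"
    unfolding act_kernel_def using gact_inv(1) by force
  show "f \<in> act_kernel \<Longrightarrow> h \<in> carrier G \<Longrightarrow> inv h \<otimes> f \<otimes> h \<in> act_kernel"
    by (simp add: act_kernel_def gact_mult nf_gact gact_inv)
qed

lemma power_in_act_kernel:
  assumes "a \<in> C"
  shows "a [^] d \<in> act_kernel"
proof -
  have a: "a \<in> B" "a \<in> carrier G" using assms C_sub basis_closed by auto
  have "word_val G (replicate n (a, True)) = a [^] n" for n
    using a by (induction n) (simp_all add: lval_def nat_pow_Suc2[symmetric] del: nat_pow_Suc)
  moreover have "gact (word_val G (replicate d (a, True))) w = w" if "nf w" for w
  proof -
    have "set (replicate d (a, True)) \<subseteq> B \<times> UNIV" using a by auto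
    then show ?thesis
      using gact_word_val that act_power_d[OF assms that] by (simp add: foldr_replicate)
  qed
  ultimately show ?thesis using a by (simp add: act_kernel_def)
qed

lemma foldr_act_append: "nf (u @ v) \<Longrightarrow> foldr act u v = u @ v"
proof (induction u)
  case (Cons l u)
  then show ?case using act_Cons[of l "u @ v"] by simp
qed simp

lemma foldr_act_replicate_d:
  assumes "a \<in> C" "nf w"
  shows "foldr act (replicate (d - 1) (a, True)) w = act (a, False) w"
proof -
  let ?A = "act (a, True)" and ?v = "foldr act (replicate (d - 1) (a, True)) w"
  have d: "d = Suc (d - 1)" using d_pos[OF assms(1)] by simp
  have a: "a \<in> B" using assms C_sub by auto
  have v: "nf ?v" by (rule nf_foldr_act) (use a assms in auto)
  have "?A ?v = (?A ^^ d) w" by (subst d) (simp add: foldr_replicate)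
  then have "?A ?v = w" using act_power_d[OF assms] by simp
  then show ?thesis using act_flip[OF v, of "(a, True)"] a by simp
qed

text \<open>Each rewriting done by \<open>act\<close> replaces a word by one with the same action: a
  cancelling pair acts trivially, and the power \<open>d - 1\<close> acts as the inverse.\<close>

lemma foldr_act_act:
  assumes l: "fst l \<in> B" and x: "nf x" and v: "nf v"
  shows "foldr act (act l x) v = act l (foldr act x v)"
proof (cases "fst l \<in> C")
  case False
  show ?thesis
  proof (cases "x \<noteq> [] \<and> hd x = flip l")
    case True
    then obtain y where y: "x = flip l # y" by (cases x) auto
    have "nf (foldr act y v)" using nf_set[OF x] y v by (intro nf_foldr_act) auto
    then have "act l (act (flip l) (foldr act y v)) = foldr act y v"
      using act_flip[of "foldr act y v" "flip l"] l by simp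
    moreover have "act l x = y" using y False by (simp add: act_def cons_red_def)
    ultimately show ?thesis unfolding y by simp
  next
    case x': False
    then have "act l x = l # x" using False by (auto simp: act_def cons_red_def)
    then show ?thesis by simp
  qed
next
  case True
  obtain a s where ls: "l = (a, s)" by (cases l)
  have a: "a \<in> C" "a \<in> B" using True ls C_sub by auto
  have nx: "nf (foldr act x v)" using nf_set[OF x] v by (intro nf_foldr_act) auto
  show ?thesis
  proof (cases s)
    case True
    show ?thesis
    proof (cases "take (d - 1) x = replicate (d - 1) l")
      case eq: True
      define y where "y = drop (d - 1) x"
      have xy: "x = replicate (d - 1) l @ y" using eq y_def by (metis append_take_drop_id)
      have ny: "nf (foldr act y v)" using nf_set[OF x] xy v by (intro nf_foldr_act) auto
      have "act l (foldr act x v) = act l (act (flip l) (foldr act y v))"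
        unfolding xy using foldr_act_replicate_d[OF a(1) ny] ls True by simp
      also have "\<dots> = foldr act y v" using act_flip[OF ny, of "flip l"] l by simp
      moreover have "act l x = y" using a ls True eq by (simp add: act_def y_def)
      ultimately show ?thesis by simp
    next
      case False
      then have "act l x = l # x" using a ls True by (simp add: act_def)
      then show ?thesis by simp
    qed
  next
    case False
    show ?thesis
    proof (cases "x \<noteq> [] \<and> hd x = flip l")
      case True
      then obtain y where y: "x = flip l # y" by (cases x) auto
      have "nf (foldr act y v)" using nf_set[OF x] y v by (intro nf_foldr_act) auto
      then have "act l (act (flip l) (foldr act y v)) = foldr act y v"
        using act_flip[of "foldr act y v" "flip l"] l by simp
      moreover have "act l x = y" using y False a ls by (simp add: act_def)
      ultimately show ?thesis unfolding y by simp
    next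
      case x': False
      then have "act l x = replicate (d - 1) (flip l) @ x" using a ls False by (auto simp: act_def)
      then show ?thesis using foldr_act_replicate_d[OF a(1) nx] ls False by simp
    qed
  qed
qed

text \<open>The normal form of \<open>f\<close> is \<open>gact f []\<close>. That it acts as
  \<open>f\<close> does makes the value at the empty word determine the whole action.\<close>

lemma gact_normal_form:
  assumes "f \<in> carrier G" "nf v"
  shows "gact f v = foldr act (gact f []) v"
proof -
  have "foldr act u v = foldr act (foldr act u []) v" if "set u \<subseteq> B \<times> UNIV" for u
    using that
  proof (induction u)
    case (Cons l u)
    have "nf (foldr act u [])" using Cons.prems by (intro nf_foldr_act) auto
    then show ?case using foldr_act_act[of l "foldr act u []" v] Cons assms(2) by (auto simp: mem_Times_iff)
  qed simp
  then show ?thesis unfolding gact_def using word_of_sub[OF assms(1)] by blast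
qed

section \<open>Concatenation of normal forms and centralizers\<close>

lemma length_act: "fst l \<in> C \<longrightarrow> snd l \<Longrightarrow> length (act l w) \<le> Suc (length w)"
  by (cases w) (auto simp: act_def cons_red_def)

lemma act_long: "fst l \<in> C \<longrightarrow> snd l \<Longrightarrow> Suc (length w) \<le> length (act l w) \<Longrightarrow> act l w = l # w"
  by (cases w) (auto simp: act_def cons_red_def split: if_splits)

text \<open>A positive letter lengthens a normal form by at most one, so a word that lengthens it by the
  full amount acts by mere concatenation.\<close>

lemma foldr_act_long:
  assumes "\<forall>l\<in>set u. fst l \<in> C \<longrightarrow> snd l" "length u + length w \<le> length (foldr act u w)"
  shows "foldr act u w = u @ w"
proof -
  have le: "length (foldr act u w) \<le> length u + length w" if "\<forall>l\<in>set u. fst l \<in> C \<longrightarrow> snd l" for u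
    using that
  proof (induction u)
    case (Cons l u)
    then show ?case using length_act[of l "foldr act u w"] by simp
  qed simp
  show ?thesis
    using assms
  proof (induction u)
    case (Cons l u)
    have 1: "length (foldr act u w) \<le> length u + length w" using le[of u] Cons.prems by simp
    have 2: "length (act l (foldr act u w)) \<le> Suc (length (foldr act u w))"
      using length_act[of l] Cons.prems by simp
    have "foldr act u w = u @ w" using Cons 1 2 by simp
    moreover have "act l (foldr act u w) = l # foldr act u w"
      using act_long[of l] Cons.prems 1 2 by simp
    ultimately show ?case by simp
  qed simp
qed

lemma nf_junction:
  assumes "nf u" "nf v" "u = [] \<or> v = [] \<or> ((fst (last u) \<in> C \<longrightarrow> fst (hd v) \<noteq> fst (last u)) \<and> hd v \<noteq> flip (last u))"
  shows "nf (u @ v)"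
proof (cases "v = []")
  case False
  show ?thesis
    using assms
  proof (induction u)
    case (Cons l u)
    show ?case
    proof (cases "u = []")
      case True
      have "take (d - 1) v \<noteq> replicate (d - 1) l" if "fst l \<in> C"
      proof -
        have "hd v \<noteq> l" using that Cons.prems(3) True False by auto
        then show ?thesis using take_replicate_append_neq[of 0 "d - 1" v l] d_pos[OF that] by simp
      qed
      then show ?thesis using Cons.prems True False by auto
    next
      case u: False
      have "take (d - 1) (u @ v) \<noteq> replicate (d - 1) l" if "fst l \<in> C"
      proof
        \<comment> \<open>A full run reaching across the junction would make \<open>last u\<close>
          and \<open>hd v\<close> the same letter from \<open>C\<close>.\<close>
        assume *: "take (d - 1) (u @ v) = replicate (d - 1) l"
        have nl: "take (d - 1) u \<noteq> replicate (d - 1) l" using Cons.prems(1) that by simp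
        then have len: "length u < d - 1" using * by (cases "d - 1 \<le> length u") auto
        then have eq: "u @ take (d - 1 - length u) v = replicate (d - 1) l" using * by simp
        have "set (u @ take (d - 1 - length u) v) \<subseteq> {l}" unfolding eq by auto
        then have all: "set u \<subseteq> {l}" "set (take (d - 1 - length u) v) \<subseteq> {l}" by simp_all
        have "last u = l" using all u last_in_set by blast
        moreover have "hd v = l"
        proof -
          have "take (d - 1 - length u) v \<noteq> []" using False len by simp
          then have "hd (take (d - 1 - length u) v) = l" using all(2) hd_in_set by blast
          then show ?thesis using len by (simp add: hd_take)
        qed
        ultimately show False using Cons.prems(3) that u False by simp
      qed
      then show ?thesis using Cons u by auto
    qed
  qed simp
qed (use assms in simp)

lemma nf_power:
  assumes "nf u" "fst (last u) \<in> C \<longrightarrow> fst (hd u) \<noteq> fst (last u)" "hd u \<noteq> flip (last u)"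
  shows "nf (concat (replicate m u))"
proof (induction m)
  case (Suc m)
  show ?case
  proof (cases m)
    case 0
    then show ?thesis using assms by simp
  next
    case (Suc k)
    show ?thesis
    proof (cases "u = []")
      case False
      then have "hd (concat (replicate m u)) = hd u" using Suc by simp
      then show ?thesis using nf_junction[of u "concat (replicate m u)"] assms Suc.IH by simp
    qed simp
  qed
qed simp

text \<open>Let U be the power of \<open>u\<close> and write \<omega> for \<open>gact q []\<close>.
  No reduction occurs between \<omega> and U, so q sends U to their concatenation. The commuted
  expression, U acting on \<omega>, therefore has full length, and \<open>foldr_act_long\<close>
  turns it into the concatenation in the other order. Thus \<omega> and \<open>u\<close> begin the
  same word.\<close>

lemma commuting_power:
  assumes q: "q \<in> carrier G"
    and comm: "\<exists>m\<ge>1. gact q (foldr act (concat (replicate m u)) []) = foldr act (concat (replicate m u)) (gact q [])"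
    and u: "nf u" "u \<noteq> []" "fst (last u) \<in> C \<longrightarrow> fst (hd u) \<noteq> fst (last u)" "hd u \<noteq> flip (last u)"
    and junction: "gact q [] \<noteq> []" "fst (last (gact q [])) \<in> C \<longrightarrow> fst (hd u) \<noteq> fst (last (gact q []))"
      "hd u \<noteq> flip (last (gact q []))"
  shows "\<exists>v v'. gact q [] @ v = u @ v'"
proof -
  obtain m where m: "m \<ge> 1" "gact q (foldr act (concat (replicate m u)) []) =
      foldr act (concat (replicate m u)) (gact q [])" using comm by blast
  let ?U = "concat (replicate m u)" and ?\<omega> = "gact q []"
  obtain k where k: "m = Suc k" using m(1) by (cases m) auto
  have U: "nf ?U" using nf_power u by blast
  have \<omega>: "nf ?\<omega>" using nf_gact[OF q] by simp
  have hd: "hd ?U = hd u" using u(2) k by simp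
  have "nf (?\<omega> @ ?U)" using nf_junction[OF \<omega> U] junction hd by simp
  then have "gact q ?U = ?\<omega> @ ?U" using gact_normal_form[OF q U] foldr_act_append by simp
  moreover have "foldr act ?U [] = ?U" using foldr_act_append[of ?U "[]"] U by simp
  ultimately have *: "foldr act ?U ?\<omega> = ?\<omega> @ ?U" using m(2) by simp
  then have "foldr act ?U ?\<omega> = ?U @ ?\<omega>"
    using nf_positive[OF U] by (intro foldr_act_long) auto
  then have "?\<omega> @ ?U = u @ (concat (replicate k u) @ ?\<omega>)" using * k by simp
  then show ?thesis by blast
qed

text \<open>Commutation is assumed only for some power of each word because the subgroup to be
  centralized has finite index: it contains a power of every element. A nonempty normal form of
  \<open>q\<close> is refuted by words \<open>u\<close> that do not reduce against its end but
  disagree with its beginning.\<close>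

lemma centralizer_trivial:
  assumes q: "q \<in> carrier G"
    and comm: "\<And>u. set u \<subseteq> B \<times> UNIV \<Longrightarrow>
      \<exists>m\<ge>1. gact q (foldr act (concat (replicate m u)) []) = foldr act (concat (replicate m u)) (gact q [])"
    and big: "(\<exists>x\<in>B - C. \<exists>y\<in>B - C. x \<noteq> y) \<or> (\<exists>a\<in>C. \<exists>b\<in>C. \<exists>c\<in>C. a \<noteq> b \<and> b \<noteq> c \<and> a \<noteq> c) \<or>
      (\<exists>a\<in>C. \<exists>b\<in>C. C = {a, b} \<and> B = C \<and> a \<noteq> b \<and> 3 \<le> d)"
  shows "gact q [] = []"
proof (rule ccontr)
  let ?\<omega> = "gact q []"
  assume ne: "?\<omega> \<noteq> []"
  have \<omega>: "nf ?\<omega>" using nf_gact[OF q] by simp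
  have step: "\<exists>v v'. ?\<omega> @ v = u @ v'"
    if "nf u" "u \<noteq> []" "fst (last u) \<in> C \<longrightarrow> fst (hd u) \<noteq> fst (last u)" "hd u \<noteq> flip (last u)"
      "fst (last ?\<omega>) \<in> C \<longrightarrow> fst (hd u) \<noteq> fst (last ?\<omega>)" "hd u \<noteq> flip (last ?\<omega>)" for u
    using commuting_power[OF q comm[OF nf_set]] that ne by blast
  have hd_eq: "hd ?\<omega> = hd u" if "?\<omega> @ v = u @ v'" "u \<noteq> []" for u v v'
    using that ne by (metis hd_append2)
  consider (free) x y where "x \<in> B - C" "y \<in> B - C" "x \<noteq> y"
    | (three) a b c where "a \<in> C" "b \<in> C" "c \<in> C" "a \<noteq> b" "b \<noteq> c" "a \<noteq> c"
    | (two) a b where "a \<in> C" "b \<in> C" "C = {a, b}" "B = C" "a \<noteq> b" "3 \<le> d"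
    using big by blast
  then show False
  proof cases
    case free
    \<comment> \<open>Two letters have to be avoided, one for disagreement at the beginning and one
      against cancellation at the end, so three candidates suffice.\<close>
    have "\<exists>l\<in>{(x, True), (x, False), (y, True)}. l \<noteq> hd ?\<omega> \<and> l \<noteq> flip (last ?\<omega>)"
      using free(3) by (cases "hd ?\<omega>"; cases "flip (last ?\<omega>)") auto
    then obtain l where l: "l \<in> {(x, True), (x, False), (y, True)}" "l \<noteq> hd ?\<omega>" "l \<noteq> flip (last ?\<omega>)" by blast
    then have "fst l \<in> B - C" using free by auto
    then have "\<exists>v v'. ?\<omega> @ v = [l] @ v'" using l by (intro step) auto
    then show False using hd_eq[of _ "[l]"] l by force
  next
    case three
    have "\<exists>e\<in>{a, b, c}. e \<noteq> fst (hd ?\<omega>) \<and> e \<noteq> fst (last ?\<omega>)" using three by auto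
    then obtain e where e: "e \<in> C" "e \<noteq> fst (hd ?\<omega>)" "e \<noteq> fst (last ?\<omega>)" using three by blast
    obtain f where f: "f \<in> C" "f \<noteq> e" using three by metis
    \<comment> \<open>A single torsion letter would merge with itself in powers of
      \<open>?u\<close>; the second letter \<open>f\<close> separates the runs.\<close>
    let ?u = "[(e, True), (f, True)]"
    have "take (d - 1) [(f, True)] \<noteq> replicate (d - 1) (e, True)"
      using d_pos[OF e(1)] f by (cases "d - 1") auto
    moreover have "take (d - 1) [] \<noteq> replicate (d - 1) (f, True)"
      using d_pos[OF e(1)] by (cases "d - 1") auto
    moreover have "(e, True) \<noteq> flip (last ?\<omega>)" using e(3) by (metis fst_conv fst_flip)
    ultimately have "\<exists>v v'. ?\<omega> @ v = ?u @ v'"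
      using e f C_sub by (intro step) auto
    then show False using hd_eq[of _ ?u] e by force
  next
    case two
    have last: "last ?\<omega> \<in> {(a, True), (b, True)}" and hd: "hd ?\<omega> \<in> {(a, True), (b, True)}"
      using nf_positive[OF \<omega>, of "last ?\<omega>"] nf_positive[OF \<omega>, of "hd ?\<omega>"] ne two
      by (auto simp: prod_eq_iff)
    obtain s e where se: "s \<in> C" "e \<in> C" "s \<noteq> e" "last ?\<omega> = (s, True)" "hd ?\<omega> = (s, True) \<or> hd ?\<omega> = (e, True)"
      using last hd two by blast
    \<comment> \<open>With two factors the first letter may be forced to be \<open>e\<close>, so two
      test words are used that differ at the second letter. The run of length 2 in the longer one is
      a normal form because \<open>d\<close> is at least 3; this is where the infinite dihedral
      group drops out.\<close>
    have nfu: "nf (replicate i (e, True) @ [(s, True)])" if "i \<le> 2" for i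
    proof (rule nf_replicate)
      have "take (d - 1) [] \<noteq> replicate (d - 1) (s, True)"
        using d_pos[OF se(1)] by (cases "d - 1") auto
      then show "nf [(s, True)]" using se C_sub by auto
    qed (use se two that in auto)
    have nfu1: "nf [(e, True), (s, True)]" and nfu2: "nf [(e, True), (e, True), (s, True)]"
      using nfu[of 1] nfu[of 2] by (simp_all add: numeral_2_eq_2 del: nf.simps)
    have 1: "\<exists>v v'. ?\<omega> @ v = [(e, True), (s, True)] @ v'"
      by (rule step[OF nfu1]) (use se in auto)
    have 2: "\<exists>v v'. ?\<omega> @ v = [(e, True), (e, True), (s, True)] @ v'"
      by (rule step[OF nfu2]) (use se in auto)
    obtain v1 v1' v2 v2' where
      *: "?\<omega> @ v1 = [(e, True), (s, True)] @ v1'" "?\<omega> @ v2 = [(e, True), (e, True), (s, True)] @ v2'"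
      using 1 2 by blast
    show False
    proof (cases "length ?\<omega> \<ge> 2")
      case True
      then have "?\<omega> ! 1 = (?\<omega> @ v1) ! 1" "?\<omega> ! 1 = (?\<omega> @ v2) ! 1" by (simp_all add: nth_append)
      then show False unfolding * using se by simp
    next
      case False
      then obtain l where "?\<omega> = [l]" using ne by (cases ?\<omega>; cases "tl ?\<omega>") auto
      then show False using * se by auto
    qed
  qed
qed

section \<open>Square-free words and their normal forms\<close>

definition expand :: "('a \<times> bool) list \<Rightarrow> ('a \<times> bool) list" where
  "expand w = concat (map (\<lambda>l. if fst l \<in> C \<and> \<not> snd l then replicate (d - 1) (flip l) else [l]) w)"

lemma expand_simps [simp]:
  "expand [] = []"
  "expand (l # w) = (if fst l \<in> C \<and> \<not> snd l then replicate (d - 1) (flip l) @ expand w else l # expand w)"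
  by (simp_all add: expand_def)

lemma expand_eq_Nil [simp]: "expand w = [] \<longleftrightarrow> w = []"
proof (cases w)
  case (Cons l v)
  then show ?thesis using d_pos[of "fst l"] by (cases "d - 1") auto
qed simp

lemma hd_expand_neg: "fst l \<in> C \<Longrightarrow> \<not> snd l \<Longrightarrow> hd (expand (l # w)) = flip l"
  using d_pos[of "fst l"] by (cases "d - 1") simp_all

text \<open>Reducedness and absence of squares make every letter from \<open>C\<close> a run of its
  own. Expanding it to 1 or \<open>d - 1\<close> positive letters creates no contact with another
  run, so the expanded word is already normal.\<close>

lemma foldr_act_square_free:
  assumes "set w \<subseteq> B \<times> UNIV" "reduced_word w" "\<And>l. fst l \<in> C \<Longrightarrow> \<not> adj w l l"
  shows "foldr act w [] = expand w \<and> nf (expand w)"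
  using assms
proof (induction w)
  case (Cons l w)
  let ?e = "expand w"
  have adj: "\<not> adj w l' l'" if "fst l' \<in> C" for l' using Cons.prems(3)[OF that] by (simp add: adj_Cons)
  have IH: "foldr act w [] = ?e" "nf ?e" using Cons.IH adj Cons.prems by simp_all
  have lB: "fst l \<in> B" using Cons.prems by (auto simp: mem_Times_iff)
  have hd: "fst (hd ?e) = fst (hd w)" "fst (hd w) \<notin> C \<Longrightarrow> hd ?e = hd w" if "w \<noteq> []"
  proof -
    obtain l' w' where w: "w = l' # w'" using \<open>w \<noteq> []\<close> by (cases w) auto
    have "fst (hd ?e) = fst (hd w) \<and> (fst (hd w) \<notin> C \<longrightarrow> hd ?e = hd w)"
    proof (cases "fst l' \<in> C \<and> \<not> snd l'")
      case True
      then have "hd ?e = flip l'" unfolding w by (intro hd_expand_neg) simp_all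
      then show ?thesis using True w by simp
    next
      case False
      then have "expand w = l' # expand w'" unfolding w by auto
      then have "hd ?e = l'" by simp
      then show ?thesis using w by simp
    qed
    then show "fst (hd ?e) = fst (hd w)" "fst (hd w) \<notin> C \<Longrightarrow> hd ?e = hd w" by blast+
  qed
  show ?case
  proof (cases "fst l \<in> C")
    case True
    have "w = [] \<or> hd w \<noteq> l \<and> hd w \<noteq> flip l"
      using Cons.prems(2) Cons.prems(3)[OF True] by (auto simp: adj_Cons)
    then have "w = [] \<or> fst (hd w) \<noteq> fst l" by (auto simp: prod_eq_iff flip_def)
    then have e: "?e = [] \<or> fst (hd ?e) \<noteq> fst l" using hd by auto
    obtain a s where ls: "l = (a, s)" by (cases l)
    have e': "?e = [] \<or> hd ?e \<noteq> (a, s')" for s' using e ls by auto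
    have tk: "take (d - 1) ?e \<noteq> replicate (d - 1) (a, True)"
      using take_replicate_append_neq[of 0 "d - 1" ?e "(a, True)"] e'[of True] d_pos[OF True] by simp
    show ?thesis
    proof (cases s)
      case s: True
      then have "act l ?e = l # ?e" using tk True ls by (simp add: act_def)
      moreover have "nf (l # ?e)" using IH(2) tk lB True ls s e'[of False] by auto
      ultimately show ?thesis using IH ls s by simp
    next
      case s: False
      then have "act l ?e = replicate (d - 1) (flip l) @ ?e"
        using True ls e'[of True] by (auto simp: act_def)
      moreover have "nf (replicate (d - 1) (flip l) @ ?e)"
        using nf_replicate[of a ?e "d - 1"] IH(2) e'[of True] True ls s by simp
      ultimately show ?thesis using IH ls s True by simp
    qed
  next
    case False
    have "w = [] \<or> hd w \<noteq> flip l" using Cons.prems(2) by simp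
    then have "?e = [] \<or> hd ?e \<noteq> flip l" using hd False by auto
    then have "act l ?e = l # ?e" "nf (l # ?e)"
      using IH(2) False lB by (auto simp: act_def cons_red_def)
    then show ?thesis using IH False by simp
  qed
qed (simp add: expand_def)

text \<open>The second alternative reflects the case \<open>d = 2\<close>, in which the expansion of
  an inverse torsion letter is a single letter.\<close>

lemma square_free_letter:
  assumes "set w \<subseteq> B \<times> UNIV" "reduced_word w" "\<And>l. fst l \<in> C \<Longrightarrow> \<not> adj w l l"
    and "foldr act w [] = [e]"
  shows "w = [e] \<or> (fst e \<in> C \<and> w = [flip e])"
proof -
  have e: "expand w = [e]" using foldr_act_square_free[of w] assms by simp
  then obtain l v where w: "w = l # v" by (cases w) (auto simp: expand_def)
  show ?thesis
  proof (cases "fst l \<in> C \<and> \<not> snd l")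
    case True
    moreover from this obtain k where "d - 1 = Suc k" using d_pos[of "fst l"] by (cases "d - 1") auto
    ultimately have "flip l = e" "v = []" using e w by (auto simp: Cons_eq_append_conv)
    then show ?thesis using w True by auto
  next
    case False
    then show ?thesis using e w by auto
  qed
qed

end

section \<open>Conjugacy classes and surface words under homomorphisms\<close>

context group
begin

lemma conj_by_closed [simp]: "a \<in> carrier G \<Longrightarrow> b \<in> carrier G \<Longrightarrow> conj_by G a b \<in> carrier G"
  by (simp add: conj_by_def)

lemma conj_class_closed: "a \<in> carrier G \<Longrightarrow> conj_class G a \<subseteq> carrier G"
  by (auto simp: conj_class_def)

lemma conj_class_self: "a \<in> carrier G \<Longrightarrow> a \<in> conj_class G a"
  unfolding conj_class_def by (rule image_eqI[of _ _ \<one>]) (simp_all add: conj_by_def)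

lemma conj_by_mult:
  "a \<in> carrier G \<Longrightarrow> h \<in> carrier G \<Longrightarrow> k \<in> carrier G \<Longrightarrow>
    conj_by G (conj_by G a h) k = conj_by G a (h \<otimes> k)"
  by (simp add: conj_by_def inv_mult_group m_assoc)

lemma conj_by_inv:
  "a \<in> carrier G \<Longrightarrow> h \<in> carrier G \<Longrightarrow> conj_by G (inv a) h = inv (conj_by G a h)"
  by (simp add: conj_by_def inv_mult_group m_assoc)

lemma conj_by_pow:
  "a \<in> carrier G \<Longrightarrow> h \<in> carrier G \<Longrightarrow> conj_by G (a [^] (n :: nat)) h = conj_by G a h [^] n"
proof (induction n)
  case (Suc n)
  have "conj_by G (a [^] Suc n) h = conj_by G (a [^] n) h \<otimes> conj_by G a h"
    using Suc.prems by (simp add: conj_by_def m_assoc)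
  also have "\<dots> = conj_by G a h [^] Suc n" using Suc by simp
  finally show ?case .
qed (simp add: conj_by_def)

lemma conj_class_conj_by:
  assumes "a \<in> carrier G" "h \<in> carrier G"
  shows "conj_class G (conj_by G a h) = conj_class G a"
proof -
  have "(\<lambda>k. h \<otimes> k) ` carrier G = carrier G"
  proof
    show "carrier G \<subseteq> (\<lambda>k. h \<otimes> k) ` carrier G"
    proof
      fix k assume "k \<in> carrier G"
      then show "k \<in> (\<lambda>k. h \<otimes> k) ` carrier G"
        using assms by (intro image_eqI[of _ _ "inv h \<otimes> k"]) simp_all
    qed
  qed (use assms in auto)
  then have "conj_class G a = (\<lambda>k. conj_by G a (h \<otimes> k)) ` carrier G"
    unfolding conj_class_def by (metis image_image)
  then show ?thesis unfolding conj_class_def using assms by (simp add: conj_by_mult)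
qed

lemma image_inv_conj_class:
  "a \<in> carrier G \<Longrightarrow> (\<lambda>x. inv x) ` conj_class G a = conj_class G (inv a)"
  unfolding conj_class_def image_image by (rule image_cong) (simp_all add: conj_by_inv)

lemma image_pow_conj_class:
  "a \<in> carrier G \<Longrightarrow> (\<lambda>x. x [^] (n :: nat)) ` conj_class G a = conj_class G (a [^] n)"
  unfolding conj_class_def image_image by (rule image_cong) (simp_all add: conj_by_pow)

lemma comm_closed [simp]: "a \<in> carrier G \<Longrightarrow> b \<in> carrier G \<Longrightarrow> comm G a b \<in> carrier G"
  by (simp add: comm_def)

lemma foldr_mult_closed: "set ss \<subseteq> carrier G \<Longrightarrow> foldr (\<otimes>) ss \<one> \<in> carrier G"
  by (induction ss) auto

lemma foldr_mult_append:
  "set ss \<subseteq> carrier G \<Longrightarrow> set ts \<subseteq> carrier G \<Longrightarrow>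
    foldr (\<otimes>) (ss @ ts) \<one> = foldr (\<otimes>) ss \<one> \<otimes> foldr (\<otimes>) ts \<one>"
  by (induction ss) (simp_all add: foldr_mult_closed m_assoc del: foldr_append)

lemma comm_list_closed:
  assumes "x ` {1..g} \<subseteq> carrier G" "y ` {1..g} \<subseteq> carrier G"
  shows "set (map (\<lambda>i. comm G (x i) (y i)) [1..<g+1]) \<subseteq> carrier G"
proof
  fix a assume "a \<in> set (map (\<lambda>i. comm G (x i) (y i)) [1..<g+1])"
  then obtain i where i: "i \<in> set [1..<g+1]" "a = comm G (x i) (y i)" unfolding set_map by blast
  then have "i \<in> {1..g}" by auto
  then show "a \<in> carrier G" using assms i(2) by (simp add: image_subset_iff)
qed

lemma surface_word_closed:
  assumes "x ` {1..g} \<subseteq> carrier G" "y ` {1..g} \<subseteq> carrier G" "set ss \<subseteq> carrier G"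
  shows "surface_word G g x y ss \<in> carrier G"
  unfolding surface_word_def set_append
  by (intro foldr_mult_closed) (use comm_list_closed[OF assms(1,2)] assms(3) in simp)

lemma surface_word_append:
  assumes "x ` {1..g} \<subseteq> carrier G" "y ` {1..g} \<subseteq> carrier G" "set ss \<subseteq> carrier G" "set ts \<subseteq> carrier G"
  shows "surface_word G g x y (ss @ ts) = surface_word G g x y ss \<otimes> foldr (\<otimes>) ts \<one>"
proof -
  let ?cs = "map (\<lambda>i. comm G (x i) (y i)) [1..<g+1]"
  have "set (?cs @ ss) \<subseteq> carrier G" using comm_list_closed[OF assms(1,2)] assms(3) by simp
  then show ?thesis
    using foldr_mult_append[of "?cs @ ss" ts] assms(4) by (simp add: surface_word_def)
qed

end

context group_hom
begin

lemma image_conj_class: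
  assumes "h ` carrier G = carrier H" "a \<in> carrier G"
  shows "h ` conj_class G a = conj_class H (h a)"
proof -
  have "conj_class H (h a) = (\<lambda>b. conj_by H (h a) (h b)) ` carrier G"
    unfolding conj_class_def assms(1)[symmetric] by (simp add: image_image)
  moreover have "h (conj_by G a b) = conj_by H (h a) (h b)" if "b \<in> carrier G" for b
    using that assms(2) by (simp add: conj_by_def)
  ultimately show ?thesis unfolding conj_class_def by (auto simp: image_image intro!: image_cong)
qed

lemma hom_surface_word:
  assumes "x ` {1..g} \<subseteq> carrier G" "y ` {1..g} \<subseteq> carrier G" "set ss \<subseteq> carrier G"
  shows "h (surface_word G g x y ss) = surface_word H g (\<lambda>i. h (x i)) (\<lambda>i. h (y i)) (map h ss)"
proof -
  have *: "h (foldr (\<otimes>\<^bsub>G\<^esub>) ts \<one>\<^bsub>G\<^esub>) = foldr (\<otimes>\<^bsub>H\<^esub>) (map h ts) \<one>\<^bsub>H\<^esub>" if "set ts \<subseteq> carrier G" for ts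
    using that by (induction ts) (simp_all add: G.foldr_mult_closed)
  let ?cs = "map (\<lambda>i. comm G (x i) (y i)) [1..<g+1]"
  have "set (?cs @ ss) \<subseteq> carrier G" using G.comm_list_closed[OF assms(1,2)] assms(3) by simp
  moreover have "map h ?cs = map (\<lambda>i. comm H (h (x i)) (h (y i))) [1..<g+1]"
    using assms by (auto simp: comm_def image_subset_iff)
  ultimately show ?thesis unfolding surface_word_def by (simp only: * map_append)
qed

end

section \<open>Algebraic mapping class groups\<close>

lemma autoD:
  assumes "group G" "\<phi> \<in> auto G"
  shows "group_hom G G \<phi>" "bij_betw \<phi> (carrier G) (carrier G)" "\<phi> \<in> extensional (carrier G)"
    "\<phi> ` carrier G = carrier G"
  using assms by (auto simp: auto_def Bij_def group_hom_def group_hom_axioms_def bij_betw_def)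

lemma AM_iff:
  "\<phi> \<in> carrier (AM G g x y pss) \<longleftrightarrow>
     \<phi> \<in> auto G \<and>
     \<phi> (surface_word G g x y (concat pss)) = surface_word G g x y (concat pss) \<and>
     (\<forall>ps\<in>set pss.
       (\<lambda>C. \<phi> ` C) ` (\<lambda>s. conj_class G (inv\<^bsub>G\<^esub> s)) ` set ps = (\<lambda>s. conj_class G (inv\<^bsub>G\<^esub> s)) ` set ps)"
  by (simp add: AM_def AutoGroup_def)

lemma AM_mult:
  assumes "\<phi> \<in> carrier (AM G g x y pss)" "\<psi> \<in> carrier (AM G g x y pss)"
  shows "\<phi> \<otimes>\<^bsub>AM G g x y pss\<^esub> \<psi> = compose (carrier G) \<phi> \<psi>"
  using assms by (simp add: AM_iff) (simp add: AM_def AutoGroup_def BijGroup_def auto_def)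

text \<open>The group structure permits the passage from injectivity to automorphisms with trivial
  image.\<close>

lemma (in group) AM_group:
  assumes "x ` {1..g} \<subseteq> carrier G" "y ` {1..g} \<subseteq> carrier G" "\<And>ps. ps \<in> set pss \<Longrightarrow> set ps \<subseteq> carrier G"
  shows "group (AM G g x y pss)"
proof -
  let ?A = "AutoGroup G" and ?w = "surface_word G g x y (concat pss)"
  let ?S = "\<lambda>ps. (\<lambda>s. conj_class G (inv s)) ` set ps"
  interpret A: group ?A by (rule AutoGroup)
  have w: "?w \<in> carrier G"     by (intro surface_word_closed assms(1,2)) (use assms(3) in \<open>simp add: UN_least\<close>)
  have S: "C \<subseteq> carrier G" if "ps \<in> set pss" "C \<in> ?S ps" for ps C
  proof -
    obtain s where "s \<in> set ps" "C = conj_class G (inv s)" using \<open>C \<in> ?S ps\<close> by blast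
    then show ?thesis using assms(3)[OF \<open>ps \<in> set pss\<close>] conj_class_closed[of "inv s"] by auto
  qed
  have car: "carrier ?A = auto G" by (simp add: AutoGroup_def)
  have mult: "\<phi> \<otimes>\<^bsub>?A\<^esub> \<psi> = compose (carrier G) \<phi> \<psi>" if "\<phi> \<in> auto G" "\<psi> \<in> auto G" for \<phi> \<psi>
    using that by (simp add: AutoGroup_def BijGroup_def auto_def)
  have one: "\<one>\<^bsub>?A\<^esub> = (\<lambda>x\<in>carrier G. x)" by (simp add: AutoGroup_def BijGroup_def)
  have comp_image: "compose (carrier G) \<phi> \<psi> ` C = \<phi> ` \<psi> ` C" if "C \<subseteq> carrier G" for \<phi> \<psi> :: "'a \<Rightarrow> 'a" and C
    using that by (auto simp: compose_def image_image intro!: image_cong)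
  have "subgroup (carrier (AM G g x y pss)) ?A"
  proof (rule A.subgroupI)
    show "carrier (AM G g x y pss) \<subseteq> carrier ?A" by (auto simp: AM_iff car)
    have "(\<lambda>x\<in>carrier G. x) \<in> carrier (AM G g x y pss)"
      unfolding AM_iff
    proof (intro conjI ballI)
      fix ps assume ps: "ps \<in> set pss"
      have "(\<lambda>x\<in>carrier G. x) ` C = C" if "C \<in> ?S ps" for C using S[OF ps that] by auto
      then show "(\<lambda>C. (\<lambda>x\<in>carrier G. x) ` C) ` ?S ps = ?S ps" by (simp cong: image_cong)
    qed (use w id_in_auto in auto)
    then show "carrier (AM G g x y pss) \<noteq> {}" by blast
  next
    fix \<phi> assume \<phi>: "\<phi> \<in> carrier (AM G g x y pss)"
    then have \<phi>a: "\<phi> \<in> auto G" by (simp add: AM_iff)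
    let ?\<psi> = "inv\<^bsub>?A\<^esub> \<phi>"
    have \<psi>a: "?\<psi> \<in> auto G" using \<phi>a A.inv_closed car by blast
    have "compose (carrier G) ?\<psi> \<phi> = (\<lambda>x\<in>carrier G. x)"
      using A.l_inv[of \<phi>] \<phi>a \<psi>a car mult one by simp
    then have *: "?\<psi> (\<phi> a) = a" if "a \<in> carrier G" for a
      using that by (metis compose_eq restrict_apply')
    show "?\<psi> \<in> carrier (AM G g x y pss)"
      unfolding AM_iff
    proof (intro conjI ballI)
      show "?\<psi> ?w = ?w" using *[OF w] \<phi> by (simp add: AM_iff)
      fix ps assume ps: "ps \<in> set pss"
      have "?\<psi> ` \<phi> ` C = C" if "C \<in> ?S ps" for C
      proof -
        have "?\<psi> ` \<phi> ` C = (\<lambda>a. a) ` C"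
          unfolding image_image using S[OF ps that] * by (intro image_cong refl) blast
        then show ?thesis by simp
      qed
      then have "(\<lambda>C. ?\<psi> ` C) ` (\<lambda>C. \<phi> ` C) ` ?S ps = ?S ps"
        by (simp add: image_image cong: image_cong)
      moreover have "(\<lambda>C. \<phi> ` C) ` ?S ps = ?S ps" using \<phi> ps by (simp add: AM_iff)
      ultimately show "(\<lambda>C. ?\<psi> ` C) ` ?S ps = ?S ps" by (simp only:)
    qed (fact \<psi>a)
  next
    fix \<phi> \<psi> assume \<phi>: "\<phi> \<in> carrier (AM G g x y pss)" and \<psi>: "\<psi> \<in> carrier (AM G g x y pss)"
    then have a: "\<phi> \<in> auto G" "\<psi> \<in> auto G" by (simp_all add: AM_iff)
    show "\<phi> \<otimes>\<^bsub>?A\<^esub> \<psi> \<in> carrier (AM G g x y pss)"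
      unfolding AM_iff
    proof (intro conjI ballI)
      show "\<phi> \<otimes>\<^bsub>?A\<^esub> \<psi> \<in> auto G" using A.m_closed a car by blast
      show "(\<phi> \<otimes>\<^bsub>?A\<^esub> \<psi>) ?w = ?w" using \<phi> \<psi> w by (simp add: mult[OF a] compose_eq AM_iff)
      fix ps assume ps: "ps \<in> set pss"
      have "(\<lambda>C. compose (carrier G) \<phi> \<psi> ` C) ` ?S ps = (\<lambda>C. \<phi> ` C) ` (\<lambda>C. \<psi> ` C) ` ?S ps"
        unfolding image_image[of _ _ "?S ps"] using S[OF ps] by (intro image_cong refl comp_image)
      also have "\<dots> = ?S ps" using \<phi> \<psi> ps by (simp only: AM_iff)
      finally show "(\<lambda>C. (\<phi> \<otimes>\<^bsub>?A\<^esub> \<psi>) ` C) ` ?S ps = ?S ps" by (simp only: mult[OF a])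
    qed
  qed
  then have "group (?A\<lparr>carrier := carrier (AM G g x y pss)\<rparr>)" by (rule A.subgroup_imp_group)
  moreover have "?A\<lparr>carrier := carrier (AM G g x y pss)\<rparr> = AM G g x y pss" by (simp add: AM_def)
  ultimately show ?thesis by simp
qed

section \<open>Eliminating punctures\<close>

locale puncture_elimination = group K for K (structure) +
  fixes x y :: "nat \<Rightarrow> 'a" and g :: nat and zs ts :: "'a list" and N
  assumes xy: "x ` {1..g} \<subseteq> carrier K" "y ` {1..g} \<subseteq> carrier K"
    and zs: "set zs \<subseteq> carrier K" and ts: "set ts \<subseteq> carrier K"
    and N_def: "N = normal_closure K (set ts)"
begin

abbreviation (input) gens :: "'a set" where
  "gens \<equiv> \<Union>a\<in>set ts. conj_class K a"

lemma gens_closed: "gens \<subseteq> carrier K"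
  using ts conj_class_closed by blast

sublocale normal N K
  unfolding N_def normal_closure_def
proof (rule normal_generateI[OF gens_closed])
  fix a h assume "a \<in> gens" and h: "h \<in> carrier K"
  then obtain s where s: "s \<in> set ts" "a \<in> conj_class K s" by blast
  then obtain b where b: "b \<in> carrier K" "a = conj_by K s b" by (auto simp: conj_class_def)
  have sc: "s \<in> carrier K" using s ts by blast
  have "h \<otimes> a \<otimes> inv h = conj_by K s (b \<otimes> inv h)"
    using b h sc by (simp add: conj_by_def inv_mult_group m_assoc)
  then have "h \<otimes> a \<otimes> inv h \<in> conj_class K s" using b h by (simp add: conj_class_def)
  then show "h \<otimes> a \<otimes> inv h \<in> gens" using s by blast
qed

abbreviation (input) M where "M \<equiv> K Mod N"

lemma proj: "group_hom K M (\<lambda>a. N #> a)"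
  using r_coset_hom_Mod factorgroup_is_group
  by (simp add: group_hom_def group_hom_axioms_def is_group)

lemma proj_surj: "(\<lambda>a. N #> a) ` carrier K = carrier M"
  by (simp add: carrier_FactGroup)

lemma quotient_elem: "X \<in> carrier M \<Longrightarrow> \<exists>a\<in>carrier K. X = N #> a"
  by (auto simp: carrier_FactGroup)

lemma proj_eq_iff:
  assumes "a \<in> carrier K" "b \<in> carrier K"
  shows "N #> a = N #> b \<longleftrightarrow> (\<exists>n\<in>N. a = n \<otimes> b)"
proof
  assume "N #> a = N #> b"
  then have "a \<in> N #> b" using rcos_self[OF assms(1) is_subgroup] by simp
  then show "\<exists>n\<in>N. a = n \<otimes> b" by (auto simp: r_coset_def)
next
  assume "\<exists>n\<in>N. a = n \<otimes> b"
  then have "a \<in> N #> b" by (auto simp: r_coset_def)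
  then show "N #> a = N #> b" using repr_independence[OF _ assms(2) is_subgroup] by simp
qed

lemma proj_in_N: "n \<in> N \<Longrightarrow> N #> n = N"
  using coset_join2[OF _ is_subgroup] subset by blast

abbreviation (input) A where "A \<equiv> AM K g x y [zs, ts]"

text \<open>The classes permuted are those of the inverses; inverting elementwise shows that the
  generating set of \<open>N\<close> is mapped onto itself.\<close>

lemma AM_image_N:
  assumes "\<sigma> \<in> carrier A"
  shows "\<sigma> ` N = N"
proof -
  have \<sigma>: "\<sigma> \<in> auto K" and S: "(\<lambda>C. \<sigma> ` C) ` (\<lambda>s. conj_class K (inv s)) ` set ts = (\<lambda>s. conj_class K (inv s)) ` set ts"
    using assms by (simp_all add: AM_iff)
  interpret \<sigma>: group_hom K K \<sigma> by (rule autoD(1)[OF is_group \<sigma>])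
  define V where "V = (\<Union>s\<in>set ts. conj_class K (inv s))"
  have "\<sigma> ` V = \<Union> ((\<lambda>C. \<sigma> ` C) ` (\<lambda>s. conj_class K (inv s)) ` set ts)" by (auto simp: V_def)
  also have "\<dots> = V" unfolding S V_def by simp
  finally have V: "\<sigma> ` V = V" .
  have Vc: "V \<subseteq> carrier K" using ts conj_class_closed by (auto simp: V_def dest!: subsetD)
  have "(\<lambda>a. inv a) ` V = (\<Union>s\<in>set ts. (\<lambda>a. inv a) ` conj_class K (inv s))" by (auto simp: V_def)
  also have "\<dots> = gens" using ts by (intro SUP_cong refl) (auto simp: image_inv_conj_class subset_iff)
  finally have U: "gens = (\<lambda>a. inv a) ` V" by simp
  have "\<sigma> ` gens = (\<lambda>a. inv a) ` \<sigma> ` V"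
    unfolding U image_image using Vc by (intro image_cong) auto
  then have "\<sigma> ` gens = gens" using V U by simp
  then show ?thesis
    using \<sigma>.generate_img[OF gens_closed] unfolding N_def normal_closure_def by simp
qed

lemma induced_proj:
  assumes "\<sigma> \<in> carrier A" "a \<in> carrier K"
  shows "induced_on_quotient K N \<sigma> (N #> a) = N #> \<sigma> a"
proof -
  have \<sigma>: "\<sigma> \<in> auto K" using assms(1) by (simp add: AM_iff)
  interpret \<sigma>: group_hom K K \<sigma> by (rule autoD(1)[OF is_group \<sigma>])
  have "\<sigma> ` (N #> a) = (\<lambda>n. \<sigma> n \<otimes> \<sigma> a) ` N"
    using assms(2) subset by (auto simp: r_coset_def image_iff)
  also have "\<dots> = (\<sigma> ` N) #> \<sigma> a" by (auto simp: r_coset_def)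
  finally have "\<sigma> ` (N #> a) = N #> \<sigma> a" by (simp add: AM_image_N[OF assms(1)])
  then show ?thesis using assms(2) proj_surj by (auto simp: induced_on_quotient_def)
qed

lemma induced_in_AM:
  assumes "\<sigma> \<in> carrier A"
  shows "induced_on_quotient K N \<sigma> \<in>
    carrier (AM M g (\<lambda>i. N #> x i) (\<lambda>i. N #> y i) [map (\<lambda>z. N #> z) zs])"
  unfolding AM_iff
proof (intro conjI ballI)
  let ?I = "induced_on_quotient K N \<sigma>"
  have \<sigma>: "\<sigma> \<in> auto K" using assms(1) by (simp add: AM_iff)
  interpret \<sigma>: group_hom K K \<sigma> by (rule autoD(1)[OF is_group \<sigma>])
  interpret p: group_hom K M "\<lambda>a. N #> a" by (rule proj)
  note I = induced_proj[OF assms]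
  have bij: "inj_on \<sigma> (carrier K)" "\<sigma> ` carrier K = carrier K"
    using autoD(2)[OF is_group \<sigma>] by (auto simp: bij_betw_def)
  have "?I \<in> hom M M"
  proof (rule homI)
    fix X assume "X \<in> carrier M"
    then obtain a where "a \<in> carrier K" "X = N #> a" using quotient_elem by blast
    then show "?I X \<in> carrier M" using I p.hom_closed by simp
  next
    fix X Y assume "X \<in> carrier M" "Y \<in> carrier M"
    then obtain a b where ab: "a \<in> carrier K" "X = N #> a" "b \<in> carrier K" "Y = N #> b"
      using quotient_elem by metis
    have "?I (X \<otimes>\<^bsub>M\<^esub> Y) = ?I (N #> (a \<otimes> b))"
      using ab(2,4) p.hom_mult[OF ab(1,3)] by (simp only:)
    also have "\<dots> = N #> (\<sigma> a \<otimes> \<sigma> b)"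
      using ab(1,3) I[of "a \<otimes> b"] by (simp del: p.hom_mult)
    also have "\<dots> = ?I X \<otimes>\<^bsub>M\<^esub> ?I Y"
      using ab(2,4) I[OF ab(1)] I[OF ab(3)] p.hom_mult[OF \<sigma>.hom_closed[OF ab(1)] \<sigma>.hom_closed[OF ab(3)]]
      by (simp only:)
    finally show "?I (X \<otimes>\<^bsub>M\<^esub> Y) = ?I X \<otimes>\<^bsub>M\<^esub> ?I Y" .
  qed
  moreover have "bij_betw ?I (carrier M) (carrier M)"
    unfolding bij_betw_def
  proof
    show "inj_on ?I (carrier M)"
    proof (rule inj_onI)
      fix X Y assume "X \<in> carrier M" "Y \<in> carrier M" and eq: "?I X = ?I Y"
      then obtain a b where ab: "a \<in> carrier K" "X = N #> a" "b \<in> carrier K" "Y = N #> b"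
        using quotient_elem by metis
      then have "N #> \<sigma> a = N #> \<sigma> b" using eq I by simp
      then obtain n where "n \<in> N" "\<sigma> a = n \<otimes> \<sigma> b" using proj_eq_iff ab by auto
      \<comment> \<open>Injectivity of the induced map rests on \<open>\<sigma>\<close> mapping
        \<open>N\<close> onto itself, not merely into itself.\<close>
      moreover then obtain n' where n': "n' \<in> N" "n = \<sigma> n'" using AM_image_N[OF assms] by blast
      moreover have nc: "n' \<in> carrier K" using n'(1) mem_carrier by blast
      ultimately have "\<sigma> a = \<sigma> (n' \<otimes> b)" using ab(3) by simp
      then have "a = n' \<otimes> b" by (rule inj_onD[OF bij(1)]) (use ab nc in simp_all)
      then show "X = Y" using proj_eq_iff[OF ab(1,3)] ab(2,4) n'(1) by blast
    qed
    show "?I ` carrier M = carrier M"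
    proof -
      have "?I ` carrier M = (\<lambda>a. N #> \<sigma> a) ` carrier K"
        unfolding proj_surj[symmetric] image_image using I by (intro image_cong) auto
      also have "\<dots> = (\<lambda>a. N #> a) ` \<sigma> ` carrier K" by (simp add: image_image)
      finally show ?thesis using bij(2) proj_surj by simp
    qed
  qed
  ultimately show "?I \<in> auto M" by (simp add: auto_def Bij_def induced_on_quotient_def)
  have w: "surface_word M g (\<lambda>i. N #> x i) (\<lambda>i. N #> y i) (concat [map (\<lambda>z. N #> z) zs]) = N #> surface_word K g x y zs"
    using p.hom_surface_word[OF xy zs] by simp
  \<comment> \<open>The product of the eliminated generators dies in the quotient, so there the long
    surface word becomes the one with \<open>zs\<close> alone.\<close>
  have tN: "foldr (\<otimes>) ss \<one> \<in> N" if "set ss \<subseteq> set ts" for ss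
    using that
  proof (induction ss)
    case (Cons s ss)
    then have "s \<in> carrier K" using ts by auto
    then have "s \<in> gens" using conj_class_self Cons.prems by auto
    then have "s \<in> N" unfolding N_def normal_closure_def by (rule generate.incl)
    then show ?case using Cons by simp
  qed simp
  have wc: "surface_word K g x y zs \<in> carrier K" by (rule surface_word_closed[OF xy zs])
  have "N #> surface_word K g x y (zs @ ts) = (N #> surface_word K g x y zs) \<otimes>\<^bsub>M\<^esub> (N #> foldr (\<otimes>) ts \<one>)"
    using surface_word_append[OF xy zs ts] wc foldr_mult_closed[OF ts] p.hom_mult by simp
  also have "\<dots> = (N #> surface_word K g x y zs) \<otimes>\<^bsub>M\<^esub> \<one>\<^bsub>M\<^esub>" using tN[of ts] proj_in_N by simp
  also have "\<dots> = N #> surface_word K g x y zs" using p.hom_closed[OF wc] by (rule p.H.r_one)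
  finally have ww: "N #> surface_word K g x y (zs @ ts) = N #> surface_word K g x y zs" .
  have "\<sigma> (surface_word K g x y (zs @ ts)) = surface_word K g x y (zs @ ts)"
    using assms by (simp add: AM_iff)
  moreover have "surface_word K g x y (zs @ ts) \<in> carrier K"
    using surface_word_closed[OF xy, of "zs @ ts"] zs ts by simp
  ultimately show "?I (surface_word M g (\<lambda>i. N #> x i) (\<lambda>i. N #> y i) (concat [map (\<lambda>z. N #> z) zs])) =
      surface_word M g (\<lambda>i. N #> x i) (\<lambda>i. N #> y i) (concat [map (\<lambda>z. N #> z) zs])"
    unfolding w ww[symmetric] using I by simp
  fix ps assume "ps \<in> set [map (\<lambda>z. N #> z) zs]"
  then have ps: "set ps = (\<lambda>z. N #> z) ` set zs" by simp
  let ?S = "(\<lambda>s. conj_class K (inv s)) ` set zs"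
  have S: "(\<lambda>C. \<sigma> ` C) ` ?S = ?S" using assms by (simp add: AM_iff)
  have Sc: "C \<subseteq> carrier K" if "C \<in> ?S" for C using that zs conj_class_closed by blast
  have "conj_class M (inv\<^bsub>M\<^esub> (N #> z)) = (\<lambda>a. N #> a) ` conj_class K (inv z)" if "z \<in> set zs" for z
  proof -
    have "z \<in> carrier K" using that zs by blast
    then show ?thesis using p.image_conj_class[OF proj_surj, of "inv z"] p.hom_inv by simp
  qed
  then have eq: "(\<lambda>s. conj_class M (inv\<^bsub>M\<^esub> s)) ` set ps = (\<lambda>C. (\<lambda>a. N #> a) ` C) ` ?S"
    unfolding ps by (simp add: image_image)
  have "?I ` (\<lambda>a. N #> a) ` C = (\<lambda>a. N #> a) ` \<sigma> ` C" if "C \<in> ?S" for C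
    unfolding image_image using Sc[OF that] I by (intro image_cong) auto
  then have "(\<lambda>C. ?I ` C) ` (\<lambda>C. (\<lambda>a. N #> a) ` C) ` ?S = (\<lambda>C. (\<lambda>a. N #> a) ` C) ` (\<lambda>C. \<sigma> ` C) ` ?S"
    unfolding image_image[of _ _ ?S] by (intro image_cong refl)
  then show "(\<lambda>C. ?I ` C) ` (\<lambda>s. conj_class M (inv\<^bsub>M\<^esub> s)) ` set ps = (\<lambda>s. conj_class M (inv\<^bsub>M\<^esub> s)) ` set ps"
    unfolding eq S .
qed

lemma induced_hom:
  "induced_on_quotient K N \<in>
     hom A (AM M g (\<lambda>i. N #> x i) (\<lambda>i. N #> y i) [map (\<lambda>z. N #> z) zs])"
proof (rule homI)
  fix \<sigma> \<tau> assume \<sigma>: "\<sigma> \<in> carrier A" and \<tau>: "\<tau> \<in> carrier A"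
  interpret A: group A by (rule AM_group) (use xy zs ts in auto)
  have \<tau>a: "\<tau> \<in> auto K" using \<tau> by (simp add: AM_iff)
  have \<tau>c: "\<tau> a \<in> carrier K" if "a \<in> carrier K" for a
    using autoD(4)[OF is_group \<tau>a] that by blast
  have st: "compose (carrier K) \<sigma> \<tau> \<in> carrier A"
    using A.m_closed[OF \<sigma> \<tau>] AM_mult[OF \<sigma> \<tau>] by simp
  have "induced_on_quotient K N (compose (carrier K) \<sigma> \<tau>) X =
      compose (carrier M) (induced_on_quotient K N \<sigma>) (induced_on_quotient K N \<tau>) X" for X
  proof (cases "X \<in> carrier M")
    case True
    then obtain a where a: "a \<in> carrier K" "X = N #> a" using quotient_elem[OF True] by blast
    then show ?thesis
      using True induced_proj[OF st a(1)] induced_proj[OF \<tau> a(1)] induced_proj[OF \<sigma> \<tau>c[OF a(1)]]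
      by (simp add: compose_eq)
  qed (simp add: induced_on_quotient_def compose_def)
  then show "induced_on_quotient K N (\<sigma> \<otimes>\<^bsub>A\<^esub> \<tau>) =
      induced_on_quotient K N \<sigma> \<otimes>\<^bsub>AM M g (\<lambda>i. N #> x i) (\<lambda>i. N #> y i) [map (\<lambda>z. N #> z) zs]\<^esub>
        induced_on_quotient K N \<tau>"
    unfolding AM_mult[OF \<sigma> \<tau>] AM_mult[OF induced_in_AM[OF \<sigma>] induced_in_AM[OF \<tau>]] by blast
qed (rule induced_in_AM)

end

section \<open>Restriction to an invariant normal subgroup\<close>

lemma surface_word_subgroup:
  assumes "group G" "subgroup H G" "x ` {1..g} \<subseteq> H" "y ` {1..g} \<subseteq> H"
  shows "surface_word (G\<lparr>carrier := H\<rparr>) g x y ss = surface_word G g x y ss"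
proof -
  have "comm (G\<lparr>carrier := H\<rparr>) (x i) (y i) = comm G (x i) (y i)" if "i \<in> {1..g}" for i
  proof -
    have "x i \<in> H" "y i \<in> H" using that assms(3,4) by blast+
    then show ?thesis using assms(1,2) by (simp add: comm_def group.m_inv_consistent)
  qed
  then have eq: "map (\<lambda>i. comm (G\<lparr>carrier := H\<rparr>) (x i) (y i)) [1..<g+1] = map (\<lambda>i. comm G (x i) (y i)) [1..<g+1]"
    by (intro map_cong refl) auto
  show ?thesis unfolding surface_word_def eq by simp
qed

lemma restrict_to_hom_auto:
  assumes "group G" "subgroup H G" "\<phi> \<in> auto G" "\<phi> ` H = H"
  shows "restrict_to H \<phi> \<in> auto (G\<lparr>carrier := H\<rparr>)"
proof -
  interpret group_hom G G \<phi> using autoD[OF assms(1,3)] by simp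
  have sub: "H \<subseteq> carrier G" using assms(2) by (rule subgroup.subset)
  have "inj_on \<phi> H" using autoD(2)[OF assms(1,3)] sub by (auto simp: bij_betw_def inj_on_subset)
  then have "bij_betw (restrict \<phi> H) H H" using assms(4) by (simp add: bij_betw_def inj_on_def)
  moreover have "restrict \<phi> H \<in> hom (G\<lparr>carrier := H\<rparr>) (G\<lparr>carrier := H\<rparr>)"
  proof -
    have "\<phi> (a \<otimes>\<^bsub>G\<^esub> b) = \<phi> a \<otimes>\<^bsub>G\<^esub> \<phi> b" if "a \<in> H" "b \<in> H" for a b
      using that sub hom_mult by blast
    then show ?thesis using assms(4) subgroup.m_closed[OF assms(2)] by (auto simp: hom_def)
  qed
  ultimately show ?thesis by (simp add: restrict_to_def auto_def Bij_def)
qed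

text \<open>The \<open>H\<close>-classes of the peripheral elements are best described by the \<open>\<phi>\<close>-invariant set \<open>R\<close> of
  all conjugates under the whole group that lie over the punctures in question.\<close>

lemma restrict_to_classes:
  assumes "group G" "subgroup H G" "\<phi> \<in> auto G" "\<phi> ` H = H" "R \<subseteq> H" "\<phi> ` R = R"
    and "S = (\<lambda>r. conj_class (G\<lparr>carrier := H\<rparr>) r) ` R"
  shows "(\<lambda>C. restrict_to H \<phi> ` C) ` S = S"
proof -
  let ?K = "G\<lparr>carrier := H\<rparr>"
  have K: "group ?K" using group.subgroup_imp_group[OF assms(1,2)] .
  have a: "restrict_to H \<phi> \<in> auto ?K" by (rule restrict_to_hom_auto[OF assms(1-4)])
  interpret r: group_hom ?K ?K "restrict_to H \<phi>" by (rule autoD(1)[OF K a])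
  have "restrict_to H \<phi> ` conj_class ?K r = conj_class ?K (\<phi> r)" if "r \<in> R" for r
    using r.image_conj_class[of r] autoD(4)[OF K a] that assms(5) by (auto simp: restrict_to_def)
  then have "(\<lambda>C. restrict_to H \<phi> ` C) ` S = conj_class ?K ` \<phi> ` R"
    unfolding assms(7) image_image by (intro image_cong refl)
  then show ?thesis using assms(6,7) by simp
qed

context normal
begin

lemma conj_class_subgroup_eq:
  assumes "a \<in> H" "h \<in> H"
  shows "conj_class (G\<lparr>carrier := H\<rparr>) (inv h \<otimes> a \<otimes> h) = conj_class (G\<lparr>carrier := H\<rparr>) a"
proof -
  have K: "group (G\<lparr>carrier := H\<rparr>)" using subgroup_imp_group[OF is_subgroup] .
  have "conj_by (G\<lparr>carrier := H\<rparr>) a h = inv h \<otimes> a \<otimes> h"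
    using assms is_subgroup by (simp add: conj_by_def m_inv_consistent)
  then show ?thesis using group.conj_class_conj_by[OF K, of a h] assms by simp
qed

text \<open>Modulo \<open>H\<close> the element \<open>f\<close> is a power of \<open>a\<close>
  times \<open>v\<close>. The power commutes with \<open>b\<close>, and the remaining factor from
  \<open>H\<close> only conjugates inside \<open>H\<close>. So the \<open>H\<close>-class depends on
  the coset alone, and coset representatives list peripheral classes.\<close>

lemma conj_class_double_coset:
  assumes a: "a \<in> carrier G" and v: "v \<in> carrier G" and f: "f \<in> carrier G"
    and coset: "H #> f \<in> generate (G Mod H) {H #> a} #>\<^bsub>G Mod H\<^esub> (H #> v)"
    and n: "a [^] n \<in> H" "b = a [^] (n :: nat) \<or> b = inv (a [^] n)"
  shows "conj_class (G\<lparr>carrier := H\<rparr>) (inv f \<otimes> b \<otimes> f) = conj_class (G\<lparr>carrier := H\<rparr>) (inv v \<otimes> b \<otimes> v)"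
proof -
  interpret p: group_hom G "G Mod H" "\<lambda>a. H #> a"
    using r_coset_hom_Mod factorgroup_is_group by (simp add: group_hom_def group_hom_axioms_def is_group)
  obtain X where X: "X \<in> generate (G Mod H) {H #> a}" "H #> f = X \<otimes>\<^bsub>G Mod H\<^esub> (H #> v)"
    using coset by (auto simp: r_coset_def)
  obtain i :: int where "X = (H #> a) [^]\<^bsub>G Mod H\<^esub> i"
    using X(1) p.H.generate_pow[of "H #> a"] p.hom_closed[OF a] by auto
  then have "H #> f = H #> (a [^] i \<otimes> v)"
    using X(2) p.hom_int_pow[OF a, of i] p.hom_mult[of "a [^] i" v] a v by simp
  then have "f \<in> H #> (a [^] i \<otimes> v)" using rcos_self[OF f is_subgroup] by simp
  then obtain h0 where h0: "h0 \<in> H" "f = h0 \<otimes> (a [^] i \<otimes> v)" by (auto simp: r_coset_def)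
  let ?c = "a [^] i \<otimes> v"
  \<comment> \<open>Normality moves the factor from \<open>H\<close> to the right, where it
    conjugates within \<open>H\<close>.\<close>
  define h where "h = inv ?c \<otimes> h0 \<otimes> ?c"
  have c: "?c \<in> carrier G" "a [^] i \<in> carrier G" "h0 \<in> carrier G" using a v h0 mem_carrier by auto
  have h: "h \<in> H" "h \<in> carrier G" unfolding h_def using inv_op_closed1[OF c(1) h0(1)] mem_carrier by auto
  have fh: "f = ?c \<otimes> h" unfolding h_def h0(2) using c by (simp add: m_assoc flip: inv_mult_group)
  have b: "b \<in> H" "b \<in> carrier G" using n mem_carrier by auto
  have "a [^] n \<otimes> a [^] i = a [^] i \<otimes> a [^] n"
    using a by (simp add: int_pow_int[symmetric] int_pow_mult[symmetric] add.commute del: int_pow_int)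
  moreover have "inv (a [^] n) \<otimes> a [^] i = a [^] i \<otimes> inv (a [^] n)"
    using a by (simp add: int_pow_int[symmetric] int_pow_neg[symmetric] int_pow_mult[symmetric] add.commute del: int_pow_int)
  ultimately have comm: "b \<otimes> a [^] i = a [^] i \<otimes> b" using n(2) by blast
  have "inv ?c \<otimes> b \<otimes> ?c = inv v \<otimes> (inv (a [^] i) \<otimes> (b \<otimes> a [^] i)) \<otimes> v"
    using c a v b by (simp add: inv_mult_group m_assoc)
  also have "\<dots> = inv v \<otimes> b \<otimes> v" unfolding comm using c v b by (simp add: m_assoc)
  finally have *: "inv ?c \<otimes> b \<otimes> ?c = inv v \<otimes> b \<otimes> v" .
  have "inv f \<otimes> b \<otimes> f = inv h \<otimes> (inv ?c \<otimes> b \<otimes> ?c) \<otimes> h"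
    using c h b v unfolding fh by (simp add: inv_mult_group m_assoc)
  then have "inv f \<otimes> b \<otimes> f = inv h \<otimes> (inv v \<otimes> b \<otimes> v) \<otimes> h"
    unfolding * .
  then show ?thesis using conj_class_subgroup_eq[OF inv_op_closed1[OF v b(1)] h(1)] by simp
qed

end

section \<open>The ribbon graph of the surface\<close>

text \<open>The components are \<open>E\<close>, \<open>Z\<close> and \<open>T\<close> of a
  \<open>ribbon_pair\<close>. The order of the four edge ends is forced by the turns of the
  commutator.\<close>

definition handle_block ::
    "'a \<Rightarrow> 'a \<Rightarrow> ('a \<times> bool) list \<times> ('a \<times> bool) list \<times> ('a \<times> bool) set" where
  "handle_block a b =
     ([(a, False), (b, True), (a, True), (b, False)], [(a, False), (b, False), (a, True), (b, True)], {})"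

definition puncture_block ::
    "'a \<Rightarrow> ('a \<times> bool) list \<times> ('a \<times> bool) list \<times> ('a \<times> bool) set" where
  "puncture_block s = ([(s, True), (s, False)], [(s, True)], {(s, True)})"

lemma ribbon_handle_block:
  "ribbon_pair (fst (handle_block a b)) (fst (snd (handle_block a b))) (snd (snd (handle_block a b)))"
  by (simp add: ribbon_pair_def handle_block_def adj_Cons)

lemma ribbon_puncture_block:
  "ribbon_pair (fst (puncture_block s)) (fst (snd (puncture_block s))) (snd (snd (puncture_block s)))"
  by (simp add: ribbon_pair_def puncture_block_def adj_Cons)

context group
begin

lemma word_val_concat:
  assumes "\<And>i. i \<in> set ks \<Longrightarrow> set (f i) \<subseteq> carrier G \<times> UNIV"
  shows "word_val G (concat (map f ks)) = foldr (\<otimes>) (map (\<lambda>i. word_val G (f i)) ks) \<one>"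
  using assms
proof (induction ks)
  case (Cons i ks)
  have "set (concat (map f ks)) \<subseteq> carrier G \<times> UNIV" using Cons.prems by (simp add: UN_least)
  then show ?case using Cons by (simp add: word_val_append)
qed simp

end

context free_group
begin

text \<open>The homomorphism to the integers that is 1 on every basis element. It is constant on
  conjugacy classes, so it tells conjugates of a generator from its inverse.\<close>

definition exponent_sum :: "'a \<Rightarrow> int" where
  "exponent_sum f = (\<Sum>l\<leftarrow>word_of f. if snd l then 1 else -1)"

lemma exponent_sum_mult:
  assumes "f \<in> carrier G" "h \<in> carrier G"
  shows "exponent_sum (f \<otimes> h) = exponent_sum f + exponent_sum h"
proof -
  let ?e = "\<lambda>w. \<Sum>l\<leftarrow>w. if snd l then 1 else (-1 :: int)"
  have cons: "?e (cons_red l w) = (if snd l then 1 else -1) + ?e w" for l :: "'a \<times> bool" and w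
    by (cases w) (auto simp: cons_red_def flip_def)
  have "?e (word_of (word_val G u \<otimes> h)) = ?e u + ?e (word_of h)" if "set u \<subseteq> B \<times> UNIV" for u
    using that
  proof (induction u)
    case (Cons l u)
    have l: "fst l \<in> B" "set u \<subseteq> B \<times> UNIV" using Cons.prems by (auto simp: mem_Times_iff)
    have "word_of (word_val G (l # u) \<otimes> h) = cons_red l (word_of (word_val G u \<otimes> h))"
      using word_of_lval_mult[of l "word_val G u \<otimes> h"] l assms(2) by (simp add: m_assoc)
    then show ?case using Cons.IH[OF l(2)] by (simp only: cons) simp
  qed (use assms in simp)
  from this[of "word_of f"] show ?thesis
    using word_of[OF assms(1)] by (simp add: exponent_sum_def)
qed

lemma exponent_sum_conj:
  assumes "s \<in> carrier G" "h \<in> carrier G"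
  shows "exponent_sum (conj_by G s h) = exponent_sum s"
proof -
  have "exponent_sum (inv h) + exponent_sum h = 0"
    using exponent_sum_mult[of "inv h" h] assms by (simp add: exponent_sum_def)
  then show ?thesis using assms by (simp add: conj_by_def exponent_sum_mult)
qed

lemma auto_fixing_basis:
  assumes "\<phi> \<in> auto G" "\<And>s. s \<in> B \<Longrightarrow> \<phi> s = s" "f \<in> carrier G"
  shows "\<phi> f = f"
proof -
  interpret h: group_hom G G \<phi> by (rule autoD(1)[OF is_group assms(1)])
  have "f \<in> generate G B" using assms(3) free by (simp add: free_basis_def)
  then show ?thesis
  proof induction
    case (eng h1 h2)
    then show ?case using generate_in_carrier[OF basis_closed] by simp
  qed (use assms(2) basis_closed in auto)
qed

end

section \<open>The covering and the automorphisms of the base\<close>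

locale cover = group F for F :: "('a, 'm) monoid_scheme" (structure) +
  fixes g p g' b q m c d :: nat
    and x y t xh yh zh th w :: "nat \<Rightarrow> 'a"
    and u :: "nat \<Rightarrow> nat \<Rightarrow> 'a"
    and Z :: 'a
    and H :: "'a set"
  assumes F_distinct: "distinct (map x [1..<g+1] @ map y [1..<g+1] @ map t [1..<p+1])"
    and F_free: "free_basis F (x ` {1..g} \<union> y ` {1..g} \<union> t ` {1..p})"
    and Z_def: "Z = surface_word F g x y (map t [1..<p+1])"
    and H_normal: "H \<lhd> F"
    and finite_index: "finite (carrier (F Mod H))"
    and c_def: "c = group.ord (F Mod H) (H #> Z)"
    and branching: "\<And>k. k \<in> {1..p} \<Longrightarrow> t k \<notin> H"
    and d_eq: "\<And>k. k \<in> {1..p} \<Longrightarrow> d = group.ord (F Mod H) (H #> t k)"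
    and basis_in_H: "xh ` {1..g'} \<union> yh ` {1..g'} \<union> zh ` {1..<b} \<union> th ` {1..q} \<subseteq> H"
    and basis1: "surface_word F g' xh yh (map zh [1..<b] @ map th [1..<q+1]) = Z [^] c"
    and basis2: "\<And>l. l \<in> {1..<b} \<Longrightarrow> w l \<in> carrier F - H \<and> zh l = conj_by F (inv (Z [^] c)) (w l)"
      "disjoint_union (carrier (F Mod H)) {1..b}
          (\<lambda>l. if l < b then generate (F Mod H) {H #> Z} #>\<^bsub>F Mod H\<^esub> (H #> w l)
               else generate (F Mod H) {H #> Z})"
    and basis3: "disjoint_union (th ` {1..q}) {1..p}
          (\<lambda>k. (\<lambda>i. conj_by F (t k [^] d) (u i k)) ` {1..m div d})"
      "\<And>i k. k \<in> {1..p} \<Longrightarrow> i \<in> {1..m div d} \<Longrightarrow> u i k \<in> carrier F"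
      "\<And>k. k \<in> {1..p} \<Longrightarrow> disjoint_union (carrier (F Mod H)) {1..m div d}
          (\<lambda>i. generate (F Mod H) {H #> t k} #>\<^bsub>F Mod H\<^esub> (H #> u i k))"
    and invariant: "\<And>\<phi>. \<phi> \<in> carrier (AM F g x y [map t [1..<p+1]]) \<Longrightarrow> \<phi> ` H = H"
    and not_022: "(g, p, d) \<noteq> (0, 2, 2)"
begin

definition "C = t ` {1..p}"
definition "B = x ` {1..g} \<union> y ` {1..g} \<union> C"
abbreviation (input) "Q \<equiv> F Mod H"
abbreviation (input) "K \<equiv> F\<lparr>carrier := H\<rparr>"
abbreviation (input) "A \<equiv> AM F g x y [map t [1..<p+1]]"
abbreviation (input) "A' \<equiv> AM K g' xh yh [map zh [1..<b], map th [1..<q+1]]"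

declare upt_Suc [simp del] atLeastLessThanSuc_atLeastAtMost [simp]

sublocale free: free_group F B
  by unfold_locales (use F_free in \<open>simp add: B_def C_def\<close>)

sublocale H: normal H F
  by (rule H_normal)

lemma proj: "group_hom F Q (\<lambda>a. H #> a)"
  using H.r_coset_hom_Mod H.factorgroup_is_group
  by (simp add: group_hom_def group_hom_axioms_def is_group)

sublocale p: group_hom F Q "\<lambda>a. H #> a"
  by (rule proj)

lemma K_group: "group K"
  by (rule subgroup_imp_group[OF H.is_subgroup])

lemma gens_closed: "x ` {1..g} \<subseteq> carrier F" "y ` {1..g} \<subseteq> carrier F" "t ` {1..p} \<subseteq> carrier F"
  using free.basis_closed by (auto simp: B_def C_def)

lemma t_closed: "k \<in> {1..p} \<Longrightarrow> t k \<in> carrier F"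
  using gens_closed by blast

lemma Z_closed [simp]: "Z \<in> carrier F"
  unfolding Z_def using gens_closed by (intro surface_word_closed) auto

lemma mem_H_iff: "a \<in> carrier F \<Longrightarrow> a \<in> H \<longleftrightarrow> H #> a = \<one>\<^bsub>Q\<^esub>"
  using coset_join1[OF _ _ H.is_subgroup] coset_join2[OF _ H.is_subgroup] by auto

lemma pow_in_H: "a \<in> carrier F \<Longrightarrow> a [^] group.ord Q (H #> a) \<in> H"
  using p.H.pow_ord_eq_1[of "H #> a"] p.hom_nat_pow[of a] by (simp add: mem_H_iff del: one_FactGroup)

lemma Z_pow_in_H: "Z [^] c \<in> H"
  unfolding c_def by (rule pow_in_H) simp

lemma t_pow_in_H: "k \<in> {1..p} \<Longrightarrow> t k [^] d \<in> H"
  using pow_in_H[of "t k"] t_closed d_eq by simp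

lemma d_ge_2: "k \<in> {1..p} \<Longrightarrow> 2 \<le> d"
proof -
  assume k: "k \<in> {1..p}"
  have "H #> t k \<in> carrier Q" using p.hom_closed t_closed[OF k] by blast
  then have "d \<ge> 1" "d \<noteq> 1"
    using p.H.ord_ge_1[OF finite_index] p.H.ord_eq_1 d_eq[OF k] mem_H_iff[OF t_closed[OF k]] branching[OF k]
    by auto
  then show ?thesis by simp
qed

lemma A_group: "group A"
  by (rule AM_group) (use gens_closed in auto)

lemma A_auto: "\<phi> \<in> carrier A \<Longrightarrow> \<phi> \<in> auto F"
  by (simp add: AM_iff)

lemma A_fix_Z: "\<phi> \<in> carrier A \<Longrightarrow> \<phi> Z = Z"
  by (simp add: AM_iff Z_def)

lemma A_classes:
  assumes "\<phi> \<in> carrier A"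
  shows "(\<lambda>C. \<phi> ` C) ` (\<lambda>k. conj_class F (inv (t k))) ` {1..p} = (\<lambda>k. conj_class F (inv (t k))) ` {1..p}"
proof -
  have "set (map t [1..<p+1]) = t ` {1..p}" by auto
  then show ?thesis using assms unfolding AM_iff by (auto simp: image_image)
qed

text \<open>The classes in the definition are those of inverses; since inversion commutes with
  conjugation, the generators themselves go to conjugates of generators, with sign
  preserved.\<close>

lemma A_conj:
  assumes "\<phi> \<in> carrier A" "k \<in> {1..p}"
  shows "\<exists>k'\<in>{1..p}. \<exists>h\<in>carrier F. \<phi> (t k) = conj_by F (t k') h"
proof -
  interpret h: group_hom F F \<phi> by (rule autoD(1)[OF is_group A_auto[OF assms(1)]])
  have "\<phi> ` conj_class F (inv (t k)) \<in> (\<lambda>C. \<phi> ` C) ` (\<lambda>k. conj_class F (inv (t k))) ` {1..p}"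
    using assms(2) by (intro imageI)
  then have "\<phi> ` conj_class F (inv (t k)) \<in> (\<lambda>k. conj_class F (inv (t k))) ` {1..p}"
    unfolding A_classes[OF assms(1)] .
  then obtain k' where k': "k' \<in> {1..p}" "\<phi> ` conj_class F (inv (t k)) = conj_class F (inv (t k'))" by blast
  have "\<phi> (inv (t k)) \<in> conj_class F (inv (t k'))"
    using k'(2) imageI[OF conj_class_self[of "inv (t k)"], of \<phi>] t_closed[OF assms(2)] by simp
  then obtain h where h: "h \<in> carrier F" "\<phi> (inv (t k)) = conj_by F (inv (t k')) h"
    by (auto simp: conj_class_def)
  then have "inv (\<phi> (t k)) = inv (conj_by F (t k') h)"
    using t_closed[OF assms(2)] t_closed[OF k'(1)] conj_by_inv[of "t k'" h] by simp
  then have "inv (inv (\<phi> (t k))) = inv (inv (conj_by F (t k') h))" by (simp only:)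
  then have "\<phi> (t k) = conj_by F (t k') h"
    using t_closed[OF assms(2)] t_closed[OF k'(1)] h(1) by simp
  then show ?thesis using k' h by blast
qed

subsection \<open>Restriction\<close>

text \<open>The preimage in F of the cyclic subgroup generated by the image of \<open>Z\<close>.
  Written as products with \<open>H\<close>, its invariance follows from \<open>\<phi>\<close>
  fixing \<open>Z\<close> and preserving \<open>H\<close>.\<close>

definition "Z_coset = {Z [^] (i :: int) \<otimes> h | i h. h \<in> H}"

lemma mem_Z_coset_iff:
  assumes "f \<in> carrier F"
  shows "f \<in> Z_coset \<longleftrightarrow> H #> f \<in> generate Q {H #> Z}"
proof -
  have gen: "generate Q {H #> Z} = {H #> Z [^] (i :: int) | i. True}"
    using p.H.generate_pow[of "H #> Z"] p.hom_closed[OF Z_closed] p.hom_int_pow[OF Z_closed] by simp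
  show ?thesis
  proof
    assume "f \<in> Z_coset"
    then obtain i :: int and h where f: "f = Z [^] i \<otimes> h" "h \<in> H" by (auto simp: Z_coset_def)
    then have "H #> f = (H #> (Z [^] i)) \<otimes>\<^bsub>Q\<^esub> (H #> h)" using H.mem_carrier p.hom_mult[of "Z [^] i" h] by simp
    moreover have "H #> h = \<one>\<^bsub>Q\<^esub>" using f H.mem_carrier mem_H_iff by blast
    ultimately have "H #> f = H #> Z [^] i" using p.H.r_one[OF p.hom_closed[of "Z [^] i"]] by simp
    then show "H #> f \<in> generate Q {H #> Z}" using gen by blast
  next
    assume "H #> f \<in> generate Q {H #> Z}"
    then obtain i :: int where "H #> f = H #> Z [^] i" using gen by blast
    then have "f \<in> H #> Z [^] i" using rcos_self[OF assms H.is_subgroup] by simp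
    then obtain h where h: "h \<in> H" "f = h \<otimes> Z [^] i" by (auto simp: r_coset_def)
    have "f = Z [^] i \<otimes> (inv (Z [^] i) \<otimes> h \<otimes> Z [^] i)"
      using h H.mem_carrier by (simp add: m_assoc)
    moreover have "inv (Z [^] i) \<otimes> h \<otimes> Z [^] i \<in> H" using h by (intro H.inv_op_closed1) simp_all
    ultimately show "f \<in> Z_coset" unfolding Z_coset_def by blast
  qed
qed

lemma Z_coset_closed: "Z_coset \<subseteq> carrier F"
  using H.mem_carrier by (auto simp: Z_coset_def)

lemma image_Z_coset:
  assumes "\<phi> \<in> carrier A"
  shows "\<phi> ` (carrier F - Z_coset) = carrier F - Z_coset"
proof -
  interpret h: group_hom F F \<phi> by (rule autoD(1)[OF is_group A_auto[OF assms]])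
  have inj: "inj_on \<phi> (carrier F)" and surj: "\<phi> ` carrier F = carrier F"
    using autoD[OF is_group A_auto[OF assms]] by (auto simp: bij_betw_def)
  have val: "\<phi> (Z [^] (i :: int) \<otimes> h) = Z [^] i \<otimes> \<phi> h" if "h \<in> H" for i h
    using that H.mem_carrier[OF that] A_fix_Z[OF assms] h.hom_int_pow[OF Z_closed] by simp
  have "\<phi> ` Z_coset = Z_coset"
  proof
    show "\<phi> ` Z_coset \<subseteq> Z_coset" using val invariant[OF assms] by (force simp: Z_coset_def)
    show "Z_coset \<subseteq> \<phi> ` Z_coset"
    proof
      fix f assume "f \<in> Z_coset"
      then obtain i :: int and h where f: "f = Z [^] i \<otimes> h" "h \<in> H" by (auto simp: Z_coset_def)
      obtain h' where "h' \<in> H" "h = \<phi> h'" using f(2) invariant[OF assms] by blast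
      then have "f = \<phi> (Z [^] i \<otimes> h')" "Z [^] i \<otimes> h' \<in> Z_coset" using f val by (auto simp: Z_coset_def)
      then show "f \<in> \<phi> ` Z_coset" by blast
    qed
  qed
  then show ?thesis using inj_on_image_set_diff[OF inj _ Z_coset_closed, of "carrier F"] surj by simp
qed

text \<open>The boundary components other than the one with the base point correspond to the
  nontrivial cosets of the subgroup generated by \<open>Z\<close>. Describing their classes by all
  of \<open>carrier F - Z_coset\<close> removes the chosen representatives \<open>w l\<close>, on
  which automorphisms have no direct action.\<close>

lemma classes_zh:
  "(\<lambda>s. conj_class K (inv\<^bsub>K\<^esub> s)) ` set (map zh [1..<b]) =
    conj_class K ` (\<lambda>f. inv f \<otimes> Z [^] c \<otimes> f) ` (carrier F - Z_coset)"
proof -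
  have zh: "inv\<^bsub>K\<^esub> (zh l) = inv (w l) \<otimes> Z [^] c \<otimes> w l" "w l \<in> carrier F" if "l \<in> {1..<b}" for l
  proof -
    show wl: "w l \<in> carrier F" using basis2(1)[OF that] by blast
    have 1: "inv\<^bsub>K\<^esub> (zh l) = inv (zh l)"
      using that basis_in_H by (intro m_inv_consistent H.is_subgroup) auto
    have 2: "inv (zh l) = conj_by F (Z [^] c) (w l)"
      using basis2(1)[OF that] wl conj_by_inv[of "Z [^] c" "w l"] by simp
    show "inv\<^bsub>K\<^esub> (zh l) = inv (w l) \<otimes> Z [^] c \<otimes> w l" unfolding 1 2 conj_by_def ..
  qed
  have disj: "disjoint_family_on (\<lambda>l. if l < b then generate Q {H #> Z} #>\<^bsub>Q\<^esub> (H #> w l) else generate Q {H #> Z}) {1..b}"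
    and cov: "(\<Union>l\<in>{1..b}. if l < b then generate Q {H #> Z} #>\<^bsub>Q\<^esub> (H #> w l) else generate Q {H #> Z}) = carrier Q"
    using basis2(2) unfolding disjoint_union_def by blast+
  show ?thesis
  proof (intro subset_antisym subsetI)
    fix C assume "C \<in> (\<lambda>s. conj_class K (inv\<^bsub>K\<^esub> s)) ` set (map zh [1..<b])"
    then obtain l where l: "l \<in> {1..<b}" "C = conj_class K (inv\<^bsub>K\<^esub> (zh l))" by auto
    \<comment> \<open>The index \<open>b\<close> stands for the trivial coset, from which the others
      are disjoint.\<close>
    have "w l \<notin> Z_coset"
    proof
      assume "w l \<in> Z_coset"
      then have "H #> w l \<in> generate Q {H #> Z}" using mem_Z_coset_iff zh(2)[OF l(1)] by blast
      moreover have "H #> w l \<in> generate Q {H #> Z} #>\<^bsub>Q\<^esub> (H #> w l)"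
      proof -
        have "\<one>\<^bsub>Q\<^esub> \<otimes>\<^bsub>Q\<^esub> (H #> w l) = H #> w l" by (rule p.H.l_one[OF p.hom_closed[OF zh(2)[OF l(1)]]])
        moreover have "\<one>\<^bsub>Q\<^esub> \<in> generate Q {H #> Z}" by (rule generate.one)
        ultimately show ?thesis unfolding r_coset_def[of Q] by force
      qed
      ultimately show False
        using disjoint_family_onD[OF disj, of l b] l(1) by auto
    qed
    then show "C \<in> conj_class K ` (\<lambda>f. inv f \<otimes> Z [^] c \<otimes> f) ` (carrier F - Z_coset)"
      using l zh[OF l(1)] by auto
  next
    fix C assume "C \<in> conj_class K ` (\<lambda>f. inv f \<otimes> Z [^] c \<otimes> f) ` (carrier F - Z_coset)"
    then obtain f where f: "f \<in> carrier F" "f \<notin> Z_coset" "C = conj_class K (inv f \<otimes> Z [^] c \<otimes> f)" by blast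
    have "H #> f \<in> carrier Q" using p.hom_closed f(1) by blast
    then obtain l where l: "l \<in> {1..b}"
      "H #> f \<in> (if l < b then generate Q {H #> Z} #>\<^bsub>Q\<^esub> (H #> w l) else generate Q {H #> Z})"
      using cov by blast
    then have lb: "l \<in> {1..<b}" using f(1,2) mem_Z_coset_iff by (auto split: if_splits)
    then have "H #> f \<in> generate Q {H #> Z} #>\<^bsub>Q\<^esub> (H #> w l)" using l(2) by simp
    then have "C = conj_class K (inv\<^bsub>K\<^esub> (zh l))"
      using H.conj_class_double_coset[OF Z_closed zh(2)[OF lb] f(1) _ Z_pow_in_H, of "Z [^] c"] f(3) zh(1)[OF lb] by simp
    then show "C \<in> (\<lambda>s. conj_class K (inv\<^bsub>K\<^esub> s)) ` set (map zh [1..<b])" using lb by auto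
  qed
qed

definition "puncture_classes = (\<Union>k\<in>{1..p}. conj_class F (inv (t k [^] d)))"

lemma image_puncture_classes:
  assumes "\<phi> \<in> carrier A"
  shows "\<phi> ` puncture_classes = puncture_classes"
proof -
  interpret h: group_hom F F \<phi> by (rule autoD(1)[OF is_group A_auto[OF assms]])
  let ?S = "(\<lambda>k. conj_class F (inv (t k))) ` {1..p}"
  let ?P = "\<lambda>C. (\<lambda>a. a [^] d) ` C"
  have "conj_class F (inv (t k [^] d)) = ?P (conj_class F (inv (t k)))" if "k \<in> {1..p}" for k
    using image_pow_conj_class[of "inv (t k)" d] t_closed[OF that] by (simp add: nat_pow_inv)
  then have eq: "puncture_classes = \<Union> (?P ` ?S)" unfolding puncture_classes_def by simp
  have cl: "C \<subseteq> carrier F" if "C \<in> ?S" for C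
  proof -
    obtain k where "k \<in> {1..p}" "C = conj_class F (inv (t k))" using \<open>C \<in> ?S\<close> by blast
    then show ?thesis using conj_class_closed[of "inv (t k)"] t_closed by simp
  qed
  have comm: "\<phi> ` ?P C = ?P (\<phi> ` C)" if "C \<in> ?S" for C
  proof -
    have "(\<lambda>a. \<phi> (a [^] d)) ` C = (\<lambda>a. \<phi> a [^] d) ` C"
      using cl[OF that] h.hom_nat_pow by (intro image_cong refl) blast
    then show ?thesis by (simp only: image_image)
  qed
  have "\<phi> ` puncture_classes = \<Union> ((\<lambda>C. \<phi> ` ?P C) ` ?S)" unfolding eq by blast
  also have "(\<lambda>C. \<phi> ` ?P C) ` ?S = (\<lambda>C. ?P (\<phi> ` C)) ` ?S" using comm by (rule image_cong[OF refl])
  also have "\<dots> = ?P ` (\<lambda>C. \<phi> ` C) ` ?S" by (simp add: image_image)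
  also have "\<dots> = ?P ` ?S" using A_classes[OF assms] by simp
  finally show ?thesis unfolding eq .
qed

lemma th_cases:
  assumes "a \<in> th ` {1..q}"
  obtains i k where "k \<in> {1..p}" "i \<in> {1..m div d}" "a = conj_by F (t k [^] d) (u i k)"
proof -
  have "a \<in> (\<Union>k\<in>{1..p}. (\<lambda>i. conj_by F (t k [^] d) (u i k)) ` {1..m div d})"
    using assms basis3(1) unfolding disjoint_union_def by blast
  then show ?thesis using that by blast
qed

text \<open>The \<open>u i k\<close> represent all cosets of the subgroup generated by
  \<open>t k\<close> in the quotient, so the classes in \<open>H\<close> exhaust all conjugates in
  F. As above, this removes the choice of representatives.\<close>

lemma classes_th:
  "(\<lambda>s. conj_class K (inv\<^bsub>K\<^esub> s)) ` set (map th [1..<q+1]) = conj_class K ` puncture_classes"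
proof -
  have set: "set (map th [1..<q+1]) = th ` {1..q}" by auto
  have inv_K: "inv\<^bsub>K\<^esub> a = inv a" if "a \<in> th ` {1..q}" for a
    using that basis_in_H by (intro m_inv_consistent H.is_subgroup) auto
  have inv_conj: "inv (conj_by F (t k [^] d) f) = conj_by F (inv (t k [^] d)) f"
    if "k \<in> {1..p}" "f \<in> carrier F" for k f
    using conj_by_inv[of "t k [^] d" f] t_closed[OF that(1)] that(2) by simp
  show ?thesis
    unfolding set
  proof (intro subset_antisym subsetI)
    fix C assume "C \<in> (\<lambda>s. conj_class K (inv\<^bsub>K\<^esub> s)) ` th ` {1..q}"
    then obtain a where a: "a \<in> th ` {1..q}" "C = conj_class K (inv\<^bsub>K\<^esub> a)" by blast
    then obtain i k where ik: "k \<in> {1..p}" "i \<in> {1..m div d}" "a = conj_by F (t k [^] d) (u i k)"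
      using th_cases by blast
    have "inv\<^bsub>K\<^esub> a = conj_by F (inv (t k [^] d)) (u i k)"
      using inv_K[OF a(1)] inv_conj[OF ik(1) basis3(2)[OF ik(1,2)]] ik(3) by simp
    then have "inv\<^bsub>K\<^esub> a \<in> puncture_classes"
      using ik basis3(2)[OF ik(1,2)] unfolding puncture_classes_def conj_class_def by blast
    then show "C \<in> conj_class K ` puncture_classes" using a(2) by blast
  next
    fix C assume "C \<in> conj_class K ` puncture_classes"
    then obtain k f where k: "k \<in> {1..p}" "f \<in> carrier F" "C = conj_class K (conj_by F (inv (t k [^] d)) f)"
      unfolding puncture_classes_def conj_class_def[of F] by blast
    have "H #> f \<in> carrier Q" using p.hom_closed k(2) by blast
    then obtain i where i: "i \<in> {1..m div d}" "H #> f \<in> generate Q {H #> t k} #>\<^bsub>Q\<^esub> (H #> u i k)"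
      using basis3(3)[OF k(1)] unfolding disjoint_union_def by blast
    let ?a = "conj_by F (t k [^] d) (u i k)"
    have a: "?a \<in> th ` {1..q}" using basis3(1) k(1) i(1) unfolding disjoint_union_def by blast
    have "C = conj_class K (conj_by F (inv (t k [^] d)) (u i k))"
      using H.conj_class_double_coset[OF t_closed[OF k(1)] basis3(2)[OF k(1) i(1)] k(2) i(2) t_pow_in_H[OF k(1)],
          of "inv (t k [^] d)"] k(3) by (simp add: conj_by_def)
    also have "\<dots> = conj_class K (inv\<^bsub>K\<^esub> ?a)"
      using inv_K[OF a] inv_conj[OF k(1) basis3(2)[OF k(1) i(1)]] by simp
    finally show "C \<in> (\<lambda>s. conj_class K (inv\<^bsub>K\<^esub> s)) ` th ` {1..q}" using a by blast
  qed
qed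

lemma hat_closed: "xh ` {1..g'} \<subseteq> H" "yh ` {1..g'} \<subseteq> H" "set (map zh [1..<b]) \<subseteq> H" "set (map th [1..<q+1]) \<subseteq> H"
  using basis_in_H by auto

lemma restrict_in_A':
  assumes \<phi>: "\<phi> \<in> carrier A"
  shows "restrict_to H \<phi> \<in> carrier A'"
  unfolding AM_iff
proof (intro conjI ballI)
  let ?r = "restrict_to H \<phi>"
  interpret h: group_hom F F \<phi> by (rule autoD(1)[OF is_group A_auto[OF \<phi>]])
  show "?r \<in> auto K"
    by (rule restrict_to_hom_auto[OF is_group H.is_subgroup A_auto[OF \<phi>] invariant[OF \<phi>]])
  have w: "surface_word K g' xh yh (concat [map zh [1..<b], map th [1..<q+1]]) = Z [^] c"
    using surface_word_subgroup[OF is_group H.is_subgroup hat_closed(1,2)] basis1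
    by simp
  have "\<phi> (Z [^] c) = Z [^] c" using h.hom_nat_pow[OF Z_closed] A_fix_Z[OF \<phi>] by simp
  then show "?r (surface_word K g' xh yh (concat [map zh [1..<b], map th [1..<q+1]])) =
      surface_word K g' xh yh (concat [map zh [1..<b], map th [1..<q+1]])"
    unfolding w using Z_pow_in_H by (simp add: restrict_to_def)
  fix ps assume "ps \<in> set [map zh [1..<b], map th [1..<q+1]]"
  then consider "ps = map zh [1..<b]" | "ps = map th [1..<q+1]" by (auto)
  then show "(\<lambda>C. ?r ` C) ` (\<lambda>s. conj_class K (inv\<^bsub>K\<^esub> s)) ` set ps = (\<lambda>s. conj_class K (inv\<^bsub>K\<^esub> s)) ` set ps"
  proof cases
    case 1
    let ?R = "(\<lambda>f. inv f \<otimes> Z [^] c \<otimes> f) ` (carrier F - Z_coset)"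
    have "?R \<subseteq> H" using H.inv_op_closed1 Z_pow_in_H by blast
    moreover have "\<phi> ` ?R = ?R"
    proof -
      have "\<phi> ` ?R = (\<lambda>f. inv (\<phi> f) \<otimes> Z [^] c \<otimes> \<phi> f) ` (carrier F - Z_coset)"
        unfolding image_image using \<open>\<phi> (Z [^] c) = Z [^] c\<close> by (intro image_cong refl) simp
      also have "\<dots> = (\<lambda>f. inv f \<otimes> Z [^] c \<otimes> f) ` \<phi> ` (carrier F - Z_coset)" by (simp add: image_image)
      finally show ?thesis using image_Z_coset[OF \<phi>] by simp
    qed
    ultimately show ?thesis
      unfolding 1 by (rule restrict_to_classes[OF is_group H.is_subgroup A_auto[OF \<phi>] invariant[OF \<phi>] _ _ classes_zh])
  next
    case 2
    have "puncture_classes \<subseteq> H"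
    proof
      fix a assume "a \<in> puncture_classes"
      then obtain k f where k: "k \<in> {1..p}" "f \<in> carrier F" "a = conj_by F (inv (t k [^] d)) f"
        unfolding puncture_classes_def conj_class_def by blast
      then show "a \<in> H" unfolding conj_by_def
        using H.inv_op_closed1[OF k(2) H.m_inv_closed[OF t_pow_in_H[OF k(1)]]] by simp
    qed
    then show ?thesis
      unfolding 2 by (rule restrict_to_classes[OF is_group H.is_subgroup A_auto[OF \<phi>] invariant[OF \<phi>] _ image_puncture_classes[OF \<phi>] classes_th])
  qed
qed

lemma restrict_hom: "restrict_to H \<in> hom A A'"
proof (rule homI)
  fix \<phi> \<psi> assume \<phi>: "\<phi> \<in> carrier A" and \<psi>: "\<psi> \<in> carrier A"
  have "restrict_to H (compose (carrier F) \<phi> \<psi>) = compose H (restrict_to H \<phi>) (restrict_to H \<psi>)"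
  proof
    fix a
    show "restrict_to H (compose (carrier F) \<phi> \<psi>) a = compose H (restrict_to H \<phi>) (restrict_to H \<psi>) a"
    proof (cases "a \<in> H")
      case True
      then have "\<psi> a \<in> H" using invariant[OF \<psi>] by blast
      then show ?thesis using True H.mem_carrier by (simp add: restrict_to_def compose_def)
    qed (simp add: restrict_to_def compose_def)
  qed
  then show "restrict_to H (\<phi> \<otimes>\<^bsub>A\<^esub> \<psi>) = restrict_to H \<phi> \<otimes>\<^bsub>A'\<^esub> restrict_to H \<psi>"
    unfolding AM_mult[OF \<phi> \<psi>] AM_mult[OF restrict_in_A'[OF \<phi>] restrict_in_A'[OF \<psi>]] by simp
qed (rule restrict_in_A')

subsection \<open>Injectivity\<close>

definition "blocks = map (\<lambda>i. handle_block (x i) (y i)) [1..<g+1] @ map (\<lambda>k. puncture_block (t k)) [1..<p+1]"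
definition "letters = concat (map fst blocks)"
definition "Zword = concat (map (\<lambda>b. fst (snd b)) blocks)"
definition "tletters = (\<Union>b\<in>set blocks. snd (snd b))"

lemma tletters: "tletters = (\<lambda>s. (s, True)) ` t ` {1..p}"
  by (auto simp: tletters_def blocks_def handle_block_def puncture_block_def)

lemma set_letters: "set letters = B \<times> UNIV"
proof -
  have "set letters = (\<Union>i\<in>{1..g}. {x i, y i} \<times> UNIV) \<union> (\<Union>k\<in>{1..p}. {t k} \<times> UNIV)"
    by (auto simp: letters_def blocks_def handle_block_def puncture_block_def UNIV_bool)
  then show ?thesis by (auto simp: B_def C_def)
qed

text \<open>By counting: the list is as long as its set of letters is large.\<close>

lemma distinct_letters: "distinct letters"
proof -
  have "set (map x [1..<g+1] @ map y [1..<g+1] @ map t [1..<p+1]) = B" by (auto simp: B_def C_def)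
  then have "card B = 2 * g + p" using distinct_card[OF F_distinct] by simp
  then have "card (set letters) = 4 * g + 2 * p" unfolding set_letters by (simp add: card_cartesian_product)
  moreover have "length letters = 4 * g + 2 * p"
    by (simp add: letters_def blocks_def length_concat handle_block_def puncture_block_def comp_def sum_list_triv)
  ultimately show ?thesis by (intro card_distinct) simp
qed

lemma ribbon_group:
  assumes "g + p \<noteq> 0"
  shows "ribbon_group F B letters Zword tletters"
proof -
  have "blocks \<noteq> []" using assms by (auto simp: blocks_def)
  then have "ribbon_pair letters Zword tletters"
    unfolding letters_def Zword_def tletters_def
    by (rule ribbon_pair_concat)
      (auto simp: blocks_def ribbon_handle_block ribbon_puncture_block)
  moreover have "flip l \<in> set letters" if "l \<in> set letters" for l
    using that by (simp add: set_letters mem_Times_iff)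
  ultimately have "ribbon letters Zword tletters" using distinct_letters by (simp add: ribbon_def)
  then show ?thesis
    using free.free_group_axioms set_letters by (simp add: ribbon_group_def ribbon_group_axioms_def)
qed

lemma word_val_Zword: "word_val F Zword = Z"
proof -
  have cl: "set (fst (snd b)) \<subseteq> carrier F \<times> UNIV" if "b \<in> set blocks" for b
    using that gens_closed
    by (auto simp: blocks_def handle_block_def puncture_block_def image_subset_iff)
  have h: "word_val F (fst (snd (handle_block (x i) (y i)))) = comm F (x i) (y i)" if "i \<in> {1..g}" for i
  proof -
    have "x i \<in> carrier F" "y i \<in> carrier F" using that gens_closed by blast+
    then show ?thesis by (simp add: handle_block_def comm_def lval_def m_assoc)
  qed
  have k: "word_val F (fst (snd (puncture_block (t k)))) = t k" if "k \<in> {1..p}" for k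
    using t_closed[OF that] by (simp add: puncture_block_def lval_def)
  have "map (\<lambda>b. word_val F (fst (snd b))) blocks = map (\<lambda>i. comm F (x i) (y i)) [1..<g+1] @ map t [1..<p+1]"
    using h k by (simp add: blocks_def)
  then show ?thesis
    unfolding Zword_def Z_def surface_word_def using word_val_concat[of blocks, OF cl]
    by (simp only:)
qed

section \<open>The quotient by the loops around the lifted punctures\<close>

abbreviation (input) "N \<equiv> normal_closure K (th ` {1..q})"

sublocale cq: cyclic_quotient F B C d
  by unfold_locales (use d_ge_2 in \<open>auto simp: B_def C_def\<close>)

text \<open>\<open>N\<close> is a normal closure in \<open>H\<close> only, but its generators are
  conjugates in F of \<open>d\<close>-th powers of the \<open>t k\<close>, and the kernel of the
  action is closed under conjugation in F.\<close>

lemma N_act_kernel: "N \<subseteq> cq.act_kernel"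
proof
  fix a assume "a \<in> N"
  then have "a \<in> generate K (\<Union>a\<in>th ` {1..q}. conj_class K a)" by (simp add: normal_closure_def)
  moreover have gens: "e \<in> H \<and> e \<in> cq.act_kernel" if e: "e \<in> (\<Union>a\<in>th ` {1..q}. conj_class K a)" for e
  proof -
    obtain a h where a: "a \<in> th ` {1..q}" "h \<in> H" "e = conj_by K a h"
      using e by (auto simp: conj_class_def)
    then have aH: "a \<in> H" using basis_in_H by blast
    have e': "e = inv h \<otimes> a \<otimes> h" using a(2,3) H.is_subgroup by (simp add: conj_by_def m_inv_consistent)
    obtain i k where ik: "k \<in> {1..p}" "i \<in> {1..m div d}" "a = conj_by F (t k [^] d) (u i k)"
      using th_cases[OF a(1)] by blast
    have "t k [^] d \<in> cq.act_kernel" using ik(1) by (intro cq.power_in_act_kernel) (simp add: C_def)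
    then have "a \<in> cq.act_kernel"
      unfolding ik(3) conj_by_def by (rule cq.act_kernel_closed(4)) (rule basis3(2)[OF ik(1,2)])
    then have "e \<in> cq.act_kernel" unfolding e' by (rule cq.act_kernel_closed(4)) (rule H.mem_carrier[OF a(2)])
    moreover have "e \<in> H" unfolding e' using H.inv_op_closed1[OF H.mem_carrier[OF a(2)] aH] .
    ultimately show ?thesis by blast
  qed
  ultimately have "a \<in> H \<and> a \<in> cq.act_kernel"
  proof induction
    case one
    then show ?case using cq.act_kernel_closed(1) by simp
  next
    case (inv h)
    then have "h \<in> H" "h \<in> cq.act_kernel" using gens by blast+
    then show ?case using cq.act_kernel_closed(3) m_inv_consistent[OF H.is_subgroup] by simp
  next
    case (eng h1 h2)
    then show ?case using cq.act_kernel_closed(2) gens by simp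
  qed (use gens in blast)
  then show "a \<in> cq.act_kernel" by blast
qed

text \<open>Both \<open>h\<close> and its conjugate by the inverse of \<open>e\<close> lie in
  \<open>H\<close> and act like their images. Evaluating the image of the conjugate directly and
  factor by factor gives the commutation.\<close>

lemma commutes_with_H:
  assumes \<phi>: "\<phi> \<in> carrier A" and triv: "\<And>h. h \<in> H \<Longrightarrow> \<exists>n\<in>N. \<phi> h = n \<otimes> h"
    and e: "e \<in> carrier F" and h: "h \<in> H" and v: "cq.nf v"
  shows "cq.gact (inv e \<otimes> \<phi> e) (cq.gact h v) = cq.gact h (cq.gact (inv e \<otimes> \<phi> e) v)"
proof -
  interpret h: group_hom F F \<phi> by (rule autoD(1)[OF is_group A_auto[OF \<phi>]])
  have same: "cq.gact (\<phi> k) v = cq.gact k v" if k: "k \<in> H" and v: "cq.nf v" for k v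
  proof -
    obtain n where n: "n \<in> N" "\<phi> k = n \<otimes> k" using triv[OF k] by blast
    have "n \<in> cq.act_kernel" using n(1) N_act_kernel by blast
    then have "n \<in> carrier F" "cq.gact n (cq.gact k v) = cq.gact k v"
      using cq.nf_gact[OF H.mem_carrier[OF k] v] by (simp_all add: cq.act_kernel_def)
    then show ?thesis using n(2) cq.gact_mult[OF _ H.mem_carrier[OF k] v] by simp
  qed
  have hc: "h \<in> carrier F" "\<phi> e \<in> carrier F" "\<phi> h \<in> carrier F" using h H.mem_carrier e by auto
  let ?k = "e \<otimes> h \<otimes> inv e" and ?v = "cq.gact (\<phi> e) v" and ?q = "inv e \<otimes> \<phi> e"
  have k: "?k \<in> H" by (rule H.inv_op_closed2[OF e h])
  have nf: "cq.nf ?v" by (rule cq.nf_gact[OF hc(2) v])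
  have "\<phi> ?k \<otimes> \<phi> e = \<phi> e \<otimes> \<phi> h" using e hc by (simp add: m_assoc)
  then have "cq.gact (\<phi> e) (cq.gact (\<phi> h) v) = cq.gact (\<phi> ?k) ?v"
    using cq.gact_mult[of "\<phi> ?k" "\<phi> e" v] cq.gact_mult[of "\<phi> e" "\<phi> h" v] hc e v by simp
  also have "\<dots> = cq.gact ?k ?v" by (rule same[OF k nf])
  also have "\<dots> = cq.gact (?k \<otimes> \<phi> e) v" using cq.gact_mult[of ?k "\<phi> e" v] hc e v by simp
  also have "?k \<otimes> \<phi> e = e \<otimes> (h \<otimes> ?q)" using e hc by (simp add: m_assoc)
  finally have "cq.gact (\<phi> e) (cq.gact h v) = cq.gact e (cq.gact (h \<otimes> ?q) v)"
    using same[OF h v] cq.gact_mult[of e "h \<otimes> ?q" v] hc e v by simp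
  then have "cq.gact (inv e) (cq.gact (\<phi> e) (cq.gact h v)) = cq.gact (h \<otimes> ?q) v"
    using cq.gact_inv(1)[OF e cq.nf_gact[of "h \<otimes> ?q" v]] hc e v by simp
  then show ?thesis
    using cq.gact_mult[of "inv e" "\<phi> e" "cq.gact h v"] cq.gact_mult[of h ?q v] cq.nf_gact[OF hc(1) v] hc e v by simp
qed

lemma quotient_centralizer:
  assumes \<phi>: "\<phi> \<in> carrier A" and triv: "\<And>h. h \<in> H \<Longrightarrow> \<exists>n\<in>N. \<phi> h = n \<otimes> h"
    and e: "e \<in> carrier F" and big: "g + p \<noteq> 0" "(g, p) \<noteq> (0, 1)"
  shows "cq.gact (inv e \<otimes> \<phi> e) [] = []"
proof (rule cq.centralizer_trivial)
  interpret h: group_hom F F \<phi> by (rule autoD(1)[OF is_group A_auto[OF \<phi>]])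
  show "inv e \<otimes> \<phi> e \<in> carrier F" using e by simp
  show "\<exists>n\<ge>1. cq.gact (inv e \<otimes> \<phi> e) (foldr cq.act (concat (replicate n v)) []) =
      foldr cq.act (concat (replicate n v)) (cq.gact (inv e \<otimes> \<phi> e) [])"
    if v: "set v \<subseteq> B \<times> UNIV" for v
  proof (intro exI conjI)
    \<comment> \<open>The order of the finite quotient is an exponent that brings every element into
      \<open>H\<close>.\<close>
    let ?n = "order Q" and ?f = "word_val F v"
    show "1 \<le> ?n" using p.H.order_gt_0_iff_finite finite_index by auto
    have f: "?f \<in> carrier F" using v by simp
    have sub: "set (concat (replicate k v)) \<subseteq> B \<times> UNIV" for k using v by auto
    have val: "word_val F (concat (replicate k v)) = ?f [^] k" for k
    proof (induction k)
      case (Suc k)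
      then show ?case using f v sub[of k] free.word_val_append_B[of v "concat (replicate k v)"]
        by (simp add: nat_pow_Suc2[symmetric] del: nat_pow_Suc)
    qed simp
    have "?f [^] ?n \<in> H"
      using p.H.pow_order_eq_1[OF p.hom_closed[OF f]] p.hom_nat_pow[OF f] f
      by (simp add: mem_H_iff del: one_FactGroup)
    then show "cq.gact (inv e \<otimes> \<phi> e) (foldr cq.act (concat (replicate ?n v)) []) =
        foldr cq.act (concat (replicate ?n v)) (cq.gact (inv e \<otimes> \<phi> e) [])"
      using commutes_with_H[OF \<phi> triv e _ , of "?f [^] ?n" "[]"]
        cq.gact_word_val[OF sub, of "[]" ?n] cq.gact_word_val[OF sub cq.nf_gact, of "inv e \<otimes> \<phi> e" "[]" ?n]
        e val by simp
  qed
  have inj: "inj_on t {1..p}" using F_distinct by (auto simp: distinct_map atLeastLessThanSuc_atLeastAtMost)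
  \<comment> \<open>A handle provides two torsion-free generators, three punctures provide three
    finite factors, and for two punctures \<open>not_022\<close> leaves only
    \<open>d \<ge> 3\<close>.\<close>
  consider "g \<ge> 1" | "g = 0" "p \<ge> 3" | "g = 0" "p = 2" using big by fastforce
  then show "(\<exists>a\<in>B - C. \<exists>b\<in>B - C. a \<noteq> b) \<or>
      (\<exists>a\<in>C. \<exists>b\<in>C. \<exists>c\<in>C. a \<noteq> b \<and> b \<noteq> c \<and> a \<noteq> c) \<or>
      (\<exists>a\<in>C. \<exists>b\<in>C. C = {a, b} \<and> B = C \<and> a \<noteq> b \<and> 3 \<le> d)"
  proof cases
    case 1
    have "set (map x [1..<g+1]) = x ` {1..g}" "set (map y [1..<g+1]) = y ` {1..g}" "set (map t [1..<p+1]) = t ` {1..p}" by auto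
    then have disj: "x ` {1..g} \<inter> y ` {1..g} = {}" "x ` {1..g} \<inter> t ` {1..p} = {}" "y ` {1..g} \<inter> t ` {1..p} = {}"
      using F_distinct unfolding distinct_append by auto
    have x1: "x 1 \<in> x ` {1..g}" "x 1 \<notin> t ` {1..p}" and y1: "y 1 \<in> y ` {1..g}" "y 1 \<notin> t ` {1..p}"
      using 1 disj(2,3) by (auto simp: disjoint_iff)
    then have "x 1 \<noteq> y 1" using disj(1) by (metis disjoint_iff)
    moreover have "x 1 \<in> B - C" "y 1 \<in> B - C" using x1 y1 by (simp_all add: B_def C_def)
    ultimately show ?thesis by blast
  next
    case 2
    then have "t 1 \<noteq> t 2" "t 2 \<noteq> t 3" "t 1 \<noteq> t 3" "{t 1, t 2, t 3} \<subseteq> C"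
      using inj_onD[OF inj, of 1 2] inj_onD[OF inj, of 2 3] inj_onD[OF inj, of 1 3] by (auto simp: C_def)
    then show ?thesis by blast
  next
    case 3
    have "{1..p} = {1, 2}" using 3 by auto
    then have "C = {t 1, t 2}" by (simp add: C_def)
    moreover have "t 1 \<noteq> t 2" using inj_onD[OF inj, of 1 2] 3 by auto
    moreover have "3 \<le> d" using d_ge_2[of 1] not_022 3 by auto
    moreover have "B = C" unfolding B_def using 3(1) by auto
    moreover have "t 1 \<in> C" "t 2 \<in> C" using \<open>C = {t 1, t 2}\<close> by simp_all
    ultimately show ?thesis by blast
  qed
qed

lemma fixes_basis:
  assumes \<phi>: "\<phi> \<in> carrier A" and triv: "\<And>h. h \<in> H \<Longrightarrow> \<exists>n\<in>N. \<phi> h = n \<otimes> h" and e: "e \<in> B"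
  shows "\<phi> e = e"
proof (cases "(g, p) = (0, 1)")
  case True
  \<comment> \<open>Here centralizers are no obstruction to be overcome: the boundary word is the
    only generator.\<close>
  then have "e = t 1" using e unfolding B_def C_def by auto
  moreover have "Z = t 1" using True t_closed[of 1] by (simp add: Z_def surface_word_def upt_Suc)
  ultimately show ?thesis using A_fix_Z[OF \<phi>] by simp
next
  case False
  have gp: "g + p \<noteq> 0" using e by (auto simp: B_def C_def)
  interpret h: group_hom F F \<phi> by (rule autoD(1)[OF is_group A_auto[OF \<phi>]])
  interpret ribbon_group F B letters Zword tletters by (rule ribbon_group[OF gp])
  have conj: "\<exists>s'\<in>tletters. \<exists>h\<in>carrier F. \<phi> (lval s) = h \<otimes> lval s' \<otimes> inv h" if s: "s \<in> tletters" for s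
  proof -
    obtain k where k: "k \<in> {1..p}" "s = (t k, True)" using s tletters by auto
    obtain k' h where h: "k' \<in> {1..p}" "h \<in> carrier F" "\<phi> (t k) = conj_by F (t k') h"
      using A_conj[OF \<phi> k(1)] by blast
    have "(t k', True) \<in> tletters" using h(1) tletters by blast
    \<comment> \<open>\<open>conj_by\<close> conjugates from the right, whereas
      \<open>ribbon_aut\<close> expects the conjugating element on the left; hence
      \<open>inv h\<close>.\<close>
    moreover have "\<phi> (lval s) = inv h \<otimes> lval (t k', True) \<otimes> inv (inv h)"
      using h k by (simp add: lval_def conj_by_def)
    ultimately show ?thesis using h(2) by blast
  qed
  interpret ribbon_aut F B letters Zword tletters \<phi>
    using conj autoD(2)[OF is_group A_auto[OF \<phi>]] A_fix_Z[OF \<phi>] word_val_Zword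
    by unfold_locales (auto simp: gZ_def)
  have ec: "e \<in> carrier F" using e free.basis_closed by blast
  have q: "cq.gact (inv e \<otimes> \<phi> e) [] = []" by (rule quotient_centralizer[OF \<phi> triv ec gp False])
  let ?w = "free.word_of (\<phi> e)"
  have "\<phi> e = e \<otimes> (inv e \<otimes> \<phi> e)" using ec by simp
  then have "cq.gact (\<phi> e) [] = cq.gact e []"
    using cq.gact_mult[of e "inv e \<otimes> \<phi> e" "[]"] q ec by simp
  also have "\<dots> = [(e, True)]"
  proof -
    have "take (d - 1) [] \<noteq> replicate (d - 1) (e, True)" if "e \<in> C"
      using cq.d_pos[OF that] by (cases "d - 1") auto
    then have "cq.act (e, True) [] = [(e, True)]" using e by (intro cq.act_Cons) auto
    moreover have "free.word_of e = [(e, True)]" using free.word_of_lval[of "(e, True)"] e by (simp add: lval_def)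
    ultimately show ?thesis by (simp add: cq.gact_def)
  qed
  finally have act: "foldr cq.act ?w [] = [(e, True)]" by (simp add: cq.gact_def)
  have \<phi>e: "\<phi> e = \<phi> (lval (e, True))" by (simp add: lval_def)
  have "\<not> adj ?w l l" if "fst l \<in> C" for l
  proof (cases "snd l")
    case True
    then have "l = (fst l, True)" by (simp add: prod_eq_iff)
    then have "l \<in> tletters" unfolding tletters C_def[symmetric] by (rule image_eqI[OF _ that])
    then show ?thesis using image_no_T_square[of "(e, True)" l] e unfolding \<phi>e adj_def by simp
  next
    case False
    then have "flip l = (fst l, True)" by (simp add: flip_def)
    then have "flip l \<in> tletters" unfolding tletters C_def[symmetric] by (rule image_eqI[OF _ that])
    then show ?thesis using image_no_flip_T_square[of "(e, True)" "flip l"] e unfolding \<phi>e adj_def by simp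
  qed
  \<comment> \<open>The second case is the ambiguity for \<open>d = 2\<close>: modulo
    \<open>N\<close> a puncture generator may equal its inverse.\<close>
  then have "?w = [(e, True)] \<or> (e \<in> C \<and> ?w = [(e, False)])"
    using cq.square_free_letter[of ?w "(e, True)"] free.word_of_sub[of "\<phi> e"] free.word_of_red[of "\<phi> e"] ec act by simp
  then show ?thesis
  proof
    assume "?w = [(e, True)]"
    then have "?w = free.word_of e" using free.word_of_lval[of "(e, True)"] e by (simp add: lval_def)
    then show ?thesis using free.word_of_inj[of "\<phi> e" e] ec by simp
  next
    assume *: "e \<in> C \<and> ?w = [(e, False)]"
    then obtain k k' h where k: "k' \<in> {1..p}" "h \<in> carrier F" "\<phi> e = conj_by F (t k') h"
      using A_conj[OF \<phi>] unfolding C_def by blast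
    \<comment> \<open>A conjugate of a puncture generator has exponent sum 1, an inverse letter has
      -1.\<close>
    have "free.exponent_sum (\<phi> e) = free.exponent_sum (t k')" using free.exponent_sum_conj t_closed k by simp
    moreover have "free.exponent_sum (\<phi> e) = -1" using * by (simp add: free.exponent_sum_def)
    moreover have "free.word_of (t k') = [(t k', True)]"
      using free.word_of_lval[of "(t k', True)"] k(1) by (simp add: lval_def B_def C_def)
    then have "free.exponent_sum (t k') = 1" by (simp add: free.exponent_sum_def)
    ultimately show ?thesis by simp
  qed
qed

lemma elimination: "puncture_elimination K xh yh g' (map zh [1..<b]) (map th [1..<q+1]) N"
proof -
  have "set (map th [1..<q+1]) = th ` {1..q}" by auto
  then show ?thesis
    using K_group hat_closed
    by (simp add: puncture_elimination_def puncture_elimination_axioms_def)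
qed

lemma composition_inj: "inj_on (induced_on_quotient K N \<circ> restrict_to H) (carrier A)"
proof (rule inj_onI)
  fix \<phi> \<psi> assume \<phi>: "\<phi> \<in> carrier A" and \<psi>: "\<psi> \<in> carrier A"
    and eq: "(induced_on_quotient K N \<circ> restrict_to H) \<phi> = (induced_on_quotient K N \<circ> restrict_to H) \<psi>"
  interpret A: group A by (rule A_group)
  interpret e: puncture_elimination K xh yh g' "map zh [1..<b]" "map th [1..<q+1]" N by (rule elimination)
  let ?A'' = "AM (K Mod N) g' (\<lambda>i. N #>\<^bsub>K\<^esub> xh i) (\<lambda>i. N #>\<^bsub>K\<^esub> yh i) [map (\<lambda>z. N #>\<^bsub>K\<^esub> z) (map zh [1..<b])]"
  let ?c = "\<lambda>\<phi>. induced_on_quotient K N (restrict_to H \<phi>)"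
  have c_mult: "?c (\<alpha> \<otimes>\<^bsub>A\<^esub> \<beta>) = ?c \<alpha> \<otimes>\<^bsub>?A''\<^esub> ?c \<beta>" if "\<alpha> \<in> carrier A" "\<beta> \<in> carrier A" for \<alpha> \<beta>
    using that hom_mult[OF restrict_hom] hom_mult[OF e.induced_hom] restrict_in_A' by simp
  \<comment> \<open>Equal images of \<open>\<phi>\<close> and \<open>\<psi>\<close> become a trivial
    image of this element, since both maps in the composition are multiplicative. The trivial image
    is compared with that of the identity, which gives the congruence modulo \<open>N\<close> on
    \<open>H\<close>.\<close>
  let ?\<omega> = "inv\<^bsub>A\<^esub> \<psi> \<otimes>\<^bsub>A\<^esub> \<phi>"
  have \<omega>: "?\<omega> \<in> carrier A" by (rule A.m_closed[OF A.inv_closed[OF \<psi>] \<phi>])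
  have "?c ?\<omega> = ?c (inv\<^bsub>A\<^esub> \<psi> \<otimes>\<^bsub>A\<^esub> \<psi>)"
    unfolding c_mult[OF A.inv_closed[OF \<psi>] \<phi>] c_mult[OF A.inv_closed[OF \<psi>] \<psi>]
    using eq by (simp only: o_apply)
  then have c_one: "?c ?\<omega> = ?c \<one>\<^bsub>A\<^esub>" unfolding A.l_inv[OF \<psi>] .
  have one: "\<one>\<^bsub>A\<^esub> = (\<lambda>a\<in>carrier F. a)" by (simp add: AM_def AutoGroup_def BijGroup_def)
  have "\<exists>n\<in>N. ?\<omega> h = n \<otimes> h" if h: "h \<in> H" for h
  proof -
    have "N #>\<^bsub>K\<^esub> restrict_to H ?\<omega> h = N #>\<^bsub>K\<^esub> restrict_to H \<one>\<^bsub>A\<^esub> h"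
      using e.induced_proj[OF restrict_in_A'[OF \<omega>], of h] e.induced_proj[OF restrict_in_A'[OF A.one_closed], of h] c_one h
      by simp
    then have "N #>\<^bsub>K\<^esub> ?\<omega> h = N #>\<^bsub>K\<^esub> h" using h H.mem_carrier one by (simp add: restrict_to_def)
    moreover have "?\<omega> h \<in> H" using invariant[OF \<omega>] h by blast
    ultimately show ?thesis using e.proj_eq_iff[of "?\<omega> h" h] h by simp
  qed
  then have "?\<omega> s = s" if "s \<in> B" for s using fixes_basis[OF \<omega> _ that] by blast
  then have "?\<omega> f = f" if "f \<in> carrier F" for f
    using free.auto_fixing_basis[OF A_auto[OF \<omega>] _ that] by blast
  then have "?\<omega> = \<one>\<^bsub>A\<^esub>"
    using autoD(3)[OF is_group A_auto[OF \<omega>]] unfolding one by (intro extensionalityI[of _ "carrier F"]) auto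
  then have "\<psi> \<otimes>\<^bsub>A\<^esub> ?\<omega> = \<psi>" using A.r_one[OF \<psi>] by (simp only:)
  then show "\<phi> = \<psi>"
    unfolding A.m_assoc[OF \<psi> A.inv_closed[OF \<psi>] \<phi>, symmetric] A.r_inv[OF \<psi>] A.l_one[OF \<phi>] .
qed

end

lemma disjoint_union_cong:
  assumes "\<And>i. i \<in> I \<Longrightarrow> A i = A' i" "disjoint_union S I A"
  shows "disjoint_union S I A'"
  using assms unfolding disjoint_union_def disjoint_family_on_def by simp

theorem theorem2p2:
  fixes F :: "('a, 'm) monoid_scheme"
    and g p g' b q m c d :: nat
    and x y t xh yh zh th w :: "nat \<Rightarrow> 'a"
    and u :: "nat \<Rightarrow> nat \<Rightarrow> 'a"
    and dk :: "nat \<Rightarrow> nat"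
    and Z :: 'a
    and H N :: "'a set"
    and \<Sigma>' :: "('a, 'm) monoid_scheme"
    and Q :: "'a set monoid"
  assumes F_group: "group F"
    and F_distinct: "distinct (map x [1..<g+1] @ map y [1..<g+1] @ map t [1..<p+1])"
    and F_free: "free_basis F (x ` {1..g} \<union> y ` {1..g} \<union> t ` {1..p})"
    and Z_def: "Z = surface_word F g x y (map t [1..<p+1])"
    and H_normal: "H \<lhd> F"
    and Q_def: "Q = F Mod H"
    and index: "finite (carrier Q)" "order Q = m"
    and c_def: "c = group.ord Q (H #>\<^bsub>F\<^esub> Z)"
    and b_def: "b = m div c"
    and branching: "\<And>k. k \<in> {1..p} \<Longrightarrow> t k \<notin> H"
    and dk_def: "\<And>k. k \<in> {1..p} \<Longrightarrow> dk k = group.ord Q (H #>\<^bsub>F\<^esub> t k)"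
    and \<Sigma>'_def: "\<Sigma>' = F\<lparr>carrier := H\<rparr>"
    and \<Sigma>'_distinct: "distinct (map xh [1..<g'+1] @ map yh [1..<g'+1] @ map zh [1..<b] @ map th [1..<q+1])"
    and \<Sigma>'_free: "free_basis \<Sigma>' (xh ` {1..g'} \<union> yh ` {1..g'} \<union> zh ` {1..<b} \<union> th ` {1..q})"
    and basis1: "surface_word F g' xh yh (map zh [1..<b] @ map th [1..<q+1]) = Z [^]\<^bsub>F\<^esub> c"
    and basis2: "\<And>l. l \<in> {1..<b} \<Longrightarrow>
          w l \<in> carrier F - H \<and> zh l = conj_by F (inv\<^bsub>F\<^esub> (Z [^]\<^bsub>F\<^esub> c)) (w l)"
      "disjoint_union (carrier Q) {1..b}
          (\<lambda>l. if l < b then generate Q {H #>\<^bsub>F\<^esub> Z} #>\<^bsub>Q\<^esub> (H #>\<^bsub>F\<^esub> w l)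
               else generate Q {H #>\<^bsub>F\<^esub> Z})"
    and basis3: "disjoint_union (th ` {1..q}) {1..p}
          (\<lambda>k. (\<lambda>i. conj_by F (t k [^]\<^bsub>F\<^esub> dk k) (u i k)) ` {1..m div dk k})"
      "\<And>i k. k \<in> {1..p} \<Longrightarrow> i \<in> {1..m div dk k} \<Longrightarrow> u i k \<in> carrier F"
      "\<And>k. k \<in> {1..p} \<Longrightarrow> disjoint_union (carrier Q) {1..m div dk k}
          (\<lambda>i. generate Q {H #>\<^bsub>F\<^esub> t k} #>\<^bsub>Q\<^esub> (H #>\<^bsub>F\<^esub> u i k))"
    and N_def: "N = normal_closure \<Sigma>' (th ` {1..q})"
    and invariant: "\<And>\<phi>. \<phi> \<in> carrier (AM F g x y [map t [1..<p+1]]) \<Longrightarrow> \<phi> ` H = H"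
    and d_common: "\<And>k. k \<in> {1..p} \<Longrightarrow> dk k = d"
    and not_022: "(g, p, d) \<noteq> (0, 2, 2)"
  shows "restrict_to H \<in>
           hom (AM F g x y [map t [1..<p+1]])
               (AM \<Sigma>' g' xh yh [map zh [1..<b], map th [1..<q+1]]) \<and>
         induced_on_quotient \<Sigma>' N \<in>
           hom (AM \<Sigma>' g' xh yh [map zh [1..<b], map th [1..<q+1]])
               (AM (\<Sigma>' Mod N) g' (\<lambda>i. N #>\<^bsub>\<Sigma>'\<^esub> xh i) (\<lambda>i. N #>\<^bsub>\<Sigma>'\<^esub> yh i)
                  [map (\<lambda>l. N #>\<^bsub>\<Sigma>'\<^esub> zh l) [1..<b]]) \<and>
         inj_on (induced_on_quotient \<Sigma>' N \<circ> restrict_to H)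
           (carrier (AM F g x y [map t [1..<p+1]]))"
proof -
  have basis_in_H: "xh ` {1..g'} \<union> yh ` {1..g'} \<union> zh ` {1..<b} \<union> th ` {1..q} \<subseteq> H"
    using \<Sigma>'_free by (simp add: free_basis_def \<Sigma>'_def)
  have conjugates: "disjoint_union (th ` {1..q}) {1..p}
      (\<lambda>k. (\<lambda>i. conj_by F (t k [^]\<^bsub>F\<^esub> d) (u i k)) ` {1..m div d})"
    by (rule disjoint_union_cong[OF _ basis3(1)]) (simp only: d_common)
  interpret cover F g p g' b q m c d x y t xh yh zh th w u Z H
  proof (intro cover.intro cover_axioms.intro)
    show "group F" "H \<lhd> F" by fact+
    show "finite (carrier (F Mod H))" using index(1) unfolding Q_def .
    show "c = group.ord (F Mod H) (H #>\<^bsub>F\<^esub> Z)" using c_def unfolding Q_def .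
    show "d = group.ord (F Mod H) (H #>\<^bsub>F\<^esub> t k)" if "k \<in> {1..p}" for k
      using dk_def[OF that] d_common[OF that] unfolding Q_def by simp
    show "u i k \<in> carrier F" if "k \<in> {1..p}" "i \<in> {1..m div d}" for i k
      using basis3(2)[OF that(1), of i] that d_common[OF that(1)] by simp
    show "disjoint_union (carrier (F Mod H)) {1..m div d}
        (\<lambda>i. generate (F Mod H) {H #>\<^bsub>F\<^esub> t k} #>\<^bsub>F Mod H\<^esub> (H #>\<^bsub>F\<^esub> u i k))" if "k \<in> {1..p}" for k
      using basis3(3)[OF that] d_common[OF that] unfolding Q_def by simp
  qed (use F_distinct F_free Z_def branching basis_in_H basis1 basis2[unfolded Q_def] conjugates
      invariant not_022 in blast)+
  interpret elim: puncture_elimination "F\<lparr>carrier := H\<rparr>" xh yh g' "map zh [1..<b]" "map th [1..<q+1]"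
    "normal_closure (F\<lparr>carrier := H\<rparr>) (th ` {1..q})"
    by (rule elimination)
  show ?thesis
    unfolding N_def \<Sigma>'_def
    using restrict_hom elim.induced_hom composition_inj unfolding map_map comp_def by blast
qed

end
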